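(* The space $\mathcal{G}^{\mathbb{C}}_{N,d}$ is path-connected for all integers $N$ and $d$ satisfying $N\geq d\geq 1$, and $\mathcal{G}^{\mathbb{R}}_{N,d}$ is path-connected for all integers $N$ and $d$ satisfying $d\geq 2$ and $N\geq d+2$.
   Context: For $\mathbb{F}=\mathbb{R}$ or $\mathbb{C}$, $\mathcal{G}^{\mathbb{F}}_{N,d}$ denotes the set of rank $d$ orthogonal projections on $\mathbb{F}^N$ (as $N\times N$ matrices over $\mathbb{F}$) with all diagonal entries equal to $d/N$, with the topology inherited from the Euclidean space of $N\times N$ matrices over $\mathbb{F}$. *)

theory Defs
  imports "HOL-Analysis.Analysis"
begin

text \<open>
  The dimension \<open>N\<close> is \<open>CARD('n)\<close>. The Euclidean topology on \<open>N \<times> N\<close> matrices is the library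
  topology of the types \<open>real^'n^'n\<close> and \<open>complex^'n^'n\<close>. \<open>rank\<close> is the rank over the
  entry field, so in the complex case it is the complex rank.
\<close>

definition conj_transpose :: "complex^'n^'m \<Rightarrow> complex^'m^'n" where
  "conj_transpose A = (\<chi> i j. cnj (A $ j $ i))"

definition orth_proj_real :: "real^'n^'n \<Rightarrow> bool" where
  "orth_proj_real P \<longleftrightarrow> P ** P = P \<and> transpose P = P"

definition orth_proj_complex :: "complex^'n^'n \<Rightarrow> bool" where
  "orth_proj_complex P \<longleftrightarrow> P ** P = P \<and> conj_transpose P = P"

definition G_real :: "nat \<Rightarrow> (real^'n^'n) set" where
  "G_real d = {P. orth_proj_real P \<and> rank P = d \<and>
                  (\<forall>i. P $ i $ i = of_nat d / of_nat CARD('n))}"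

definition G_complex :: "nat \<Rightarrow> (complex^'n^'n) set" where
  "G_complex d = {P. orth_proj_complex P \<and> rank P = d \<and>
                     (\<forall>i. P $ i $ i = of_nat d / of_nat CARD('n))}"

end

theory Submission
  imports Defs
begin

text \<open>
  Real symmetric and complex Hermitian matrices are treated together. Let \<open>projs a\<close> be the set of
  orthogonal projections with diagonal \<open>a\<close>.

  Near \<open>Q\<close> in \<open>projs a\<close> every projection is \<open>Q + (1 - 2 Q) X\<^sup>2 + X sqrt (1 - X\<^sup>2)\<close> for a tangent vector \<open>X\<close>.
  In this chart the traces over the connected components of the support graph of \<open>Q\<close> are exactly
  quadratic, so \<open>X \<mapsto> s X\<close> keeps them fixed, and the remaining diagonal error can be removed by
  plane rotations along a spanning tree. Hence \<open>projs a\<close> is locally path connected, even at its singular points,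
  and its path components are compact.

  Minimizing the real part of an entry \<open>P $ x $ y\<close> over a path component, a Lagrange multiplier and one
  explicit second-order direction show that a negative minimum makes the \<open>2 \<times> 2\<close> block at \<open>x, y\<close>
  extremal: it has eigenvalue 0 or 1. A fixed rotation of the plane of \<open>x, y\<close> then turns one of the two
  diagonal entries into 0 or 1 and decouples it. By induction, conjugation with diagonal unitary matrices acts
  transitively on the path components. For complex matrices these form a connected torus. For real
  matrices they are sign changes, and a special projection (two equal rows, both orthogonal to
  a third one) shows that each of them preserves every component.
\<close>

section \<open>Fields with conjugation and matrices over them\<close>

text \<open>At \<open>Q\<close> the diagonal map, into diagonals of fixed trace, is a submersion
  only if the support graph of \<open>Q\<close> is connected: a real diagonal matrix constant on its
  components commutes with \<open>Q\<close> and is orthogonal to all tangent directions. Closedness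
  of path components thus needs more than a manifold structure, namely the exact quadratic form of
  the component traces.

  General diagonals \<open>a\<close> appear because the induction leaves the constant ones. What
  survives is that, away from one index, every diagonal value is 0, 1 or a fixed \<open>c\<close>.
  Two indices with equal value and vanishing entry can be rotated into each other freely, and this
  is the means of making a prescribed entry nonzero.

  In the real case the obstacle is parity. Half turns of a plane flip two signs at once, so flips of
  pairs are easy to get; a single flip needs an odd relation. Modulo pairs, a quarter turn makes a
  transposition act as one flip, and the equal rows provide a product of three such transpositions
  that acts trivially.\<close>

class conj_field = real_normed_field + euclidean_space +
  fixes cj :: "'a \<Rightarrow> 'a"
  assumes cj_add: "cj (x + y) = cj x + cj y"
    and cj_mult: "cj (x * y) = cj x * cj y"
    and cj_cj [simp]: "cj (cj x) = x"
    and mult_cj_scaleR: "x * cj x = scaleR ((norm x)\<^sup>2) 1"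
    and scaleR_inner: "scaleR (2 * inner x y) 1 = x * cj y + y * cj x"

instantiation real :: conj_field
begin
definition cj_real :: "real \<Rightarrow> real" where "cj_real x = x"
instance by standard (auto simp: cj_real_def power2_eq_square)
end

instantiation complex :: conj_field
begin
definition cj_complex :: "complex \<Rightarrow> complex" where "cj_complex = cnj"
instance 
proof
  fix x y :: complex
  show "x * cj x = scaleR ((norm x)\<^sup>2) 1"
    using complex_norm_square[of x] by (simp add: cj_complex_def scaleR_conv_of_real)
  show "scaleR (2 * inner x y) 1 = x * cj y + y * cj x"
    by (simp add: cj_complex_def complex_eq_iff inner_complex_def)
qed (auto simp: cj_complex_def)
end

definition rp :: "'a::conj_field \<Rightarrow> real" where "rp x = inner 1 x"

context
  fixes x y :: "'a::conj_field"
begin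

lemma mult_cj: "x * cj x = of_real ((norm x)\<^sup>2)"
  by (simp add: mult_cj_scaleR of_real_def)

lemma cj_mult_self: "cj x * x = of_real ((norm x)\<^sup>2)"
  using mult_cj by (simp add: mult.commute)

lemma of_real_inner: "of_real (2 * inner x y) = x * cj y + y * cj x"
  using scaleR_inner by (simp add: of_real_def)
end

lemma cj_0 [simp]: "cj 0 = (0::'a::conj_field)"
  using cj_add[of "0::'a" 0] by simp

lemma cj_minus [simp]: "cj (- x) = - cj (x::'a::conj_field)"
  using cj_add[of "- x" x] by (simp add: eq_neg_iff_add_eq_0)

lemma cj_diff: "cj (x - y) = cj x - cj (y::'a::conj_field)"
  using cj_add[of x "- y"] by simp

lemma cj_1 [simp]: "cj 1 = (1::'a::conj_field)"
  using mult_cj[of "1::'a"] by simp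

lemma cj_of_real [simp]: "cj (of_real r) = (of_real r::'a::conj_field)"
proof (cases "r = 0")
  case False
  have "of_real r * cj (of_real r) = (of_real r * of_real r :: 'a)"
    using mult_cj[of "of_real r::'a"] by (simp add: power2_eq_square)
  then show ?thesis using False by simp
qed simp

lemma cj_scaleR [simp]: "cj (r *\<^sub>R x) = r *\<^sub>R cj (x::'a::conj_field)"
  by (simp add: scaleR_conv_of_real cj_mult)

lemma norm_cj [simp]: "norm (cj x) = norm (x::'a::conj_field)"
proof -
  have "of_real ((norm (cj x))\<^sup>2) = (of_real ((norm x)\<^sup>2) :: 'a)"
    using mult_cj[of "cj x"] mult_cj[of x] by (simp add: mult.commute)
  then show ?thesis by (simp only: of_real_eq_iff power2_eq_iff_nonneg norm_ge_zero)
qed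

lemma cj_eq_0_iff [simp]: "cj x = 0 \<longleftrightarrow> x = (0::'a::conj_field)"
  by (metis cj_0 cj_cj)

lemma cj_sum: "cj (sum f A) = (\<Sum>i\<in>A. cj (f i :: 'a::conj_field))"
  by (induction A rule: infinite_finite_induct) (auto simp: cj_add)

lemma bounded_linear_cj: "bounded_linear (cj :: 'a::conj_field \<Rightarrow> 'a)"
  by (rule bounded_linear_intro[where K = 1]) (auto simp: cj_add)

lemma rp_add: "rp (x + y) = rp x + rp y" by (simp add: rp_def inner_right_distrib)
lemma rp_0 [simp]: "rp 0 = 0" by (simp add: rp_def)
lemma rp_minus [simp]: "rp (- x) = - rp x" by (simp add: rp_def)
lemma rp_diff: "rp (x - y) = rp x - rp y" by (simp add: rp_def inner_diff_right)
lemma rp_scaleR [simp]: "rp (r *\<^sub>R x) = r * rp x" by (simp add: rp_def)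
lemma rp_sum: "rp (sum f A) = (\<Sum>i\<in>A. rp (f i))" by (simp add: rp_def inner_sum_right)
lemma rp_of_real [simp]: "rp (of_real r) = r"
  by (simp add: rp_def of_real_def dot_square_norm)
lemma rp_1 [simp]: "rp 1 = 1"
  using rp_of_real[of 1] by simp

lemma of_real_rp: "of_real (2 * rp x) = x + cj x"
  using of_real_inner[of 1 x] by (simp add: rp_def add.commute)

lemma rp_cj [simp]: "rp (cj x) = rp (x::'a::conj_field)"
proof -
  have "of_real (2 * rp (cj x)) = (of_real (2 * rp x)::'a)"
    by (simp only: of_real_rp cj_cj add.commute)
  then show ?thesis unfolding of_real_eq_iff by simp
qed

lemma real_iff_cj: "cj x = x \<longleftrightarrow> x = of_real (rp (x::'a::conj_field))"
proof
  assume "cj x = x"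
  then have "of_real (2 * rp x) = of_real 2 * x"
    using of_real_rp[of x] by (simp only: mult_2[symmetric] of_real_numeral)
  then have "of_real 2 * of_real (rp x) = of_real 2 * x" by (simp only: of_real_mult)
  then show "x = of_real (rp x)" by simp
qed (metis cj_of_real)

lemma inner_eq_rp: "inner x y = rp (cj x * (y::'a::conj_field))"
proof -
  have "of_real (2 * inner x y) = (of_real (2 * rp (cj x * y))::'a)"
    unfolding of_real_inner of_real_rp by (simp add: cj_mult mult.commute add.commute)
  then show ?thesis unfolding of_real_eq_iff by simp
qed

lemma bounded_linear_rp: "bounded_linear (rp :: 'a::conj_field \<Rightarrow> real)"
  unfolding rp_def by (rule bounded_linear_inner_right)

section \<open>Adjoints, the Frobenius norm and the real trace inner product\<close>

definition adj :: "'a::conj_field^'n^'m \<Rightarrow> 'a^'m^'n" where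
  "adj A = (\<chi> i j. cj (A $ j $ i))"

lemma adj_nth [simp]: "adj A $ i $ j = cj (A $ j $ i)"
  by (simp add: adj_def)

lemma adj_adj [simp]: "adj (adj A) = A" by (simp add: vec_eq_iff)
lemma adj_0 [simp]: "adj 0 = 0" by (simp add: vec_eq_iff)
lemma adj_add: "adj (A + B) = adj A + adj B" by (simp add: vec_eq_iff cj_add)
lemma adj_diff: "adj (A - B) = adj A - adj B" by (simp add: vec_eq_iff cj_diff)
lemma adj_scaleR [simp]: "adj (r *\<^sub>R A) = r *\<^sub>R adj A" by (simp add: vec_eq_iff)
lemma adj_mat_1 [simp]: "adj (mat 1) = mat 1" by (auto simp: vec_eq_iff mat_def)
lemma adj_mult: "adj (A ** B) = adj B ** adj A"
  by (simp add: vec_eq_iff matrix_matrix_mult_def cj_sum cj_mult mult.commute)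

lemma norm_mat_sq: "(norm (A::'a::conj_field^'n^'m))\<^sup>2 = (\<Sum>i\<in>UNIV. \<Sum>j\<in>UNIV. (norm (A $ i $ j))\<^sup>2)"
  by (simp add: norm_vec_def L2_set_def sum_nonneg)

lemma norm_adj [simp]: "norm (adj A) = norm (A::'a::conj_field^'n^'m)"
proof (rule power2_eq_imp_eq)
  show "(norm (adj A))\<^sup>2 = (norm A)\<^sup>2"
    unfolding norm_mat_sq adj_nth norm_cj by (rule sum.swap)
qed simp_all

lemma norm_entry_le: "norm (A $ i $ j) \<le> norm (A::'a::conj_field^'n^'m)"
  by (rule order_trans[OF Finite_Cartesian_Product.norm_nth_le Finite_Cartesian_Product.norm_nth_le])

lemma norm_mm:
  fixes A :: "'a::conj_field^'k^'m" and B :: "'a^'n^'k"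
  shows "norm (A ** B) \<le> norm A * norm B"
proof (rule power2_le_imp_le)
  have "(norm (A ** B))\<^sup>2 = (\<Sum>i\<in>UNIV. \<Sum>j\<in>UNIV. (norm (\<Sum>k\<in>UNIV. A$i$k * B$k$j))\<^sup>2)"
    unfolding norm_mat_sq by (simp add: matrix_matrix_mult_def)
  also have "\<dots> \<le> (\<Sum>i\<in>UNIV. \<Sum>j\<in>UNIV. (\<Sum>k\<in>UNIV. (norm (A$i$k))\<^sup>2) * (\<Sum>k\<in>UNIV. (norm (B$k$j))\<^sup>2))"
  proof (intro sum_mono)
    fix i j
    have "norm (\<Sum>k\<in>UNIV. A$i$k * B$k$j) \<le> (\<Sum>k\<in>UNIV. norm (A$i$k) * norm (B$k$j))"
      by (rule order_trans[OF norm_sum]) (simp add: norm_mult)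
    then have "(norm (\<Sum>k\<in>UNIV. A$i$k * B$k$j))\<^sup>2 \<le> (\<Sum>k\<in>UNIV. norm (A$i$k) * norm (B$k$j))\<^sup>2"
      by (intro power_mono) auto
    also have "\<dots> \<le> (\<Sum>k\<in>UNIV. (norm (A$i$k))\<^sup>2) * (\<Sum>k\<in>UNIV. (norm (B$k$j))\<^sup>2)"
      by (rule Cauchy_Schwarz_ineq_sum)
    finally show "(norm (\<Sum>k\<in>UNIV. A$i$k * B$k$j))\<^sup>2 \<le> \<dots>" .
  qed
  also have "\<dots> = (\<Sum>i\<in>UNIV. \<Sum>k\<in>UNIV. (norm (A$i$k))\<^sup>2) * (\<Sum>j\<in>UNIV. \<Sum>k\<in>UNIV. (norm (B$k$j))\<^sup>2)"
    by (simp only: sum_product)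
  also have "(\<Sum>j\<in>UNIV. \<Sum>k\<in>UNIV. (norm (B$k$j))\<^sup>2) = (norm B)\<^sup>2"
    unfolding norm_mat_sq by (rule sum.swap)
  finally show "(norm (A ** B))\<^sup>2 \<le> (norm A * norm B)\<^sup>2"
    by (simp add: norm_mat_sq power_mult_distrib)
qed simp

interpretation mm: bounded_bilinear "(**) :: 'a::conj_field^'k^'m \<Rightarrow> 'a^'n^'k \<Rightarrow> 'a^'n^'m"
proof
  show "\<exists>K. \<forall>a b. norm ((a::'a^'k^'m) ** (b::'a^'n^'k)) \<le> norm a * norm b * K"
    by (rule exI[of _ 1]) (simp add: norm_mm)
qed (simp_all add: vec_eq_iff matrix_matrix_mult_def algebra_simps sum.distrib scaleR_sum_right)

lemma bounded_linear_adj: "bounded_linear (adj :: 'a::conj_field^'n^'m \<Rightarrow> 'a^'m^'n)"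
  by (rule bounded_linear_intro[where K = 1]) (auto simp: adj_add)

lemmas continuous_on_adj [continuous_intros] = bounded_linear.continuous_on[OF bounded_linear_adj]
lemmas continuous_on_mm [continuous_intros] = mm.continuous_on

lemma inner_mat: "(A::'a::conj_field^'n^'m) \<bullet> B = (\<Sum>i\<in>UNIV. \<Sum>j\<in>UNIV. rp (cj (A$i$j) * B$i$j))"
  by (simp add: inner_vec_def inner_eq_rp)

lemma inner_adj: "adj A \<bullet> adj B = (A::'a::conj_field^'n^'m) \<bullet> B"
proof -
  have *: "rp (cj (cj x) * cj y) = rp (cj x * y)" for x y :: 'a
    using rp_cj[of "cj x * y"] by (simp only: cj_cj cj_mult)
  show ?thesis unfolding inner_mat adj_nth * by (rule sum.swap)
qed

text \<open>The Euclidean inner product of matrices is the real part of the trace of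
  \<open>adj A ** B\<close>, so moving a factor across it costs an adjoint. Later trace computations
  run through this rule and its mirror image.\<close>

lemma inner_mm_right:
  fixes A :: "'a::conj_field^'k^'m" and B :: "'a^'n^'k"
  shows "(A ** B) \<bullet> C = B \<bullet> (adj A ** C)"
proof -
  have "(A ** B) \<bullet> C = (\<Sum>i\<in>UNIV. \<Sum>j\<in>UNIV. \<Sum>k\<in>UNIV. rp (cj (A$i$k) * cj (B$k$j) * C$i$j))"
    unfolding inner_mat
    by (simp add: matrix_matrix_mult_def cj_sum cj_mult sum_distrib_right rp_sum)
  also have "\<dots> = (\<Sum>j\<in>UNIV. \<Sum>i\<in>UNIV. \<Sum>k\<in>UNIV. rp (cj (A$i$k) * cj (B$k$j) * C$i$j))"
    by (rule sum.swap)
  also have "\<dots> = (\<Sum>j\<in>UNIV. \<Sum>k\<in>UNIV. \<Sum>i\<in>UNIV. rp (cj (A$i$k) * cj (B$k$j) * C$i$j))"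
    by (intro sum.cong refl sum.swap)
  also have "\<dots> = (\<Sum>k\<in>UNIV. \<Sum>j\<in>UNIV. \<Sum>i\<in>UNIV. rp (cj (A$i$k) * cj (B$k$j) * C$i$j))"
    by (rule sum.swap)
  also have "\<dots> = B \<bullet> (adj A ** C)"
    unfolding inner_mat
    by (simp add: matrix_matrix_mult_def sum_distrib_left rp_sum mult_ac)
  finally show ?thesis .
qed

lemma inner_mm_left:
  fixes A :: "'a::conj_field^'k^'m" and B :: "'a^'n^'k"
  shows "(A ** B) \<bullet> C = A \<bullet> (C ** adj B)"
proof -
  have "(A ** B) \<bullet> C = (adj B ** adj A) \<bullet> adj C"
    by (simp only: inner_adj adj_mult[symmetric])
  also have "\<dots> = adj A \<bullet> adj (C ** adj B)"
    unfolding inner_mm_right by (simp add: adj_mult)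
  finally show ?thesis by (simp only: inner_adj)
qed

section \<open>Orthogonal projections and inverse square roots\<close>

lemmas mm_simps = mm.add_left mm.add_right mm.diff_left mm.diff_right mm.minus_left mm.minus_right
  mm.zero_left mm.zero_right matrix_mul_assoc[symmetric]

definition unitary :: "'a::conj_field^'n^'n \<Rightarrow> bool" where
  "unitary V \<longleftrightarrow> V ** adj V = mat 1 \<and> adj V ** V = mat 1"

definition proj :: "'a::conj_field^'n^'n \<Rightarrow> bool" where
  "proj P \<longleftrightarrow> P ** P = P \<and> adj P = P"

definition projs :: "('n \<Rightarrow> real) \<Rightarrow> ('a::conj_field^'n^'n) set" where
  "projs a = {P. proj P \<and> (\<forall>i. P $ i $ i = of_real (a i))}"

text \<open>Expanding \<open>(1 + Z)^2 (1 - Y) = 1\<close> and solving for the linear term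
  \<open>2 Z\<close> gives this map, so a fixed point makes \<open>1 + Z\<close> an inverse square
  root of \<open>1 - Y\<close>. With \<open>norm Z\<close> at most 1/4 and \<open>norm Y\<close> at
  most 1/16 it contracts by the factor 1/2.\<close>

definition sqrt_step :: "'a::conj_field^'n^'n \<Rightarrow> 'a^'n^'n \<Rightarrow> 'a^'n^'n" where
  "sqrt_step Y Z = (1/2) *\<^sub>R (Y + Z ** Y + Z ** Y + Z ** (Z ** Y) - Z ** Z)"

lemma norm_sum4: "norm (A + B + C + D) \<le> norm A + norm B + norm C + norm (D::'v::real_normed_vector)"
  using norm_triangle_ineq[of "A + B + C" D] norm_triangle_ineq[of "A + B" C] norm_triangle_ineq[of A B]
  by linarith

lemma norm_sum6: "norm (A + B + (C + D) - (E + F))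
    \<le> norm A + norm B + (norm C + norm D) + (norm E + norm (F::'v::real_normed_vector))"
  using norm_triangle_ineq4[of "A + B + (C + D)" "E + F"] norm_triangle_ineq[of "A + B" "C + D"]
    norm_triangle_ineq[of A B] norm_triangle_ineq[of C D] norm_triangle_ineq[of E F]
  by linarith

lemma sqrt_step_lipschitz:
  fixes Y Z :: "'a::conj_field^'n^'n"
  assumes Y: "norm Y \<le> 1/16" and Z: "norm Z \<le> 1/4" "norm Z' \<le> 1/4"
  shows "norm (sqrt_step Y Z - sqrt_step Y Z') \<le> (1/2) * norm (Z - Z')"
proof -
  define D where "D = Z - Z'"
  have "sqrt_step Y Z - sqrt_step Y Z'
      = (1/2) *\<^sub>R (D ** Y + D ** Y + (D ** (Z ** Y) + Z' ** (D ** Y)) - (D ** Z + Z' ** D))"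
    unfolding sqrt_step_def D_def by (simp add: mm_simps scaleR_diff_right[symmetric] algebra_simps)
  also have "norm \<dots> = (1/2) * norm (D ** Y + D ** Y + (D ** (Z ** Y) + Z' ** (D ** Y)) - (D ** Z + Z' ** D))"
    by simp
  also have "\<dots> \<le> (1/2) * (norm (D ** Y) + norm (D ** Y) + (norm (D ** (Z ** Y)) + norm (Z' ** (D ** Y)))
      + (norm (D ** Z) + norm (Z' ** D)))"
    by (intro mult_left_mono norm_sum6) simp
  also have "\<dots> \<le> (1/2) * (norm D * (1/16) + norm D * (1/16) + (norm D * ((1/4) * (1/16)) + (1/4) * (norm D * (1/16)))
      + (norm D * (1/4) + (1/4) * norm D))"
    by (intro mult_left_mono add_mono order_trans[OF norm_mm] mult_mono order_refl Y Z) auto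
  also have "\<dots> \<le> (1/2) * norm D" by simp
  finally show ?thesis unfolding D_def .
qed

lemma sqrt_step_lipschitz_param:
  fixes Y Z :: "'a::conj_field^'n^'n"
  assumes Z: "norm Z \<le> 1/4"
  shows "norm (sqrt_step Y Z - sqrt_step Y' Z) \<le> norm (Y - Y')"
proof -
  define D where "D = Y - Y'"
  have "sqrt_step Y Z - sqrt_step Y' Z = (1/2) *\<^sub>R (D + Z ** D + Z ** D + Z ** (Z ** D))"
    unfolding sqrt_step_def D_def by (simp add: mm_simps scaleR_diff_right[symmetric] algebra_simps)
  also have "norm \<dots> = (1/2) * norm (D + Z ** D + Z ** D + Z ** (Z ** D))" by simp
  also have "\<dots> \<le> (1/2) * (norm D + norm (Z ** D) + norm (Z ** D) + norm (Z ** (Z ** D)))"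
    by (intro mult_left_mono norm_sum4) simp
  also have "\<dots> \<le> (1/2) * (norm D + (1/4) * norm D + (1/4) * norm D + (1/4) * ((1/4) * norm D))"
    by (intro mult_left_mono add_mono order_trans[OF norm_mm] mult_mono order_refl Z) auto
  also have "\<dots> \<le> norm D" by simp
  finally show ?thesis unfolding D_def .
qed

lemma sqrt_step_ball:
  assumes Y: "norm Y \<le> 1/16" and Z: "norm Z \<le> 1/4"
  shows "norm (sqrt_step Y Z) \<le> 1/4"
proof -
  have "norm (sqrt_step Y Z - sqrt_step Y 0) \<le> (1/2) * norm (Z - 0)"
    by (rule sqrt_step_lipschitz) (use assms in auto)
  moreover have "norm (sqrt_step Y 0) = (1/2) * norm Y"
    by (simp add: sqrt_step_def mm_simps)
  ultimately show ?thesis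
    using norm_triangle_sub[of "sqrt_step Y Z" "sqrt_step Y 0"] assms by simp
qed

lemma sqrt_step_fixpoint:
  assumes Y: "norm Y \<le> 1/16" and S: "closed S" "0 \<in> S"
    and inv: "\<And>Z. Z \<in> S \<Longrightarrow> sqrt_step Y Z \<in> S"
  shows "\<exists>!Z. Z \<in> cball 0 (1/4) \<inter> S \<and> sqrt_step Y Z = Z"
proof (rule Banach_fix[where c = "1/2"])
  show "complete (cball 0 (1/4) \<inter> S)"
    using S by (auto simp: complete_eq_closed)
  show "cball 0 (1/4) \<inter> S \<noteq> {}" using S by force
  show "sqrt_step Y ` (cball 0 (1/4) \<inter> S) \<subseteq> cball 0 (1/4) \<inter> S"
    using inv sqrt_step_ball[OF Y] by auto
  show "dist (sqrt_step Y Z) (sqrt_step Y Z') \<le> (1/2) * dist Z Z'"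
    if "Z \<in> cball 0 (1/4) \<inter> S" "Z' \<in> cball 0 (1/4) \<inter> S" for Z Z'
    using that sqrt_step_lipschitz[OF Y, of Z Z'] by (auto simp: dist_norm)
qed auto

definition sqrt_fix :: "'a::conj_field^'n^'n \<Rightarrow> 'a^'n^'n" where
  "sqrt_fix Y = (THE Z. Z \<in> cball 0 (1/4) \<and> sqrt_step Y Z = Z)"

lemma sqrt_fix:
  fixes Y :: "'a::conj_field^'n^'n"
  assumes "norm Y \<le> 1/16"
  shows "norm (sqrt_fix Y) \<le> 1/4" "sqrt_step Y (sqrt_fix Y) = sqrt_fix Y"
proof -
  have "\<exists>!Z. Z \<in> cball 0 (1/4) \<and> sqrt_step Y Z = Z"
    using sqrt_step_fixpoint[OF assms, of UNIV] by simp
  then have "sqrt_fix Y \<in> cball 0 (1/4) \<and> sqrt_step Y (sqrt_fix Y) = sqrt_fix Y"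
    unfolding sqrt_fix_def by (rule theI')
  then show "norm (sqrt_fix Y) \<le> 1/4" "sqrt_step Y (sqrt_fix Y) = sqrt_fix Y" by auto
qed

text \<open>By uniqueness the fixed point found inside the closed invariant set \<open>S\<close> is
  the one of the whole ball. This passes commutation and hermiticity on to \<open>sqrt_fix Y\<close>
  without a spectral decomposition.\<close>

lemma sqrt_fix_in:
  fixes Y :: "'a::conj_field^'n^'n"
  assumes Y: "norm Y \<le> 1/16" and S: "closed S" "0 \<in> S"
    and inv: "\<And>Z. Z \<in> S \<Longrightarrow> sqrt_step Y Z \<in> S"
  shows "sqrt_fix Y \<in> S"
proof -
  obtain Z where Z: "Z \<in> S" "norm Z \<le> 1/4" "sqrt_step Y Z = Z"
    using sqrt_step_fixpoint[OF assms] by auto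
  have "norm (sqrt_step Y (sqrt_fix Y) - sqrt_step Y Z) \<le> (1/2) * norm (sqrt_fix Y - Z)"
    by (rule sqrt_step_lipschitz[OF Y sqrt_fix(1)[OF Y] Z(2)])
  then have "norm (sqrt_fix Y - Z) \<le> (1/2) * norm (sqrt_fix Y - Z)"
    unfolding sqrt_fix(2)[OF Y] Z(3) .
  then have "sqrt_fix Y = Z" by simp
  then show ?thesis using Z(1) by simp
qed

definition inv_sqrt :: "'a::conj_field^'n^'n \<Rightarrow> 'a^'n^'n" where
  "inv_sqrt Y = mat 1 + sqrt_fix Y"

lemma inv_sqrt_eq:
  fixes Y :: "'a::conj_field^'n^'n"
  assumes "norm Y \<le> 1/16"
  shows "inv_sqrt Y ** (inv_sqrt Y ** (mat 1 - Y)) = mat 1"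
proof -
  define Z where "Z = sqrt_fix Y"
  have "Z + Z = 2 *\<^sub>R sqrt_step Y Z" using sqrt_fix(2)[OF assms] by (simp add: Z_def scaleR_2)
  also have "\<dots> = Y + Z ** Y + Z ** Y + Z ** (Z ** Y) - Z ** Z"
    by (simp add: sqrt_step_def)
  finally have "Z + Z = Y + Z ** Y + Z ** Y + Z ** (Z ** Y) - Z ** Z" .
  then have "Z ** (Z ** Y) = Z + Z - (Y + Z ** Y + Z ** Y) + Z ** Z" by (simp add: algebra_simps)
  then show ?thesis
    unfolding inv_sqrt_def Z_def[symmetric] by (simp add: mm_simps algebra_simps)
qed

lemma inv_sqrt_near:
  fixes Y :: "'a::conj_field^'n^'n"
  assumes "norm Y \<le> 1/16"
  shows "norm (inv_sqrt Y - mat 1) \<le> norm Y"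
proof -
  have "norm (sqrt_step Y (sqrt_fix Y) - sqrt_step Y 0) \<le> (1/2) * norm (sqrt_fix Y - 0)"
    by (rule sqrt_step_lipschitz) (use assms sqrt_fix[OF assms] in auto)
  moreover have "norm (sqrt_step Y 0) = (1/2) * norm Y"
    by (simp add: sqrt_step_def mm_simps)
  ultimately show ?thesis
    using norm_triangle_sub[of "sqrt_fix Y" "sqrt_step Y 0"] sqrt_fix(2)[OF assms]
    by (simp add: inv_sqrt_def)
qed

lemma closed_commutant: "closed {Z::'a::conj_field^'n^'n. M ** Z = Z ** M}"
  by (intro closed_Collect_eq continuous_intros)

lemma inv_sqrt_commutes:
  fixes Y :: "'a::conj_field^'n^'n"
  assumes "norm Y \<le> 1/16" and "M ** Y = Y ** M"
  shows "M ** inv_sqrt Y = inv_sqrt Y ** M"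
proof -
  have "sqrt_fix Y \<in> {Z. M ** Z = Z ** M}"
  proof (rule sqrt_fix_in[OF assms(1) closed_commutant])
    fix Z assume "Z \<in> {Z. M ** Z = Z ** M}"
    then have *: "M ** Z = Z ** M" "M ** (Z ** B) = Z ** (M ** B)" for B
      by (auto simp: matrix_mul_assoc)
    show "sqrt_step Y Z \<in> {Z. M ** Z = Z ** M}"
      by (simp only: mem_Collect_eq sqrt_step_def mm.scaleR_left mm.scaleR_right mm_simps * assms)
  qed (simp add: mm_simps)
  then show ?thesis by (simp add: inv_sqrt_def mm_simps)
qed

lemma inv_sqrt_herm:
  fixes Y :: "'a::conj_field^'n^'n"
  assumes "norm Y \<le> 1/16" and "adj Y = Y"
  shows "adj (inv_sqrt Y) = inv_sqrt Y"
proof -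
  \<comment> \<open>Hermiticity alone is not invariant under \<open>sqrt_step Y\<close>: the adjoint
    of \<open>Z ** Y\<close> is \<open>Y ** Z\<close>. Hence commutation with \<open>Y\<close> is
    carried along.\<close>
  have "sqrt_fix Y \<in> {Z. adj Z = Z} \<inter> {Z. Y ** Z = Z ** Y}"
  proof (rule sqrt_fix_in[OF assms(1)])
    show "closed ({Z. adj Z = Z} \<inter> {Z. Y ** Z = Z ** Y})"
      by (intro closed_Int closed_commutant closed_Collect_eq continuous_intros)
    fix Z assume "Z \<in> {Z. adj Z = Z} \<inter> {Z. Y ** Z = Z ** Y}"
    then have *: "adj Z = Z" "Y ** Z = Z ** Y" "Y ** (Z ** B) = Z ** (Y ** B)" for B
      by (auto simp: matrix_mul_assoc)
    show "sqrt_step Y Z \<in> {Z. adj Z = Z} \<inter> {Z. Y ** Z = Z ** Y}"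
      by (simp only: Int_iff mem_Collect_eq sqrt_step_def mm.scaleR_left mm.scaleR_right mm_simps adj_scaleR adj_add adj_diff adj_mult * assms)
  qed (simp add: mm_simps)
  then show ?thesis by (simp add: inv_sqrt_def adj_add)
qed

lemma continuous_on_inv_sqrt:
  "continuous_on (cball 0 (1/16)) (inv_sqrt :: 'a::conj_field^'n^'n \<Rightarrow> 'a^'n^'n)"
proof (rule continuous_on_subset[OF lipschitz_on_continuous_on subset_refl])
  show "2-lipschitz_on (cball 0 (1/16)) (inv_sqrt :: 'a::conj_field^'n^'n \<Rightarrow> 'a^'n^'n)"
  proof (rule lipschitz_onI)
    fix Y Y' :: "'a^'n^'n" assume "Y \<in> cball 0 (1/16)" "Y' \<in> cball 0 (1/16)"
    then have Y: "norm Y \<le> 1/16" "norm Y' \<le> 1/16" by auto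
    define Z Z' where "Z = sqrt_fix Y" "Z' = sqrt_fix Y'"
    have "norm (Z - Z') = norm ((sqrt_step Y Z - sqrt_step Y Z') + (sqrt_step Y Z' - sqrt_step Y' Z'))"
      using sqrt_fix(2)[OF Y(1)] sqrt_fix(2)[OF Y(2)] by (simp add: Z_Z'_def)
    also have "\<dots> \<le> norm (sqrt_step Y Z - sqrt_step Y Z') + norm (sqrt_step Y Z' - sqrt_step Y' Z')"
      by (rule norm_triangle_ineq)
    also have "\<dots> \<le> (1/2) * norm (Z - Z') + norm (Y - Y')"
      using Y sqrt_fix(1)[OF Y(1)] sqrt_fix(1)[OF Y(2)]
      by (intro add_mono sqrt_step_lipschitz sqrt_step_lipschitz_param) (auto simp: Z_Z'_def)
    finally show "dist (inv_sqrt Y) (inv_sqrt Y') \<le> 2 * dist Y Y'"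
      by (simp add: dist_norm inv_sqrt_def Z_Z'_def)
  qed simp
qed

section \<open>A chart for the orthogonal projections\<close>

text \<open>In the block decomposition given by a projection \<open>Q\<close>, both diagonal blocks
  of the Hermitian \<open>X\<close> vanish. Such matrices form the tangent space at \<open>Q\<close>
  of the projections of the same rank.\<close>

definition tangent :: "'a::conj_field^'n^'n \<Rightarrow> 'a^'n^'n \<Rightarrow> bool" where
  "tangent Q X \<longleftrightarrow> adj X = X \<and> Q ** X + X ** Q = X"

definition quad :: "'a::conj_field^'n^'n \<Rightarrow> 'a^'n^'n \<Rightarrow> 'a^'n^'n" where
  "quad Q X = X ** X - Q ** (X ** X) - Q ** (X ** X)"

text \<open>This is \<open>sqrt (1 - X^2)\<close>, written as \<open>1 - X^2\<close> times its own
  inverse square root. \<open>X\<close> acts as the sine of the principal angles; with this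
  parameter the block-diagonal part of \<open>chart Q X\<close> is a polynomial in
  \<open>X\<close>.\<close>

definition cosine :: "'a::conj_field^'n^'n \<Rightarrow> 'a^'n^'n" where
  "cosine X = (mat 1 - X ** X) ** inv_sqrt (X ** X)"

definition chart :: "'a::conj_field^'n^'n \<Rightarrow> 'a^'n^'n \<Rightarrow> 'a^'n^'n" where
  "chart Q X = Q + quad Q X + X ** cosine X"

lemma norm_square_le:
  fixes X :: "'a::conj_field^'n^'n"
  assumes "norm X \<le> 1/4" shows "norm (X ** X) \<le> 1/16"
proof -
  have "norm X * norm X \<le> (1/4) * (1/4)"
    by (rule mult_mono) (use assms in auto)
  then show ?thesis using norm_mm[of X X] by simp
qed

lemma tangent_commute:
  assumes "tangent Q X"
  shows "X ** Q = X - Q ** X" "X ** (Q ** B) = X ** B - Q ** (X ** B)"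
proof -
  show *: "X ** Q = X - Q ** X" using assms by (simp add: tangent_def algebra_simps)
  show "X ** (Q ** B) = X ** B - Q ** (X ** B)"
    unfolding matrix_mul_assoc * by (simp add: mm.diff_left)
qed

lemma tangent_square_commute:
  assumes "tangent Q X"
  shows "Q ** (X ** X) = (X ** X) ** Q"
  by (simp only: matrix_mul_assoc[symmetric] tangent_commute[OF assms] mm_simps) simp

lemma cosine_props:
  assumes Y: "norm (X ** X) \<le> 1/16" and X: "adj X = X"
  shows "adj (cosine X) = cosine X" "cosine X ** X = X ** cosine X"
    "cosine X ** cosine X = mat 1 - X ** X"
    "Q ** (X ** X) = (X ** X) ** Q \<Longrightarrow> cosine X ** Q = Q ** cosine X"
proof -
  define Y T where "Y = X ** X" and "T = inv_sqrt Y"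
  have c: "cosine X = (mat 1 - Y) ** T" by (simp add: cosine_def Y_def T_def)
  have YT: "Y ** T = T ** Y" and XT: "X ** T = T ** X"
    using inv_sqrt_commutes[of Y] Y by (auto simp: Y_def T_def matrix_mul_assoc)
  have YTB: "Y ** (T ** B) = T ** (Y ** B)" for B by (simp add: matrix_mul_assoc YT)
  have T: "adj T = T" unfolding T_def by (rule inv_sqrt_herm) (use Y X in \<open>auto simp: Y_def adj_mult\<close>)
  have Yh: "adj Y = Y" by (simp add: Y_def adj_mult X)
  show "adj (cosine X) = cosine X"
    by (simp only: c adj_mult adj_diff adj_mat_1 T Yh mm_simps YT matrix_mul_lid matrix_mul_rid)
  show "cosine X ** X = X ** cosine X"
    by (simp only: c mm_simps XT[symmetric] matrix_mul_lid matrix_mul_rid) (simp add: Y_def mm_simps)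
  have "cosine X ** cosine X = (mat 1 - Y) ** (T ** (T ** (mat 1 - Y)))"
    by (simp only: c mm_simps YT YTB matrix_mul_lid matrix_mul_rid)
  also have "\<dots> = mat 1 - Y"
    using inv_sqrt_eq[of Y] Y by (simp add: Y_def T_def)
  finally show "cosine X ** cosine X = mat 1 - X ** X" by (simp add: Y_def)
  assume Q: "Q ** (X ** X) = (X ** X) ** Q"
  then have QY: "Q ** Y = Y ** Q" by (simp add: Y_def)
  have QT: "Q ** T = T ** Q"
    unfolding T_def by (rule inv_sqrt_commutes) (use Y QY in \<open>auto simp: Y_def\<close>)
  have "Q ** (Y ** T) = Y ** (T ** Q)" by (metis QT QY matrix_mul_assoc)
  then show "cosine X ** Q = Q ** cosine X"
    by (simp only: c mm_simps QT matrix_mul_lid matrix_mul_rid)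
qed

text \<open>The relations between \<open>Q\<close>, \<open>X\<close> and \<open>S = cosine X\<close>
  form a rewrite system that brings every word to the order \<open>Q\<close>, \<open>X\<close>,
  \<open>S\<close>; both identities then follow by cancelling terms.\<close>

lemma proj_chart:
  assumes Q: "proj Q" and X: "tangent Q X" and Y: "norm (X ** X) \<le> 1/16"
  shows "proj (chart Q X)"
proof -
  define S where "S = cosine X"
  have Xh: "adj X = X" using X by (simp add: tangent_def)
  have S: "adj S = S" "S ** X = X ** S" "S ** S = mat 1 - X ** X" "S ** Q = Q ** S"
    unfolding S_def by (rule cosine_props[OF Y Xh] tangent_square_commute[OF X])+
  have S': "S ** (X ** B) = X ** (S ** B)" "S ** (S ** B) = (mat 1 - X ** X) ** B"
     "S ** (Q ** B) = Q ** (S ** B)" for B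
    by (simp_all only: matrix_mul_assoc S)
  have Qq: "Q ** Q = Q" "Q ** (Q ** B) = Q ** B" "adj Q = Q" for B
    using Q by (auto simp: proj_def matrix_mul_assoc)
  note T = tangent_commute[OF X]
  show ?thesis
    unfolding proj_def chart_def quad_def S_def[symmetric]
    by (simp only: mm_simps S S' Qq T matrix_mul_lid matrix_mul_rid adj_add adj_diff adj_mult Xh)
       (simp add: algebra_simps)
qed

text \<open>\<open>E\<close> is block diagonal and \<open>N\<close> block off-diagonal with respect
  to \<open>Q\<close>, so the trace pairing vanishes.\<close>

lemma inner_offdiag:
  assumes Q: "proj Q" and E: "E ** Q = Q ** E" and N: "Q ** N + N ** Q = N"
  shows "E \<bullet> N = 0"
proof -
  have Qq: "Q ** Q = Q" "adj Q = Q" "Q ** (Q ** B) = Q ** B" for B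
    using Q by (auto simp: proj_def matrix_mul_assoc)
  have "Q ** N ** Q = Q ** (Q ** N + N ** Q) ** Q" by (simp only: N)
  also have "\<dots> = Q ** N ** Q + Q ** N ** Q"
    by (simp only: mm_simps Qq)
  finally have 0: "Q ** N ** Q = 0" by simp
  have "E \<bullet> N = E \<bullet> (Q ** N) + E \<bullet> (N ** Q)"
    by (subst N[symmetric]) (rule inner_right_distrib)
  also have "\<dots> = 2 * ((Q ** E) \<bullet> N)"
    using inner_mm_right[of Q E N] inner_mm_left[of E Q N] E by (simp add: Qq)
  also have "Q ** E = Q ** (E ** Q)" by (simp only: E matrix_mul_assoc Qq)
  also have "(Q ** (E ** Q)) \<bullet> N = E \<bullet> (Q ** N ** Q)"
    by (simp only: inner_mm_right[of Q "E ** Q" N] inner_mm_left[of E Q "Q ** N"] Qq)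
  finally show ?thesis by (simp add: 0)
qed

text \<open>A matrix commuting with \<open>Q\<close> does not see the odd part
  \<open>X ** cosine X\<close>. The dependence on \<open>X\<close> is therefore homogeneous of
  degree two without any error term, and a vanishing pairing stays zero when \<open>X\<close> is
  scaled.\<close>

lemma inner_chart:
  assumes Q: "proj Q" and X: "tangent Q X" and Y: "norm (X ** X) \<le> 1/16" and E: "E ** Q = Q ** E"
  shows "E \<bullet> chart Q X = E \<bullet> Q + E \<bullet> quad Q X"
proof -
  have Xh: "adj X = X" using X by (simp add: tangent_def)
  have S: "cosine X ** Q = Q ** cosine X"
    by (rule cosine_props[OF Y Xh] tangent_square_commute[OF X])+
  have "Q ** (X ** cosine X) + (X ** cosine X) ** Q = (Q ** X + X ** Q) ** cosine X"
    by (simp only: mm_simps S)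
  also have "\<dots> = X ** cosine X" using X by (simp add: tangent_def)
  finally have "E \<bullet> (X ** cosine X) = 0" by (rule inner_offdiag[OF Q E])
  then show ?thesis by (simp add: chart_def inner_right_distrib)
qed

lemma chart_near:
  assumes X: "norm X \<le> 1/4"
  shows "norm (chart Q X - Q - X) \<le> (2 + 2 * norm Q) * (norm X)\<^sup>2"
proof -
  define Y T where "Y = X ** X" and "T = inv_sqrt Y"
  have Y: "norm Y \<le> (norm X)\<^sup>2" "norm Y \<le> 1/16"
    using norm_mm[of X X] norm_square_le[OF X] by (auto simp: Y_def power2_eq_square)
  have T: "norm (T - mat 1) \<le> norm Y" unfolding T_def by (rule inv_sqrt_near) (rule Y)
  have "chart Q X - Q - X = Y - Q ** Y - Q ** Y + X ** ((T - mat 1) - (Y + Y ** (T - mat 1)))"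
    by (simp add: chart_def quad_def cosine_def Y_def[symmetric] T_def[symmetric] mm_simps)
  also have "norm \<dots> \<le> norm Y + norm (Q ** Y) + norm (Q ** Y) + norm (X ** ((T - mat 1) - (Y + Y ** (T - mat 1))))"
    using norm_sum4[of Y "- (Q ** Y)" "- (Q ** Y)"] by simp
  also have "norm (X ** ((T - mat 1) - (Y + Y ** (T - mat 1)))) \<le> (1/4) * (norm Y + (norm Y + (1/16) * norm Y))"
    by (intro order_trans[OF norm_mm] mult_mono order_trans[OF norm_triangle_ineq4] add_mono
        order_trans[OF norm_triangle_ineq] X T order_refl Y) auto
  also have "norm Y + norm (Q ** Y) + norm (Q ** Y) + \<dots> \<le> (2 + 2 * norm Q) * norm Y"
  proof -
    have "y + a + a + 1/4 * (y + (y + 1/16 * y)) \<le> (2 + 2 * q) * y"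
      if "a \<le> q * y" "0 \<le> y" for a q y :: real
      using that unfolding distrib_right by (simp add: mult.assoc)
    from this[OF norm_mm norm_ge_zero] show ?thesis .
  qed
  also have "\<dots> \<le> (2 + 2 * norm Q) * (norm X)\<^sup>2"
    by (intro mult_left_mono Y) auto
  finally show ?thesis by simp
qed

lemma tangent_scaleR:
  assumes "tangent Q X" shows "tangent Q (s *\<^sub>R X)"
  using assms by (simp add: tangent_def mm.scaleR_left mm.scaleR_right scaleR_add_right[symmetric])

lemma quad_scaleR: "quad Q (s *\<^sub>R X) = s\<^sup>2 *\<^sub>R quad Q X"
  by (simp add: quad_def mm.scaleR_left mm.scaleR_right scaleR_diff_right power2_eq_square)

lemma chart_0 [simp]: "chart Q 0 = Q"
  by (simp add: chart_def quad_def mm_simps)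

lemma continuous_on_chart:
  assumes "norm (X ** X) \<le> 1/16"
  shows "continuous_on {0..1} (\<lambda>s. chart Q (s *\<^sub>R X))"
proof -
  have "continuous_on {0..1} (\<lambda>s. inv_sqrt ((s *\<^sub>R X) ** (s *\<^sub>R X)))"
  proof (rule continuous_on_compose2[OF continuous_on_inv_sqrt])
    show "(\<lambda>s. (s *\<^sub>R X) ** (s *\<^sub>R X)) ` {0..1} \<subseteq> cball 0 (1/16)"
    proof clarsimp
      fix s :: real assume s: "0 \<le> s" "s \<le> 1"
      have "norm ((s *\<^sub>R X) ** (s *\<^sub>R X)) = s\<^sup>2 * norm (X ** X)"
        by (simp add: mm.scaleR_left mm.scaleR_right power2_eq_square abs_mult)
      also have "\<dots> \<le> 1 * (1/16)"
        using s assms by (intro mult_mono power_le_one) auto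
      finally show "norm ((s *\<^sub>R X) ** (s *\<^sub>R X)) * 16 \<le> 1" by simp
    qed
  qed (intro continuous_intros)
  then show ?thesis unfolding chart_def quad_def cosine_def by (intro continuous_intros)
qed

text \<open>\<open>N\<close> is the off-diagonal part of \<open>P\<close> relative to
  \<open>Q\<close>, and \<open>Y = (P - Q)^2\<close> is the squared sine of the principal angles,
  which commutes with both projections. Since \<open>N^2 = Y (1 - Y)\<close>, \<open>N\<close> is
  sine times cosine; dividing by the cosine \<open>sqrt (1 - Y)\<close> leaves the sine
  \<open>X\<close> with \<open>X^2 = Y\<close>.\<close>

lemma chart_surj:
  assumes Q: "proj Q" and P: "proj P" and near: "norm (P - Q) \<le> 1/4"
  obtains X where "tangent Q X" "norm (X ** X) \<le> 1/16" "chart Q X = P"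
    "norm X \<le> 4 * (norm Q + (norm Q)\<^sup>2) * norm (P - Q)"
proof -
  define D where "D = P - Q"
  define Y where "Y = D ** D"
  define T where "T = inv_sqrt Y"
  define N where "N = Q ** P + P ** Q - Q ** (P ** Q) - Q ** (P ** Q)"
  have q: "Q ** Q = Q" "Q ** (Q ** B) = Q ** B" "adj Q = Q"
    and p: "P ** P = P" "P ** (P ** B) = P ** B" "adj P = P" for B
    using P Q by (auto simp: proj_def matrix_mul_assoc)
  have Yeq: "Y = P + Q - P ** Q - Q ** P" by (simp add: Y_def D_def mm_simps p q algebra_simps)
  have Yn: "norm Y \<le> 1/16" unfolding Y_def D_def by (rule norm_square_le[OF near])
  have YQ: "Q ** Y = Y ** Q" by (simp add: Yeq mm_simps p q)
  have YN: "N ** Y = Y ** N" by (simp only: Yeq N_def mm_simps p q) (simp add: algebra_simps)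
  have QT: "Q ** T = T ** Q" and NT: "N ** T = T ** N" and YT: "Y ** T = T ** Y"
    using YQ YN Yn inv_sqrt_commutes[of Y] unfolding T_def by auto
  have YTB: "Y ** (T ** B) = T ** (Y ** B)" for B by (simp add: matrix_mul_assoc YT)
  have Th: "adj T = T" unfolding T_def by (rule inv_sqrt_herm[OF Yn]) (simp add: Yeq adj_add adj_diff adj_mult p q)
  have Nh: "adj N = N"
    by (simp only: N_def adj_add adj_diff adj_mult p q mm_simps) (simp add: algebra_simps)
  have N2: "N ** N = Y ** (mat 1 - Y)"
    by (simp only: Yeq N_def mm_simps p q matrix_mul_lid matrix_mul_rid) (simp add: algebra_simps)
  have QN: "Q ** N + N ** Q = N"
    by (simp only: N_def mm_simps p q) (simp add: algebra_simps)
  define X where "X = N ** T"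
  have TT: "T ** (T ** (mat 1 - Y)) = mat 1" unfolding T_def by (rule inv_sqrt_eq[OF Yn])
  have XX: "X ** X = Y"
  proof -
    have "X ** X = (N ** N) ** (T ** T)" unfolding X_def by (metis NT matrix_mul_assoc)
    also have "\<dots> = Y ** (T ** (T ** (mat 1 - Y)))"
      unfolding N2 by (simp only: mm_simps YT YTB matrix_mul_lid matrix_mul_rid)
    finally show ?thesis by (simp add: TT)
  qed
  have tan: "tangent Q X"
    unfolding tangent_def
  proof
    show "adj X = X" by (simp add: X_def adj_mult Th Nh NT)
    have "Q ** X + X ** Q = (Q ** N + N ** Q) ** T" by (simp only: X_def mm_simps QT)
    then show "Q ** X + X ** Q = X" by (simp only: QN X_def)
  qed
  have "X ** cosine X = X ** ((mat 1 - Y) ** T)"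
    by (simp only: cosine_def XX T_def[symmetric])
  also have "\<dots> = N ** (T ** (T ** (mat 1 - Y)))"
    by (simp only: X_def mm_simps YT matrix_mul_lid matrix_mul_rid)
  finally have "X ** cosine X = N" by (simp add: TT)
  then have "chart Q X = P"
    by (simp add: chart_def quad_def XX Yeq N_def mm_simps p q algebra_simps)
  moreover have "norm X \<le> 4 * (norm Q + (norm Q)\<^sup>2) * norm D"
  proof -
    \<comment> \<open>\<open>Q\<close> has no off-diagonal part relative to itself, so
      \<open>N\<close> is linear in \<open>D\<close>; this makes the bound proportional to
      \<open>norm D\<close>.\<close>
    have Neq: "N = Q ** D + D ** Q - Q ** (D ** Q) - Q ** (D ** Q)"
      by (simp add: N_def D_def mm_simps p q algebra_simps)
    have "norm N \<le> norm (Q ** D) + norm (D ** Q) + norm (Q ** (D ** Q)) + norm (Q ** (D ** Q))"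
      unfolding Neq using norm_sum4[of "Q ** D" "D ** Q" "- (Q ** (D ** Q))" "- (Q ** (D ** Q))"] by simp
    also have "\<dots> \<le> norm Q * norm D + norm D * norm Q + norm Q * (norm D * norm Q) + norm Q * (norm D * norm Q)"
      by (intro add_mono order_trans[OF norm_mm] mult_left_mono order_refl norm_ge_zero)
    finally have N: "norm N \<le> 2 * (norm Q + (norm Q)\<^sup>2) * norm D"
      by (simp add: algebra_simps power2_eq_square)
    have "X = N + N ** (T - mat 1)" by (simp add: X_def mm_simps)
    then have "norm X \<le> norm N + norm (N ** (T - mat 1))"
      by (simp only: norm_triangle_ineq)
    also have "\<dots> \<le> norm N + norm N * norm (T - mat 1)"
      by (intro add_left_mono norm_mm)
    also have "\<dots> \<le> norm N + norm N * 1"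
      using inv_sqrt_near[OF Yn] Yn by (intro add_left_mono mult_left_mono) (auto simp: T_def)
    finally show ?thesis using N by (simp add: algebra_simps)
  qed
  ultimately show thesis using that tan Yn by (simp add: XX D_def)
qed

section \<open>Plane rotations\<close>

lemma unitary_1 [simp]: "unitary (mat 1)" by (simp add: unitary_def)

lemma unitary_mult:
  fixes U V :: "'a::conj_field^'n^'n"
  assumes "unitary U" "unitary V" shows "unitary (U ** V)"
proof -
  have "U ** ((V ** adj V) ** adj U) = mat 1" "adj V ** ((adj U ** U) ** V) = mat 1"
    using assms by (simp_all add: unitary_def)
  then show ?thesis by (simp only: unitary_def adj_mult matrix_mul_assoc)
qed

lemma norm_unitary:
  fixes V :: "'a::conj_field^'n^'n"
  assumes "unitary V" shows "norm V = norm (mat 1 :: 'a^'n^'n)"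
proof -
  have "V \<bullet> V = mat 1 \<bullet> (adj V ** V)"
    using inner_mm_right[of V "mat 1" V] by simp
  then show ?thesis using assms by (simp add: unitary_def norm_eq)
qed

definition rdiag :: "('n \<Rightarrow> real) \<Rightarrow> 'a::conj_field^'n^'n" where
  "rdiag b = (\<chi> i j. if i = j then of_real (b i) else 0)"

lemma rdiag_mult: "(rdiag b ** P) $ i $ j = of_real (b i) * P $ i $ j"
  by (simp add: rdiag_def matrix_matrix_mult_def if_distrib[of "\<lambda>x. x * _"] cong: if_cong)

lemma mult_rdiag: "(P ** rdiag b) $ i $ j = of_real (b j) * P $ i $ j"
proof -
  have "(P ** rdiag b) $ i $ j = (\<Sum>k\<in>UNIV. if k = j then P $ i $ k * of_real (b j) else 0)"
    unfolding rdiag_def matrix_matrix_mult_def vec_lambda_beta by (rule sum.cong) auto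
  then show ?thesis by (simp add: mult.commute)
qed

text \<open>\<open>b\<close> must agree along every edge of the support graph of \<open>P\<close>.
  Commutation thus encodes functions constant on the components without mentioning
  connectivity.\<close>

lemma rdiag_commute_iff: "rdiag b ** P = P ** rdiag b \<longleftrightarrow> (\<forall>i j. P $ i $ j \<noteq> 0 \<longrightarrow> b i = b j)"
  by (auto simp: vec_eq_iff rdiag_mult mult_rdiag)

lemma inner_rdiag: "rdiag b \<bullet> P = (\<Sum>i\<in>UNIV. b i * rp (P $ i $ i))"
proof -
  have "rp (cj (rdiag b $ i $ j) * P $ i $ j) = (if j = i then b i * rp (P $ i $ i) else 0)" for i j
    by (auto simp: rdiag_def scaleR_conv_of_real[symmetric])
  then show ?thesis by (simp add: inner_mat)
qed

definition givens :: "'n \<Rightarrow> 'n \<Rightarrow> real \<Rightarrow> 'a::conj_field \<Rightarrow> 'a^'n^'n" where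
  "givens x y c s = (\<chi> i j. if i = x then (if j = x then of_real c else if j = y then s else 0)
     else if i = y then (if j = x then - cj s else if j = y then of_real c else 0)
     else if i = j then 1 else 0)"

lemma sum_two:
  fixes f :: "'n::finite \<Rightarrow> 'a::comm_monoid_add"
  assumes "x \<noteq> y" "\<And>k. k \<noteq> x \<Longrightarrow> k \<noteq> y \<Longrightarrow> f k = 0"
  shows "sum f UNIV = f x + f y"
proof -
  have "sum f UNIV = sum f {x, y}"
    by (rule sum.mono_neutral_right) (use assms in auto)
  then show ?thesis using assms by simp
qed

lemma givens_mult:
  assumes "x \<noteq> y"
  shows "(givens x y c s ** P) $ i $ j =
    (if i = x then of_real c * P $ x $ j + s * P $ y $ j
     else if i = y then - cj s * P $ x $ j + of_real c * P $ y $ j else P $ i $ j)"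
proof -
  have "(\<Sum>k\<in>UNIV. givens x y c s $ i $ k * P $ k $ j) = P $ i $ j" if "i \<noteq> x" "i \<noteq> y"
  proof -
    have "givens x y c s $ i $ k * P $ k $ j = (if k = i then P $ i $ j else 0)" for k
      using that by (auto simp: givens_def)
    then show ?thesis by simp
  qed
  moreover have "(\<Sum>k\<in>UNIV. givens x y c s $ x $ k * P $ k $ j) = of_real c * P $ x $ j + s * P $ y $ j"
    using assms by (subst sum_two[OF assms]) (auto simp: givens_def)
  moreover have "(\<Sum>k\<in>UNIV. givens x y c s $ y $ k * P $ k $ j) = - cj s * P $ x $ j + of_real c * P $ y $ j"
    using assms by (subst sum_two[OF assms]) (auto simp: givens_def)
  ultimately show ?thesis by (auto simp: matrix_matrix_mult_def)
qed

lemma mult_adj_givens: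
  assumes "x \<noteq> y"
  shows "(A ** adj (givens x y c s)) $ i $ j =
    (if j = x then of_real c * A $ i $ x + cj s * A $ i $ y
     else if j = y then - s * A $ i $ x + of_real c * A $ i $ y else A $ i $ j)"
proof -
  have "(A ** adj (givens x y c s)) $ i $ j = cj ((givens x y c s ** adj A) $ j $ i)"
    using adj_nth[of "givens x y c s ** adj A" i j] by (simp add: adj_mult)
  then show ?thesis by (simp add: givens_mult[OF assms] cj_add cj_diff cj_mult)
qed

lemma adj_givens: assumes "x \<noteq> y" shows "adj (givens x y c s) = givens x y c (- s)"
  using assms by (auto simp: vec_eq_iff givens_def)

lemma givens_1: "x \<noteq> y \<Longrightarrow> givens x y 1 0 = mat 1"
  by (auto simp: vec_eq_iff givens_def mat_def)

lemma unitary_givens: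
  fixes s :: "'a::conj_field" and x y :: "'n::finite"
  assumes "x \<noteq> y" "c\<^sup>2 + (norm s)\<^sup>2 = 1"
  shows "unitary (givens x y c s :: 'a^'n^'n)"
proof -
  have 1: "of_real c * of_real c + s * cj s = 1"
    using assms(2) by (metis mult_cj of_real_1 of_real_add of_real_mult power2_eq_square)
  have g: "givens x y c s ** adj (givens x y c s) = (mat 1 :: 'a^'n^'n)" if "of_real c * of_real c + s * cj s = 1" for s :: 'a
    using that assms(1) unfolding vec_eq_iff
    by (auto simp: mult_adj_givens[OF assms(1)] mat_def) (auto simp: givens_def algebra_simps)
  from g[OF 1] g[of "- s"] 1 show ?thesis
    by (simp add: unitary_def adj_givens[OF assms(1)])
qed

text \<open>For \<open>0 \<le> c\<close> the estimate
  \<open>(1 - c)^2 \<le> 1 - c^2 = (norm s)^2\<close> holds. A bound linear in \<open>norm s\<close>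
  keeps the later corrections proportional to the diagonal error.\<close>

lemma norm_givens_minus_1:
  fixes s :: "'a::conj_field" and x y :: "'n::finite"
  assumes "x \<noteq> y" "c\<^sup>2 + (norm s)\<^sup>2 = 1" "0 \<le> c"
  shows "norm (givens x y c s - mat 1 :: 'a^'n^'n) \<le> 2 * norm s"
proof (rule power2_le_imp_le)
  have row: "(\<Sum>j\<in>UNIV. (norm ((givens x y c s - mat 1 :: 'a^'n^'n) $ i $ j))\<^sup>2)
    = (if i = x \<or> i = y then (1 - c)\<^sup>2 + (norm s)\<^sup>2 else 0)" for i
  proof -
    have n: "norm (of_real c - 1 :: 'a) = \<bar>1 - c\<bar>"
      by (metis abs_minus_commute norm_of_real of_real_1 of_real_diff)
    show ?thesis
    proof (cases "i = x \<or> i = y")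
      case True
      then show ?thesis using assms(1)
        by (subst sum_two[OF assms(1)]) (auto simp: givens_def mat_def n)
    next
      case False
      then show ?thesis by (auto simp: givens_def mat_def intro!: sum.neutral)
    qed
  qed
  have c: "c \<le> 1" using assms(2,3) by (smt (verit) one_less_power pos2 zero_le_power2)
  have "(norm (givens x y c s - mat 1 :: 'a^'n^'n))\<^sup>2 = 2 * ((1 - c)\<^sup>2 + (norm s)\<^sup>2)"
    unfolding norm_mat_sq row using assms(1) by (subst sum_two[OF assms(1)]) auto
  also have "(1 - c)\<^sup>2 \<le> (1 - c) * (1 + c)"
    unfolding power2_eq_square using assms(3) c by (intro mult_left_mono) auto
  also have "(1 - c) * (1 + c) = (norm s)\<^sup>2" using assms(2) by (simp add: algebra_simps power2_eq_square)
  finally show "(norm (givens x y c s - mat 1 :: 'a^'n^'n))\<^sup>2 \<le> (2 * norm s)\<^sup>2" by simp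
qed simp

section \<open>Conjugation and its effect on the diagonal\<close>

definition conj_by :: "'a::conj_field^'n^'n \<Rightarrow> 'a^'n^'n \<Rightarrow> 'a^'n^'n" where
  "conj_by V P = V ** P ** adj V"

lemma conj_by_mult: "conj_by U (conj_by V P) = conj_by (U ** V) P"
  by (simp add: conj_by_def adj_mult matrix_mul_assoc)

lemma conj_by_1 [simp]: "conj_by (mat 1) P = P" by (simp add: conj_by_def)

lemma adj_conj_by: "adj P = P \<Longrightarrow> adj (conj_by V P) = conj_by V P"
  by (simp add: conj_by_def adj_mult matrix_mul_assoc)

lemma proj_conj_by:
  assumes "proj P" "unitary V" shows "proj (conj_by V P)"
proof -
  have "V ** P ** adj V ** (V ** P ** adj V) = V ** (P ** ((adj V ** V) ** (P ** adj V)))"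
    by (simp add: matrix_mul_assoc)
  also have "\<dots> = V ** P ** adj V" using assms by (simp add: unitary_def proj_def matrix_mul_assoc)
  finally show ?thesis using assms adj_conj_by by (auto simp: proj_def conj_by_def)
qed

lemma herm_nth: "adj P = P \<Longrightarrow> P $ j $ i = cj (P $ i $ j)"
  by (metis adj_nth)

lemma herm_diag: "adj P = P \<Longrightarrow> P $ i $ i = of_real (rp (P $ i $ i))"
  by (metis adj_nth real_iff_cj)

lemma conj_givens_other:
  assumes "x \<noteq> y" "i \<noteq> x" "i \<noteq> y"
  shows "conj_by (givens x y c s) P $ i $ i = P $ i $ i"
  using assms by (simp add: conj_by_def mult_adj_givens givens_mult)

lemma conj_givens_xx:
  assumes "x \<noteq> y"
  shows "conj_by (givens x y c s) P $ x $ x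
    = of_real c * (of_real c * P $ x $ x + s * P $ y $ x) + cj s * (of_real c * P $ x $ y + s * P $ y $ y)"
  using assms by (simp add: conj_by_def mult_adj_givens givens_mult)

lemma conj_givens_sum:
  fixes s :: "'a::conj_field" and x y :: "'n::finite"
  assumes "x \<noteq> y" "c\<^sup>2 + (norm s)\<^sup>2 = 1"
  shows "conj_by (givens x y c s) P $ x $ x + conj_by (givens x y c s) P $ y $ y = P $ x $ x + P $ y $ y"
proof -
  have 1: "of_real c * of_real c + s * cj s = 1"
    using assms(2) by (metis mult_cj of_real_1 of_real_add of_real_mult power2_eq_square)
  have "conj_by (givens x y c s) P $ x $ x + conj_by (givens x y c s) P $ y $ y
     = (of_real c * of_real c + s * cj s) * (P $ x $ x + P $ y $ y)"
    using assms(1) by (simp add: conj_by_def mult_adj_givens givens_mult algebra_simps)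
  then show ?thesis by (simp add: 1)
qed

text \<open>The tangent of the rotation angle is the small root \<open>t\<close> of \<open>u + 2 t h + t\<^sup>2 v = 0\<close>,
  written so that it vanishes with \<open>u\<close>.\<close>

definition rot_tan :: "real \<Rightarrow> real \<Rightarrow> real \<Rightarrow> real" where
  "rot_tan h u v = - u / (h + sqrt (h\<^sup>2 - u * v))"

text \<open>If \<open>u = 0\<close>, the denominator may vanish too, but the quotient is then 0,
  which is the root wanted. Otherwise multiplying by \<open>(h + r)^2\<close> avoids a division by
  \<open>v\<close>, which may be 0.\<close>

lemma rot_tan_root:
  assumes "0 < h + sqrt (h\<^sup>2 - u * v) \<or> u = 0" "u * v \<le> h\<^sup>2"
  shows "u + 2 * rot_tan h u v * h + (rot_tan h u v)\<^sup>2 * v = 0"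
proof (cases "u = 0")
  case False
  define r where "r = sqrt (h\<^sup>2 - u * v)"
  have r: "r\<^sup>2 = h\<^sup>2 - u * v" "h + r > 0" using assms False by (auto simp: r_def)
  define t where "t = rot_tan h u v"
  have tr: "t * (h + r) = - u" using r(2) by (simp add: t_def rot_tan_def r_def[symmetric])
  have "(u + 2 * t * h + t\<^sup>2 * v) * (h + r)\<^sup>2
     = u * (h + r)\<^sup>2 + 2 * (t * (h + r)) * h * (h + r) + (t * (h + r))\<^sup>2 * v"
    by (simp add: algebra_simps power2_eq_square)
  also have "\<dots> = u * (r\<^sup>2 - h\<^sup>2 + u * v)" unfolding tr by (simp add: algebra_simps power2_eq_square)
  also have "\<dots> = 0" using r by simp
  finally show ?thesis using r(2) by (simp add: t_def)
qed (simp add: rot_tan_def)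

text \<open>The factor \<open>P$x$y / of_real h\<close> aligns phases so that the cross terms of the
  rotated diagonal entry are real. The value 1 for \<open>h = 0\<close> admits rotations between
  coordinates whose entry vanishes.\<close>

definition rot :: "real \<Rightarrow> 'n \<Rightarrow> 'n \<Rightarrow> 'a::conj_field^'n^'n \<Rightarrow> 'a^'n^'n" where
  "rot a x y P = (let h = norm (P$x$y); t = rot_tan h (rp (P$x$x) - a) (rp (P$y$y) - a)
     in givens x y (1 / sqrt (1 + t\<^sup>2)) (of_real (t / sqrt (1 + t\<^sup>2)) * (if h = 0 then 1 else P$x$y / of_real h)))"

lemma rot_cos_sin: "(1 / sqrt (1 + t\<^sup>2))\<^sup>2 + (t / sqrt (1 + t\<^sup>2))\<^sup>2 = (1::real)"
proof -
  have "1 + t\<^sup>2 > 0" by (simp add: add_pos_nonneg)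
  then show ?thesis by (simp add: power_divide add_divide_distrib[symmetric])
qed

lemma rot_givens:
  fixes P :: "'a::conj_field^'n^'n" and x y :: 'n and a :: real
  defines "t \<equiv> rot_tan (norm (P$x$y)) (rp (P$x$x) - a) (rp (P$y$y) - a)"
  obtains c and s :: 'a where "rot a x y P = givens x y c s" "c\<^sup>2 + (norm s)\<^sup>2 = 1" "0 \<le> c" "norm s \<le> \<bar>t\<bar>"
    "c = 1 / sqrt (1 + t\<^sup>2)" "P $ x $ y * cj s = of_real (t / sqrt (1 + t\<^sup>2) * norm (P$x$y))"
proof -
  define c s where "c = 1 / sqrt (1 + t\<^sup>2)"
    and "s = of_real (t / sqrt (1 + t\<^sup>2)) * (if norm (P$x$y) = 0 then 1 else P$x$y / of_real (norm (P$x$y)))"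
  have ns: "norm s = \<bar>t\<bar> / sqrt (1 + t\<^sup>2)"
    by (simp add: s_def norm_mult norm_divide add_nonneg_nonneg)
  have 1: "c\<^sup>2 + (norm s)\<^sup>2 = 1"
    using rot_cos_sin[of t] by (simp add: ns c_def power_divide)
  have 2: "norm s \<le> \<bar>t\<bar>"
  proof -
    have "1 \<le> sqrt (1 + t\<^sup>2)" by simp
    then show ?thesis unfolding ns by (simp add: divide_le_eq mult_le_cancel_left1 add_pos_nonneg)
  qed
  have 3: "P $ x $ y * cj s = of_real (t / sqrt (1 + t\<^sup>2) * norm (P$x$y))"
  proof (cases "P$x$y = 0")
    case False
    define n w where "n = norm (P$x$y)" and "w = P$x$y / of_real n"
    have n: "(of_real n :: 'a) \<noteq> 0" using False by (simp add: n_def)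
    have "(P$x$y * cj w) * of_real n = P$x$y * cj (w * of_real n)" by (simp add: cj_mult)
    also have "\<dots> = of_real n * of_real n" using n by (simp add: w_def mult_cj n_def power2_eq_square)
    finally have "P$x$y * cj w = of_real n" using n by simp
    moreover have "s = of_real (t / sqrt (1 + t\<^sup>2)) * w" using False by (simp add: s_def w_def n_def)
    ultimately show ?thesis
      by (simp only: cj_mult cj_of_real of_real_mult n_def mult.left_commute[of "P$x$y"])
  qed (simp add: s_def)
  show thesis
    by (rule that[of c s]) (use 1 2 3 in \<open>auto simp: rot_def t_def[symmetric] Let_def c_def s_def\<close>)
qed

text \<open>Up to the factor \<open>c^2\<close> the defect of the new entry is
  \<open>u + 2 t h + t^2 v\<close>. Its discriminant is positive as soon as the two diagonal entries
  lie strictly on opposite sides of \<open>a\<close>, even if \<open>P$x$y = 0\<close>.\<close>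

lemma rot_diag:
  fixes P :: "'a::conj_field^'n^'n"
  assumes P: "adj P = P" and "x \<noteq> y"
    and d: "(rp (P$x$x) - a) * (rp (P$y$y) - a) < (norm (P$x$y))\<^sup>2 \<or> rp (P$x$x) = a"
  shows "conj_by (rot a x y P) P $ x $ x = of_real a"
proof -
  define h u v where "h = norm (P$x$y)" "u = rp (P$x$x) - a" "v = rp (P$y$y) - a"
  define t where "t = rot_tan h u v"
  obtain c s where cs: "rot a x y P = givens x y c s" "c\<^sup>2 + (norm s)\<^sup>2 = 1"
    "c = 1 / sqrt (1 + t\<^sup>2)" "P $ x $ y * cj s = of_real (t / sqrt (1 + t\<^sup>2) * h)"
    using rot_givens[of a x y P] unfolding t_def h_u_v_def by metis
  have hy: "P$y$x = cj (P$x$y)" by (rule herm_nth[OF P])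
  have e2: "s * P$y$x = of_real (t / sqrt (1 + t\<^sup>2) * h)"
    unfolding hy using arg_cong[OF cs(4), of cj] by (simp only: cj_mult cj_cj cj_of_real mult.commute)
  have root: "u + 2 * t * h + t\<^sup>2 * v = 0"
    unfolding t_def
  proof (rule rot_tan_root)
    show "0 < h + sqrt (h\<^sup>2 - u * v) \<or> u = 0"
      using d unfolding h_u_v_def by (auto intro!: add_nonneg_pos)
    show "u * v \<le> h\<^sup>2" using d unfolding h_u_v_def by auto
  qed
  have pos: "1 + t\<^sup>2 > 0" by (simp add: add_pos_nonneg)
  have ss: "cj s * s = of_real (t\<^sup>2 * c\<^sup>2)"
  proof -
    have "(norm s)\<^sup>2 = t\<^sup>2 * c\<^sup>2"
    proof -
      have "c\<^sup>2 * (1 + t\<^sup>2) = 1" using pos by (simp add: cs(3) power_divide)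
      then show ?thesis using cs(2) by (simp add: algebra_simps)
    qed
    then show ?thesis by (simp add: cj_mult_self)
  qed
  have tc: "t / sqrt (1 + t\<^sup>2) = t * c" by (simp add: cs(3))
  have "conj_by (rot a x y P) P $ x $ x
     = of_real c * of_real c * P$x$x + of_real c * (s * P$y$x) + of_real c * (P$x$y * cj s) + cj s * s * P$y$y"
    unfolding cs(1) conj_givens_xx[OF assms(2)] by (simp add: algebra_simps)
  also have "\<dots> = of_real (c * c * rp (P$x$x) + c * (t * c * h) + c * (t * c * h) + t\<^sup>2 * c\<^sup>2 * rp (P$y$y))"
    unfolding e2 cs(4) ss tc by (subst (1 2) herm_diag[OF P]) simp
  also have "c * c * rp (P$x$x) + c * (t * c * h) + c * (t * c * h) + t\<^sup>2 * c\<^sup>2 * rp (P$y$y)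
     = c\<^sup>2 * (u + 2 * t * h + t\<^sup>2 * v) + a * (c\<^sup>2 * (1 + t\<^sup>2))"
    by (simp add: h_u_v_def algebra_simps power2_eq_square)
  also have "\<dots> = a" using pos by (simp add: root cs(3) power_divide)
  finally show ?thesis .
qed

section \<open>Correcting the diagonal\<close>

lemmas continuous_on_rp [continuous_intros] = bounded_linear.continuous_on[OF bounded_linear_rp]
lemmas continuous_on_cj [continuous_intros] = bounded_linear.continuous_on[OF bounded_linear_cj]

lemma continuous_on_givens:
  assumes "continuous_on S f" "continuous_on S g"
  shows "continuous_on S (\<lambda>P. givens x y (f P) (g P))"
proof -
  have "continuous_on S (\<lambda>P. if i = x then (if j = x then of_real (f P) else if j = y then g P else 0)
     else if i = y then (if j = x then - cj (g P) else if j = y then of_real (f P) else 0)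
     else if i = j then 1 else 0)" for i j
    by (cases "i = x"; cases "i = y"; cases "j = x"; cases "j = y"; simp; intro continuous_intros assms)
  then show ?thesis unfolding givens_def by (intro continuous_on_vec_lambda)
qed

lemma continuous_on_rot:
  fixes U :: "('a::conj_field^'n^'n) set"
  assumes U: "\<And>P. P \<in> U \<Longrightarrow> P $ x $ y \<noteq> 0"
    and d: "\<And>P. P \<in> U \<Longrightarrow> (rp (P$x$x) - a) * (rp (P$y$y) - a) < (norm (P$x$y))\<^sup>2"
  shows "continuous_on U (rot a x y)"
proof -
  define t where "t P = rot_tan (norm (P$x$y)) (rp (P$x$x) - a) (rp (P$y$y) - a)" for P :: "'a^'n^'n"
  have t: "continuous_on U t"
  proof -
    have "norm (P$x$y) + sqrt ((norm (P$x$y))\<^sup>2 - (rp (P$x$x) - a) * (rp (P$y$y) - a)) > 0" if "P \<in> U" for P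
      using U[OF that] d[OF that] by (intro add_pos_pos) auto
    then have "\<forall>P\<in>U. norm (P$x$y) + sqrt ((norm (P$x$y))\<^sup>2 - (rp (P$x$x) - a) * (rp (P$y$y) - a)) \<noteq> 0"
      by (metis less_irrefl)
    then show ?thesis unfolding t_def rot_tan_def by (intro continuous_intros)
  qed
  have pos: "sqrt (1 + (t P)\<^sup>2) \<noteq> 0" for P
    by (metis add_pos_nonneg less_numeral_extra(3) real_sqrt_eq_zero_cancel_iff zero_le_power2 zero_less_one)
  have "continuous_on U (\<lambda>P. givens x y (1 / sqrt (1 + (t P)\<^sup>2))
      (of_real (t P / sqrt (1 + (t P)\<^sup>2)) * (P$x$y / of_real (norm (P$x$y)))))"
    by (intro continuous_on_givens continuous_intros t) (use pos U in auto)
  moreover have "rot a x y P = givens x y (1 / sqrt (1 + (t P)\<^sup>2))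
      (of_real (t P / sqrt (1 + (t P)\<^sup>2)) * (P$x$y / of_real (norm (P$x$y))))" if "P \<in> U" for P
    using U[OF that] unfolding rot_def Let_def t_def by (simp only: norm_eq_zero if_False)
  ultimately show ?thesis by (simp cong: continuous_on_cong)
qed

lemma continuous_on_conj_by:
  assumes "continuous_on S V" "continuous_on S f"
  shows "continuous_on S (\<lambda>P. conj_by (V P) (f P))"
  unfolding conj_by_def by (intro continuous_intros assms)

definition dev :: "('n \<Rightarrow> real) \<Rightarrow> 'a::conj_field^'n^'n \<Rightarrow> real" where
  "dev a P = (\<Sum>i\<in>UNIV. norm (P $ i $ i - of_real (a i)))"

text \<open>Near \<open>Q\<close> the unitaries \<open>V P\<close> correct the diagonal to \<open>a\<close> on \<open>B - R\<close>, touch it only in \<open>B\<close>, and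
  preserve its partial sums over the connected components of the support graph of \<open>Q\<close>: the real diagonal
  matrices commuting with \<open>Q\<close> are those constant on these components.\<close>

definition corrects_at :: "('n \<Rightarrow> real) \<Rightarrow> 'a::conj_field^'n^'n \<Rightarrow> 'n set \<Rightarrow> 'n set \<Rightarrow> real \<Rightarrow> 'a^'n^'n \<Rightarrow> 'a^'n^'n \<Rightarrow> bool" where
  "corrects_at a Q B R C V P \<longleftrightarrow> unitary V \<and> norm (V - mat 1) \<le> C * dev a P \<and>
      (\<forall>i. i \<notin> B \<longrightarrow> conj_by V P $ i $ i = P $ i $ i) \<and>
      (\<forall>i\<in>B - R. conj_by V P $ i $ i = of_real (a i)) \<and>
      (\<forall>b. rdiag b ** Q = Q ** rdiag b \<longrightarrow> rdiag b \<bullet> conj_by V P = rdiag b \<bullet> P)"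

definition correctable :: "('n \<Rightarrow> real) \<Rightarrow> 'a::conj_field^'n^'n \<Rightarrow> 'n set \<Rightarrow> 'n set \<Rightarrow> bool" where
  "correctable a Q B R \<longleftrightarrow> (\<exists>V C U. open U \<and> Q \<in> U \<and> 0 \<le> C \<and> continuous_on (U \<inter> {P. adj P = P}) V \<and>
    (\<forall>P\<in>U. adj P = P \<longrightarrow> corrects_at a Q B R C (V P) P))"

lemma sum_split_two:
  fixes f :: "'n::finite \<Rightarrow> 'a::comm_monoid_add"
  assumes "x \<noteq> y"
  shows "sum f UNIV = (f x + f y) + sum f (UNIV - {x, y})"
  using sum.subset_diff[of "{x, y}" UNIV f] assms by (simp add: add.commute)

text \<open>The new leaf \<open>x\<close>, attached at \<open>y\<close>, is rotated first. This
  settles its diagonal entry and moves the error to \<open>y \<in> B\<close>, where the correction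
  already constructed takes over without touching \<open>x\<close>. Since
  \<open>Q $ x $ y \<noteq> 0\<close>, the entry stays away from 0 near \<open>Q\<close>, so the
  rotation is continuous and small.\<close>

lemma correctable_step:
  fixes Q :: "'a::conj_field^'n^'n"
  assumes Q: "adj Q = Q" "\<And>i. Q $ i $ i = of_real (a i)"
    and corr: "correctable a Q B R" and x: "x \<notin> B" "x \<notin> R" and y: "y \<in> B" and xy: "Q $ x $ y \<noteq> 0"
  shows "correctable a Q (insert x B) R"
proof -
  have ne: "x \<noteq> y" using x y by auto
  obtain V C U where U: "open U" "Q \<in> U" and C: "0 \<le> C" and V: "continuous_on (U \<inter> {P. adj P = P}) V"
    and VP: "\<And>P. P \<in> U \<Longrightarrow> adj P = P \<Longrightarrow> corrects_at a Q B R C (V P) P"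
    using corr unfolding correctable_def by blast
  define m where "m = norm (Q $ x $ y)"
  have m: "m > 0" using xy by (simp add: m_def)
  \<comment> \<open>The second condition is positivity of the discriminant. With the first it makes
    the rotation continuous and bounds its tangent by \<open>2 / m\<close> times the diagonal
    error.\<close>
  define W where "W = {P::'a^'n^'n. m / 2 < norm (P$x$y)} \<inter>
     {P. (rp (P$x$x) - a x) * (rp (P$y$y) - a x) < (norm (P$x$y))\<^sup>2}"
  have W: "open W" unfolding W_def
    by (intro open_Int open_Collect_less continuous_intros)
  have QW: "Q \<in> W" using m Q by (simp add: W_def m_def)
  have nz: "P $ x $ y \<noteq> 0" if "P \<in> W" for P using that m by (auto simp: W_def)
  have rotc: "continuous_on W (rot (a x) x y)"
    by (rule continuous_on_rot) (use nz in \<open>auto simp: W_def\<close>)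
  define F where "F P = conj_by (rot (a x) x y P) P" for P :: "'a^'n^'n"
  have Fc: "continuous_on W F" unfolding F_def
    by (intro continuous_on_conj_by rotc continuous_intros)
  have rotQ: "rot (a x) x y Q = mat 1"
    using Q by (simp add: rot_def rot_tan_def Let_def givens_1[OF ne])
  then have FQ: "F Q = Q" by (simp add: F_def)
  define U' where "U' = W \<inter> F -` U"
  have U': "open U'" "Q \<in> U'"
    using continuous_open_preimage[OF Fc W U(1)] QW FQ U(2) by (auto simp: U'_def)
  define V' where "V' P = V (F P) ** rot (a x) x y P" for P
  \<comment> \<open>\<open>norm (mat 1)\<close> is the norm of the rotation, as of every unitary
    matrix; \<open>4 / m\<close> is the factor 2 of \<open>norm_givens_minus_1\<close> times the
    bound \<open>2 / m\<close> on the tangent.\<close>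
  define C' where "C' = C * norm (mat 1 :: 'a^'n^'n) + 4 / m"
  have Fh: "adj (F P) = F P" if "adj P = P" for P
    using that by (simp add: F_def adj_conj_by)
  have V'c: "continuous_on (U' \<inter> {P. adj P = P}) V'"
    unfolding V'_def
  proof (intro continuous_on_mm continuous_on_subset[OF rotc] continuous_on_compose2[OF V]
      continuous_on_subset[OF Fc])
    show "F ` (U' \<inter> {P. adj P = P}) \<subseteq> U \<inter> {P. adj P = P}" using Fh by (auto simp: U'_def)
  qed (auto simp: U'_def)
  have main: "corrects_at a Q (insert x B) R C' (V' P) P"
    if P: "P \<in> U'" "adj P = P" for P
  proof -
    have PW: "P \<in> W" and FU: "F P \<in> U" using P by (auto simp: U'_def)
    define t where "t = rot_tan (norm (P$x$y)) (rp (P$x$x) - a x) (rp (P$y$y) - a x)"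
    obtain c s where cs: "rot (a x) x y P = givens x y c s" "c\<^sup>2 + (norm s)\<^sup>2 = 1" "0 \<le> c" "norm s \<le> \<bar>t\<bar>"
      using rot_givens[of "a x" x y P] unfolding t_def by metis
    have Geq: "F P = conj_by (givens x y c s) P" by (simp add: F_def cs)
    have Fx: "F P $ x $ x = of_real (a x)"
      unfolding F_def by (rule rot_diag[OF P(2) ne]) (use PW in \<open>auto simp: W_def\<close>)
    have Fo: "F P $ i $ i = P $ i $ i" if "i \<noteq> x" "i \<noteq> y" for i
      unfolding Geq by (rule conj_givens_other[OF ne that])
    have Fs: "F P $ x $ x + F P $ y $ y = P $ x $ x + P $ y $ y"
      unfolding Geq by (rule conj_givens_sum[OF ne cs(2)])
    \<comment> \<open>The error at \<open>x\<close> disappears and that at \<open>y\<close> becomes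
      the sum of both, so the total cannot grow.\<close>
    have devF: "dev a (F P) \<le> dev a P"
    proof -
      have e: "F P $ y $ y - of_real (a y) = (P $ x $ x - of_real (a x)) + (P $ y $ y - of_real (a y))"
        using Fs unfolding Fx by (simp add: algebra_simps)
      have "norm (F P $ x $ x - of_real (a x)) + norm (F P $ y $ y - of_real (a y))
         \<le> norm (P $ x $ x - of_real (a x)) + norm (P $ y $ y - of_real (a y))"
        unfolding e unfolding Fx by (simp add: norm_triangle_ineq)
      moreover have "(\<Sum>i\<in>UNIV - {x,y}. norm (F P $ i $ i - of_real (a i)))
          = (\<Sum>i\<in>UNIV - {x,y}. norm (P $ i $ i - of_real (a i)))"
        by (rule sum.cong) (auto simp: Fo)
      ultimately show ?thesis unfolding dev_def by (subst (1 2) sum_split_two[OF ne]) simp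
    qed
    note VF = VP[OF FU Fh[OF P(2)], unfolded corrects_at_def]
    have t: "\<bar>t\<bar> \<le> (2 / m) * dev a P"
    proof -
      define h u v where "h = norm (P$x$y)" "u = rp (P$x$x) - a x" "v = rp (P$y$y) - a x"
      have h: "m / 2 < h" "u * v \<le> h\<^sup>2" using PW by (auto simp: W_def h_u_v_def)
      have "\<bar>t\<bar> = \<bar>u\<bar> / (h + sqrt (h\<^sup>2 - u * v))"
        using h m unfolding t_def h_u_v_def[symmetric] rot_tan_def by (simp add: abs_divide)
      also have "\<dots> \<le> \<bar>u\<bar> / (m / 2)"
        using h m by (intro divide_left_mono mult_pos_pos add_pos_nonneg) (auto intro: add_increasing2)
      also have "\<bar>u\<bar> = norm (P$x$x - of_real (a x))"
      proof -
        have "P$x$x - of_real (a x) = of_real u"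
          using herm_diag[OF P(2), of x] by (simp add: h_u_v_def)
        then show ?thesis by simp
      qed
      also have "\<dots> \<le> dev a P" unfolding dev_def by (rule member_le_sum) auto
      finally show ?thesis using m by (simp add: divide_right_mono mult.commute)
    qed
    have un: "unitary (rot (a x) x y P)" unfolding cs(1) by (rule unitary_givens[OF ne cs(2)])
    have "V' P - mat 1 = (V (F P) - mat 1) ** rot (a x) x y P + (rot (a x) x y P - mat 1)"
      by (simp add: V'_def mm_simps)
    then have "norm (V' P - mat 1) \<le> norm ((V (F P) - mat 1) ** rot (a x) x y P) + norm (rot (a x) x y P - mat 1)"
      by (simp only: norm_triangle_ineq)
    also have "\<dots> \<le> (C * dev a P) * norm (mat 1 :: 'a^'n^'n) + 2 * ((2 / m) * dev a P)"
    proof (intro add_mono)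
      have "norm (V (F P) - mat 1) \<le> C * dev a P"
        using VF mult_left_mono[OF devF C] by linarith
      then show "norm ((V (F P) - mat 1) ** rot (a x) x y P) \<le> (C * dev a P) * norm (mat 1 :: 'a^'n^'n)"
        by (intro order_trans[OF norm_mm]) (simp add: norm_unitary[OF un] mult_right_mono)
      show "norm (rot (a x) x y P - mat 1) \<le> 2 * ((2 / m) * dev a P)"
        using norm_givens_minus_1[OF ne cs(2,3)] cs(1,4) t by simp
    qed
    also have "\<dots> = C' * dev a P" by (simp add: C'_def algebra_simps)
    finally have bound: "norm (V' P - mat 1) \<le> C' * dev a P" .
    have cb: "conj_by (V' P) P = conj_by (V (F P)) (F P)"
      by (simp add: V'_def F_def conj_by_mult)
    have "rdiag b \<bullet> F P = rdiag b \<bullet> P" if "rdiag b ** Q = Q ** rdiag b" for b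
    proof -
      have b: "b x = b y" using that xy by (simp add: rdiag_commute_iff)
      have "rp (F P $ x $ x) + rp (F P $ y $ y) = rp (P $ x $ x) + rp (P $ y $ y)"
        using arg_cong[OF Fs, of rp] by (simp only: rp_add)
      then have "b x * rp (F P $ x $ x) + b y * rp (F P $ y $ y) = b x * rp (P $ x $ x) + b y * rp (P $ y $ y)"
        unfolding b by (simp only: distrib_left[symmetric])
      moreover have "(\<Sum>i\<in>UNIV - {x,y}. b i * rp (F P $ i $ i)) = (\<Sum>i\<in>UNIV - {x,y}. b i * rp (P $ i $ i))"
        by (rule sum.cong) (auto simp: Fo)
      ultimately show ?thesis unfolding inner_rdiag by (subst (1 2) sum_split_two[OF ne]) simp
    qed
    then show ?thesis
      unfolding corrects_at_def cb using VF x y Fx Fo bound un by (auto simp: V'_def intro: unitary_mult)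
  qed
  show ?thesis unfolding correctable_def
    by (rule exI[of _ V'], rule exI[of _ C'], rule exI[of _ U'])
      (use U' V'c main C m in \<open>auto simp: C'_def\<close>)
qed

definition balanced :: "'a::conj_field^'n^'n \<Rightarrow> 'a^'n^'n \<Rightarrow> bool" where
  "balanced Q P \<longleftrightarrow> (\<forall>b. rdiag b ** Q = Q ** rdiag b \<longrightarrow> rdiag b \<bullet> P = rdiag b \<bullet> Q)"

text \<open>\<open>R\<close> holds one root per component of the support graph of \<open>Q\<close>.
  From \<open>B = R\<close>, edges leaving \<open>B\<close> add vertices until all are reached. The
  roots themselves are not corrected, but the preserved component sums of a balanced
  \<open>P\<close> leave no room for an error there.\<close>

lemma correction:
  fixes Q :: "'a::conj_field^'n^'n"
  assumes Q: "Q \<in> projs a"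
  shows "\<exists>U C V. open U \<and> Q \<in> U \<and> 0 \<le> C \<and> continuous_on (U \<inter> {P. adj P = P}) V \<and>
    (\<forall>P\<in>U. adj P = P \<longrightarrow> unitary (V P) \<and> norm (V P - mat 1) \<le> C * dev a P \<and>
      (balanced Q P \<longrightarrow> (\<forall>i. conj_by (V P) P $ i $ i = of_real (a i))))"
proof -
  have Qh: "adj Q = Q" and Qd: "Q $ i $ i = of_real (a i)" for i
    using Q by (auto simp: projs_def proj_def)
  define E where "E = (\<lambda>i j. Q $ i $ j \<noteq> 0)\<^sup>*\<^sup>*"
  have Esym: "E j i" if "E i j" for i j
    using that unfolding E_def
  proof (induction rule: rtranclp_induct)
    case (step y z)
    then show ?case using herm_nth[OF Qh, of z y] by (intro converse_rtranclp_into_rtranclp[of _ z y i]) auto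
  qed simp
  have Etr: "E i j \<Longrightarrow> E j k \<Longrightarrow> E i k" for i j k unfolding E_def by (rule rtranclp_trans)
  define rep where "rep i = (SOME j. E i j)" for i
  have Erep: "E i (rep i)" for i
    unfolding rep_def by (rule someI[of _ i]) (simp add: E_def)
  have repeq: "rep i = rep j" if "E i j" for i j
  proof -
    have "E i = E j" using that Esym Etr by blast
    then show ?thesis by (simp add: rep_def)
  qed
  define R where "R = range rep"
  have "correctable a Q R R"
    unfolding correctable_def
    by (rule exI[of _ "\<lambda>_. mat 1"], rule exI[of _ 0], rule exI[of _ UNIV]) (auto simp: corrects_at_def)
  then have "\<exists>B. R \<subseteq> B \<and> correctable a Q B R" by blast
  moreover have fin: "finite {B. R \<subseteq> B \<and> correctable a Q B R}" by simp
  ultimately obtain B where B: "R \<subseteq> B" "correctable a Q B R"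
    and max: "\<And>B'. R \<subseteq> B' \<Longrightarrow> correctable a Q B' R \<Longrightarrow> B \<subseteq> B' \<Longrightarrow> B = B'"
    using finite_has_maximal[OF fin] by auto
  have "B = UNIV"
  proof (rule ccontr)
    assume "B \<noteq> UNIV"
    then obtain x where x: "x \<notin> B" by auto
    have Ex: "E (rep x) x" by (rule Esym[OF Erep])
    obtain y z where yz: "y \<in> B" "z \<notin> B" "Q $ y $ z \<noteq> 0"
    proof (rule ccontr)
      note thesisI = that
      assume no: "\<not> thesis"
      have closed: "z \<in> B" if "y \<in> B" "Q $ y $ z \<noteq> 0" for y z
        using thesisI[OF that(1) _ that(2)] no by blast
      have "z \<in> B" if "E (rep x) z" for z
        using that unfolding E_def
      proof (induction rule: rtranclp_induct)
        case base show ?case using B(1) by (auto simp: R_def)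
      next
        case (step y z) then show ?case using closed by blast
      qed
      then show False using Ex x by blast
    qed
    have "Q $ y $ z = cj (Q $ z $ y)" by (rule herm_nth[OF Qh])
    then have zy: "Q $ z $ y \<noteq> 0" using yz(3) by auto
    have "z \<notin> R" using yz(2) B(1) by blast
    then have "correctable a Q (insert z B) R"
      by (rule correctable_step[OF Qh Qd B(2) yz(2) _ yz(1) zy])
    then have "B = insert z B" using B(1) by (intro max) blast+
    then show False using yz(2) by blast
  qed
  then obtain V C U where U: "open U" "Q \<in> U" "0 \<le> C" and V: "continuous_on (U \<inter> {P. adj P = P}) V"
    and VP0: "\<And>P. P \<in> U \<Longrightarrow> adj P = P \<Longrightarrow> corrects_at a Q UNIV R C (V P) P"
    using B(2) unfolding correctable_def by blast
  note VP = VP0[unfolded corrects_at_def]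
  have "conj_by (V P) P $ i $ i = of_real (a i)" if P: "P \<in> U" "adj P = P" and "balanced Q P" for P i
  proof -
    have bal: "rdiag b \<bullet> P = rdiag b \<bullet> Q" if "rdiag b ** Q = Q ** rdiag b" for b
      using \<open>balanced Q P\<close> that by (simp add: balanced_def)
    define D where "D = conj_by (V P) P"
    show ?thesis
    proof (cases "i \<in> R")
      case True
      then have repi: "rep i = i" using repeq[OF Erep] by (auto simp: R_def)
      \<comment> \<open>The indicator of the component with root \<open>i\<close>; all its other
        vertices lie outside \<open>R\<close> and are already correct.\<close>
      define b where "b j = (if rep j = i then 1 else 0 :: real)" for j
      have comm: "rdiag b ** Q = Q ** rdiag b"
      proof -
        have "rep j = rep k" if "Q $ j $ k \<noteq> 0" for j k
          by (rule repeq) (use that in \<open>auto simp: E_def\<close>)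
        then show ?thesis by (auto simp: rdiag_commute_iff b_def)
      qed
      have other: "b j * rp (D $ j $ j) = b j * a j" if "j \<noteq> i" for j
      proof (cases "rep j = i")
        case True
        have "j \<notin> R"
        proof
          assume "j \<in> R"
          then have "rep j = j" using repeq[OF Erep] by (auto simp: R_def)
          then show False using True that by simp
        qed
        then show ?thesis using VP[OF P] by (simp add: D_def)
      qed (simp add: b_def)
      have "rdiag b \<bullet> D = rdiag b \<bullet> Q" using VP[OF P] comm bal[OF comm] by (simp add: D_def)
      then have "(\<Sum>j\<in>UNIV. b j * rp (D $ j $ j)) = (\<Sum>j\<in>UNIV. b j * a j)"
        by (simp add: inner_rdiag Qd)
      moreover have "(\<Sum>j\<in>UNIV - {i}. b j * rp (D $ j $ j)) = (\<Sum>j\<in>UNIV - {i}. b j * a j)"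
        by (rule sum.cong) (auto simp: other)
      ultimately have "b i * rp (D $ i $ i) = b i * a i"
        by (simp add: sum.remove[of UNIV i])
      then have "rp (D $ i $ i) = a i" using repi by (simp add: b_def)
      then show ?thesis using herm_diag[OF adj_conj_by[OF P(2)], of "V P" i] by (simp add: D_def)
    qed (use VP[OF P] in auto)
  qed
  then show ?thesis using U V VP
    by (intro exI[of _ U] exI[of _ C] exI[of _ V]) blast
qed

section \<open>Local path connectedness\<close>

lemma projs_D:
  assumes "P \<in> projs a"
  shows "proj P" "adj P = P" "P ** P = P" "P $ i $ i = of_real (a i)"
  using assms by (auto simp: projs_def proj_def)

lemma dev_projs: "P \<in> projs a \<Longrightarrow> dev a P = 0"
  by (simp add: dev_def projs_def)

lemma row_norm:
  assumes "proj P" shows "rp (P $ i $ i) = (\<Sum>j\<in>UNIV. (norm (P $ i $ j))\<^sup>2)"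
proof -
  have P: "P ** P = P" "adj P = P" using assms by (auto simp: proj_def)
  have "P $ i $ i = (\<Sum>j\<in>UNIV. P $ i $ j * P $ j $ i)"
    by (subst P(1)[symmetric]) (simp add: matrix_matrix_mult_def)
  also have "\<dots> = (\<Sum>j\<in>UNIV. of_real ((norm (P $ i $ j))\<^sup>2))"
  proof (rule sum.cong[OF refl])
    fix j
    have "P $ j $ i = cj (P $ i $ j)" by (rule herm_nth[OF P(2)])
    then show "P $ i $ j * P $ j $ i = of_real ((norm (P $ i $ j))\<^sup>2)" by (simp only: mult_cj)
  qed
  finally show ?thesis by (simp only: rp_sum rp_of_real)
qed

lemma norm_projs:
  assumes "P \<in> projs a" shows "(norm P)\<^sup>2 = (\<Sum>i\<in>UNIV. a i)"
proof -
  have "rp (P $ i $ i) = a i" for i using projs_D(4)[OF assms] by simp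
  then show ?thesis unfolding norm_mat_sq using row_norm[OF projs_D(1)[OF assms]] by simp
qed

lemma compact_projs: "compact (projs a :: ('a::conj_field^'n^'n) set)"
proof -
  have "norm P \<le> sqrt (\<Sum>i\<in>UNIV. a i)" if "P \<in> projs a" for P :: "'a^'n^'n"
    using norm_projs[OF that] by (simp add: real_le_rsqrt)
  then have "bounded (projs a :: ('a^'n^'n) set)" unfolding bounded_iff by blast
  moreover have "closed (projs a :: ('a^'n^'n) set)"
    unfolding projs_def proj_def by (intro closed_Collect_conj closed_Collect_all closed_Collect_eq continuous_intros)
  ultimately show ?thesis by (simp add: compact_eq_bounded_closed)
qed

lemma chart_dist:
  assumes "norm X \<le> 1/4"
  shows "norm (chart Q X - Q) \<le> (3 + 2 * norm Q) * norm X"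
proof -
  have "norm (chart Q X - Q) \<le> norm (chart Q X - Q - X) + norm X"
    using norm_triangle_ineq[of "chart Q X - Q - X" X] by simp
  also have "\<dots> \<le> (2 + 2 * norm Q) * (norm X)\<^sup>2 + norm X"
    using chart_near[OF assms] by simp
  also have "(2 + 2 * norm Q) * (norm X)\<^sup>2 \<le> (2 + 2 * norm Q) * norm X"
  proof (rule mult_left_mono)
    have "norm X * norm X \<le> 1 * norm X" using assms by (intro mult_right_mono) auto
    then show "(norm X)\<^sup>2 \<le> norm X" by (simp add: power2_eq_square)
  qed simp
  finally show ?thesis by (simp add: algebra_simps)
qed

text \<open>Write \<open>P = chart Q X\<close> and follow \<open>chart Q (s X)\<close>. Both ends
  have equal pairings with the commuting diagonals, so \<open>quad Q X\<close> pairs to 0 and so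
  does \<open>s^2\<close> times it: the whole path is balanced and can be corrected. At the ends
  \<open>dev\<close> vanishes, which forces \<open>V = mat 1\<close>, so the endpoints do not
  move.\<close>

lemma projs_locally_path_connected:
  fixes Q :: "'a::conj_field^'n^'n"
  assumes Q: "Q \<in> projs a"
  obtains d where "d > 0" "\<And>P. P \<in> projs a \<Longrightarrow> norm (P - Q) < d \<Longrightarrow> path_component (projs a) P Q"
proof -
  obtain U C V where U: "open U" "Q \<in> U" "0 \<le> C" and Vc: "continuous_on (U \<inter> {P. adj P = P}) V"
    and V: "\<forall>P\<in>U. adj P = P \<longrightarrow> unitary (V P) \<and> norm (V P - mat 1) \<le> C * dev a P \<and>
      (balanced Q P \<longrightarrow> (\<forall>i. conj_by (V P) P $ i $ i = of_real (a i)))"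
    using correction[OF Q] by blast
  obtain e where e: "e > 0" "ball Q e \<subseteq> U" using U openE by blast
  define q where "q = norm Q"
  define K where "K = 4 * (q + q\<^sup>2) + 1"
  have q: "0 \<le> q" by (simp add: q_def)
  have K: "K > 0" using q by (simp add: K_def add_nonneg_pos)
  \<comment> \<open>The three radii guarantee in turn that the chart reaches \<open>P\<close>, that
    \<open>norm X \<le> 1/4\<close>, and that the path stays in \<open>ball Q e\<close>.\<close>
  define d where "d = min (1/4) (min (1 / (4 * K)) (e / ((3 + 2 * q) * K)))"
  have d: "d > 0" using K e q by (simp add: d_def add_pos_nonneg)
  show thesis
  proof (rule that[OF d])
    fix P :: "'a^'n^'n" assume P: "P \<in> projs a" and near: "norm (P - Q) < d"
    have "norm (P - Q) \<le> 1/4" using near by (simp add: d_def)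
    then obtain X where X: "tangent Q X" "norm (X ** X) \<le> 1/16" "chart Q X = P"
      and nX: "norm X \<le> 4 * (norm Q + (norm Q)\<^sup>2) * norm (P - Q)"
      by (rule chart_surj[OF projs_D(1)[OF Q] projs_D(1)[OF P]])
    have nXd: "norm X \<le> K * norm (P - Q)"
      using nX unfolding K_def q_def by (simp add: distrib_right add_increasing2)
    also have "\<dots> < K * d" using near K by simp
    finally have nX: "norm X < K * d" .
    have "K * d \<le> K * (1 / (4 * K))" using K by (intro mult_left_mono) (auto simp: d_def)
    then have X4: "norm X \<le> 1/4" using nX K by simp
    have "K * d \<le> K * (e / ((3 + 2 * q) * K))" using K by (intro mult_left_mono) (auto simp: d_def)
    then have "norm X < e / (3 + 2 * q)" using nX K by simp
    then have Xe: "(3 + 2 * q) * norm X < e" using q by (simp add: field_simps)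
    define c where "c s = chart Q (s *\<^sub>R X)" for s :: real
    have Qp: "proj Q" by (rule projs_D(1)[OF Q])
    have sX: "norm (s *\<^sub>R X) \<le> norm X" if "s \<in> {0..1}" for s
      using that by (simp add: mult_left_le_one_le)
    have cU: "c s \<in> U" if "s \<in> {0..1}" for s
    proof -
      have "norm (c s - Q) \<le> (3 + 2 * q) * norm (s *\<^sub>R X)"
        unfolding c_def q_def by (rule chart_dist) (use sX[OF that] X4 in linarith)
      also have "\<dots> \<le> (3 + 2 * q) * norm X" using sX[OF that] q by (intro mult_left_mono) auto
      finally have "norm (c s - Q) < e" using Xe by linarith
      then show ?thesis using e(2) by (auto simp: dist_norm norm_minus_commute)
    qed
    have sXX: "norm ((s *\<^sub>R X) ** (s *\<^sub>R X)) \<le> 1/16" if "s \<in> {0..1}" for s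
      by (rule norm_square_le) (use sX[OF that] X4 in linarith)
    have cp: "proj (c s)" if "s \<in> {0..1}" for s
      unfolding c_def by (rule proj_chart[OF Qp tangent_scaleR[OF X(1)] sXX[OF that]])
    then have ch: "adj (c s) = c s" if "s \<in> {0..1}" for s using that by (simp add: proj_def)
    have bal: "balanced Q (c s)" if s: "s \<in> {0..1}" for s
      unfolding balanced_def
    proof (intro allI impI)
      fix b assume b: "rdiag b ** Q = Q ** rdiag b"
      have "rdiag b \<bullet> P = rdiag b \<bullet> Q"
        using projs_D(4)[OF P] projs_D(4)[OF Q] by (simp add: inner_rdiag)
      then have "rdiag b \<bullet> quad Q X = 0"
        using inner_chart[OF Qp X(1,2) b] X(3) by simp
      then show "rdiag b \<bullet> c s = rdiag b \<bullet> Q"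
        using inner_chart[OF Qp tangent_scaleR[OF X(1)] sXX[OF s] b]
        by (simp add: c_def quad_scaleR)
    qed
    define g where "g s = conj_by (V (c s)) (c s)" for s
    have "continuous_on {0..1} c" unfolding c_def by (rule continuous_on_chart[OF X(2)])
    then have "continuous_on {0..1} g" unfolding g_def
      by (intro continuous_on_conj_by continuous_on_compose2[OF Vc]) (use cU ch in auto)
    moreover have "g s \<in> projs a" if "s \<in> {0..1}" for s
    proof -
      have "unitary (V (c s))" "\<forall>i. conj_by (V (c s)) (c s) $ i $ i = of_real (a i)"
        using V cU[OF that] ch[OF that] bal[OF that] by blast+
      then show ?thesis using proj_conj_by[OF cp[OF that]] by (simp add: projs_def g_def)
    qed
    moreover have "g 0 = Q"
    proof -
      have "norm (V Q - mat 1) \<le> C * dev a Q" using V U(2) projs_D(2)[OF Q] by blast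
      then have "V Q = mat 1" using dev_projs[OF Q] by simp
      then show ?thesis by (simp add: g_def c_def)
    qed
    moreover have "g 1 = P"
    proof -
      have "P \<in> U" using cU[of 1] X(3) by (simp add: c_def)
      then have "norm (V P - mat 1) \<le> C * dev a P" using V projs_D(2)[OF P] by blast
      then have "V P = mat 1" using dev_projs[OF P] by simp
      then show ?thesis by (simp add: g_def c_def X(3))
    qed
    ultimately have "path_component (projs a) Q P"
      unfolding path_component_def path_def path_image_def pathstart_def pathfinish_def
      by (intro exI[of _ g]) auto
    then show "path_component (projs a) P Q" by (rule path_component_sym)
  qed
qed

text \<open>A limit point of the component lies in the compact set \<open>projs a\<close> and is
  joined to all points of \<open>projs a\<close> near it, among them points of the
  component.\<close>

lemma compact_path_component_projs: "compact (path_component_set (projs a) (P :: 'a::conj_field^'n^'n))"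
proof -
  have "closure (path_component_set (projs a) P) \<subseteq> path_component_set (projs a) P"
  proof
    fix Q assume "Q \<in> closure (path_component_set (projs a) P)"
    then have Q: "\<forall>e>0. \<exists>y\<in>path_component_set (projs a) P. dist y Q < e"
      by (simp only: closure_approachable)
    have "closed (projs a :: ('a^'n^'n) set)" using compact_projs compact_imp_closed by blast
    then have "closure (path_component_set (projs a) P) \<subseteq> projs a"
      by (intro closure_minimal path_component_subset)
    then have "Q \<in> projs a" using \<open>Q \<in> closure _\<close> by blast
    then obtain d where d: "d > 0" "\<And>R. R \<in> projs a \<Longrightarrow> norm (R - Q) < d \<Longrightarrow> path_component (projs a) R Q"
      using projs_locally_path_connected[of Q a] by blast
    obtain R where R: "path_component (projs a) P R" "dist R Q < d" using Q d(1) by auto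
    then have "path_component (projs a) R Q"
      using d(2) path_component_mem(2)[OF R(1)] by (simp add: dist_norm)
    then show "Q \<in> path_component_set (projs a) P" using path_component_trans[OF R(1)] by simp
  qed
  then have "closed (path_component_set (projs a) P)"
    using closure_subset_eq by blast
  moreover have "bounded (path_component_set (projs a) P)"
    using bounded_subset[OF compact_imp_bounded[OF compact_projs] path_component_subset] .
  ultimately show ?thesis by (simp add: compact_eq_bounded_closed)
qed

text \<open>Nearby points of \<open>projs a\<close> belong to the same component, so a minimum over
  the component is a local minimum in \<open>projs a\<close>. The radius \<open>d\<close> lets the
  variational arguments ignore components.\<close>

lemma path_component_minimum:
  fixes P :: "'a::conj_field^'n^'n"
  assumes "P \<in> projs a" and f: "continuous_on UNIV f"
  obtains Q d where "path_component (projs a) P Q" "\<And>R. path_component (projs a) P R \<Longrightarrow> f Q \<le> (f R :: real)"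
    "d > 0" "\<And>R. R \<in> projs a \<Longrightarrow> norm (R - Q) < d \<Longrightarrow> f Q \<le> f R"
proof -
  have "path_component_set (projs a) P \<noteq> {}" using assms(1) path_component_refl_eq by blast
  then obtain Q where Q: "path_component (projs a) P Q" "\<And>R. path_component (projs a) P R \<Longrightarrow> f Q \<le> f R"
    using continuous_attains_inf[OF compact_path_component_projs, of a P f] continuous_on_subset[OF f] by auto
  obtain d where d: "d > 0" "\<And>R. R \<in> projs a \<Longrightarrow> norm (R - Q) < d \<Longrightarrow> path_component (projs a) R Q"
    using projs_locally_path_connected[OF path_component_mem(2)[OF Q(1)]] by blast
  show thesis
  proof (rule that[OF Q d(1)])
    fix R assume "R \<in> projs a" "norm (R - Q) < d"
    then have "path_component (projs a) Q R" by (intro path_component_sym[OF d(2)])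
    then show "f Q \<le> f R" using Q(2) path_component_trans[OF Q(1)] by blast
  qed
qed

section \<open>Descent directions\<close>

text \<open>For unitary \<open>V = mat 1 + A\<close> the matrix \<open>A\<close> is skew up to
  \<open>A ** adj A\<close>, so the first-order change of \<open>E \<bullet> R\<close> is
  \<open>A \<bullet> (E ** R - R ** E)\<close>. If \<open>E\<close> nearly commutes with
  \<open>R\<close>, conjugation by \<open>V\<close> influences the value much less than its size
  suggests.\<close>

lemma conj_by_estimate:
  fixes R V E :: "'a::conj_field^'n^'n"
  assumes V: "unitary V" and R: "adj R = R"
  defines "\<eta> \<equiv> norm (V - mat 1)"
  shows "\<bar>E \<bullet> conj_by V R - E \<bullet> R\<bar> \<le> (norm (E ** R - R ** E) + 2 * norm E * norm R * \<eta>) * \<eta>"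
    "norm (conj_by V R - R) \<le> 2 * norm R * norm (mat 1 :: 'a^'n^'n) * \<eta>"
proof -
  define A where "A = V - mat 1"
  have VA: "V = mat 1 + A" by (simp add: A_def)
  have "V ** adj V = mat 1" using V by (simp add: unitary_def)
  then have A: "adj A = - A - A ** adj A"
    by (simp add: VA adj_add mm_simps algebra_simps eq_neg_iff_add_eq_0)
  have "conj_by V R = R + A ** R + R ** adj A + A ** (R ** adj A)"
    by (simp add: conj_by_def VA adj_add mm_simps algebra_simps)
  moreover have "R ** adj A = - (R ** A) - R ** (A ** adj A)"
    by (subst A) (simp only: mm_simps)
  ultimately have "conj_by V R = R + A ** R - R ** A - R ** (A ** adj A) + A ** (R ** adj A)"
    by (simp only: diff_conv_add_uminus add.assoc)
  moreover have "E \<bullet> (A ** R) - E \<bullet> (R ** A) = A \<bullet> (E ** R - R ** E)"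
    using inner_mm_left[of A R E] inner_mm_right[of R A E]
    by (simp add: inner_commute R inner_diff_right)
  ultimately have eq: "E \<bullet> conj_by V R - E \<bullet> R = A \<bullet> (E ** R - R ** E) - E \<bullet> (R ** (A ** adj A)) + E \<bullet> (A ** (R ** adj A))"
    by (simp add: inner_add_right inner_diff_right)
  have "\<bar>A \<bullet> (E ** R - R ** E)\<bar> \<le> \<eta> * norm (E ** R - R ** E)"
    unfolding \<eta>_def A_def by (rule Cauchy_Schwarz_ineq2)
  moreover have "\<bar>E \<bullet> (R ** (A ** adj A))\<bar> \<le> norm E * (norm R * (\<eta> * \<eta>))"
    by (rule order_trans[OF Cauchy_Schwarz_ineq2])
      (intro mult_left_mono order_trans[OF norm_mm] mult_mono norm_ge_zero, auto simp: \<eta>_def A_def)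
  moreover have "\<bar>E \<bullet> (A ** (R ** adj A))\<bar> \<le> norm E * (\<eta> * (norm R * \<eta>))"
    by (rule order_trans[OF Cauchy_Schwarz_ineq2])
      (intro mult_left_mono order_trans[OF norm_mm] mult_mono norm_ge_zero, auto simp: \<eta>_def A_def)
  ultimately have "\<bar>E \<bullet> conj_by V R - E \<bullet> R\<bar> \<le> \<eta> * norm (E ** R - R ** E) + norm E * (norm R * (\<eta> * \<eta>)) + norm E * (\<eta> * (norm R * \<eta>))"
    unfolding eq by linarith
  then show "\<bar>E \<bullet> conj_by V R - E \<bullet> R\<bar> \<le> (norm (E ** R - R ** E) + 2 * norm E * norm R * \<eta>) * \<eta>"
    by (simp add: algebra_simps)
  have "conj_by V R - R = (V ** R - R ** V) ** adj V"
    using V by (simp add: conj_by_def unitary_def mm_simps)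
  also have "V ** R - R ** V = A ** R - R ** A" by (simp add: VA mm_simps)
  finally have "norm (conj_by V R - R) \<le> norm (A ** R - R ** A) * norm (adj V)"
    by (simp only: norm_mm)
  also have "\<dots> \<le> (\<eta> * norm R + norm R * \<eta>) * norm (mat 1 :: 'a^'n^'n)"
    unfolding norm_adj norm_unitary[OF V]
    by (intro mult_right_mono order_trans[OF norm_triangle_ineq4] add_mono order_trans[OF norm_mm])
      (auto simp: \<eta>_def A_def)
  finally show "norm (conj_by V R - R) \<le> 2 * norm R * norm (mat 1 :: 'a^'n^'n) * \<eta>"
    by (simp add: algebra_simps)
qed

text \<open>Along \<open>chart Q (e X)\<close> the diagonal error is of order \<open>e^2\<close>,
  hence so is the correction; \<open>bal\<close> makes the corrected diagonal exactly
  \<open>a\<close>. In the first-order case the gain \<open>e * (E \<bullet> X)\<close> dominates.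
  In the second-order case \<open>E\<close> commutes with \<open>Q\<close>, its commutator with the
  moving point is of order \<open>e\<close>, and the correction costs order \<open>e^3\<close>
  against the gain \<open>e^2 * (E \<bullet> quad Q X)\<close>.\<close>

lemma descent:
  fixes Q :: "'a::conj_field^'n^'n"
  assumes Q: "Q \<in> projs a" and X: "tangent Q X" and diag: "\<And>i. X $ i $ i = 0"
    and bal: "\<And>b. rdiag b ** Q = Q ** rdiag b \<Longrightarrow> rdiag b \<bullet> quad Q X = 0"
    and neg: "E \<bullet> X < 0 \<or> E ** Q = Q ** E \<and> E \<bullet> X = 0 \<and> E \<bullet> quad Q X < 0"
    and d: "d > 0"
  shows "\<exists>P\<in>projs a. norm (P - Q) < d \<and> E \<bullet> P < E \<bullet> Q"
proof -
  obtain U C V where U: "open U" "Q \<in> U" "0 \<le> C"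
    and V: "\<forall>P\<in>U. adj P = P \<longrightarrow> unitary (V P) \<and> norm (V P - mat 1) \<le> C * dev a P \<and>
      (balanced Q P \<longrightarrow> (\<forall>i. conj_by (V P) P $ i $ i = of_real (a i)))"
    using correction[OF Q] by blast
  obtain r where r: "r > 0" "ball Q r \<subseteq> U" using U openE by blast
  have Qp: "proj Q" and Qh: "adj Q = Q" using projs_D[OF Q] by auto
  define x q where "x = norm X" and "q = norm Q"
  define R where "R e = chart Q (e *\<^sub>R X)" for e :: real
  define P where "P e = conj_by (V (R e)) (R e)" for e :: real
  define m where "m = norm (mat 1 :: 'a^'n^'n)"
  define D where "D = C * (real CARD('n) * ((2 + 2 * q) * x\<^sup>2))"
  define M where "M = 2 * norm E * (x + (2 + 2 * q) * x\<^sup>2)"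
  define N where "N = q + (3 + 2 * q) * x"
  have nonneg: "0 \<le> x" "0 \<le> q" "0 \<le> D" "0 \<le> m" "0 \<le> M" "0 \<le> N"
    using U(3) by (auto simp: x_def q_def D_def m_def M_def N_def intro!: mult_nonneg_nonneg add_nonneg_nonneg)
  have key: "P e \<in> projs a \<and> norm (P e - Q) \<le> (3 + 2 * q) * x * e + 2 * N * m * D * e
      \<and> \<bar>E \<bullet> P e - E \<bullet> R e\<bar> \<le> (norm (E ** R e - R e ** E) + 2 * norm E * N * (D * e\<^sup>2)) * (D * e\<^sup>2)
      \<and> norm (R e - Q - e *\<^sub>R X) \<le> (2 + 2 * q) * x\<^sup>2 * e\<^sup>2"
    if e: "0 < e" "e \<le> 1" "e * x \<le> 1/4" "(3 + 2 * q) * x * e < r" for e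
  proof -
    have nX: "norm (e *\<^sub>R X) = e * x" using e by (simp add: x_def)
    have X4: "norm (e *\<^sub>R X) \<le> 1/4" unfolding nX by (rule e(3))
    have XX: "norm ((e *\<^sub>R X) ** (e *\<^sub>R X)) \<le> 1/16" by (rule norm_square_le[OF X4])
    have Rp: "proj (R e)" unfolding R_def by (rule proj_chart[OF Qp tangent_scaleR[OF X] XX])
    then have Rh: "adj (R e) = R e" by (simp add: proj_def)
    have RQ: "norm (R e - Q) \<le> (3 + 2 * q) * x * e"
      using chart_dist[OF X4, of Q] by (simp only: R_def q_def nX mult_ac)
    have "R e \<in> ball Q r" using RQ e(4) by (simp add: dist_norm norm_minus_commute)
    then have RU: "R e \<in> U" using r(2) by blast
    have "balanced Q (R e)"
      unfolding balanced_def R_def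
      using inner_chart[OF Qp tangent_scaleR[OF X] XX] bal by (simp add: quad_scaleR)
    then have W: "unitary (V (R e))" "norm (V (R e) - mat 1) \<le> C * dev a (R e)"
       "\<And>i. P e $ i $ i = of_real (a i)"
      using V RU Rh unfolding P_def by blast+
    have PG: "P e \<in> projs a" using W(3) proj_conj_by[OF Rp W(1)] by (simp add: projs_def P_def)
    have near: "norm (R e - Q - e *\<^sub>R X) \<le> (2 + 2 * q) * x\<^sup>2 * e\<^sup>2"
      using chart_near[OF X4, of Q] by (simp only: R_def q_def nX power_mult_distrib mult_ac)
    have "dev a (R e) \<le> (\<Sum>i\<in>(UNIV::'n set). (2 + 2 * q) * x\<^sup>2 * e\<^sup>2)"
      unfolding dev_def
    proof (rule sum_mono)
      fix i
      have eq: "R e $ i $ i - of_real (a i) = (R e - Q - e *\<^sub>R X) $ i $ i"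
        using projs_D(4)[OF Q, of i] diag[of i] by simp
      show "norm (R e $ i $ i - of_real (a i)) \<le> (2 + 2 * q) * x\<^sup>2 * e\<^sup>2"
        unfolding eq by (rule order_trans[OF norm_entry_le near])
    qed
    then have "C * dev a (R e) \<le> C * (real CARD('n) * ((2 + 2 * q) * x\<^sup>2 * e\<^sup>2))"
      using U(3) by (intro mult_left_mono) auto
    then have VD: "norm (V (R e) - mat 1) \<le> D * e\<^sup>2" using W(2) by (simp add: D_def mult_ac)
    have Rn: "norm (R e) \<le> N"
    proof -
      have "norm (R e) \<le> norm Q + norm (R e - Q)" by (rule norm_triangle_sub)
      also have "\<dots> \<le> q + (3 + 2 * q) * x * 1"
        using RQ e nonneg mult_left_mono[OF e(2), of "(3 + 2 * q) * x"] by (simp add: q_def)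
      finally show ?thesis by (simp add: N_def)
    qed
    note est = conj_by_estimate[OF W(1) Rh]
    have "\<bar>E \<bullet> P e - E \<bullet> R e\<bar> \<le> (norm (E ** R e - R e ** E) + 2 * norm E * norm (R e) * norm (V (R e) - mat 1)) * norm (V (R e) - mat 1)"
      unfolding P_def by (rule est(1))
    also have "\<dots> \<le> (norm (E ** R e - R e ** E) + 2 * norm E * N * (D * e\<^sup>2)) * (D * e\<^sup>2)"
      using VD Rn nonneg by (intro mult_mono add_left_mono add_nonneg_nonneg mult_nonneg_nonneg) auto
    finally have E: "\<bar>E \<bullet> P e - E \<bullet> R e\<bar> \<le> (norm (E ** R e - R e ** E) + 2 * norm E * N * (D * e\<^sup>2)) * (D * e\<^sup>2)" .
    have "norm (P e - Q) \<le> norm (R e - Q) + norm (P e - R e)"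
      using norm_triangle_ineq[of "R e - Q" "P e - R e"] by simp
    also have "norm (P e - R e) \<le> 2 * norm (R e) * m * norm (V (R e) - mat 1)"
      unfolding P_def m_def by (rule est(2))
    also have "\<dots> \<le> 2 * N * m * (D * e\<^sup>2)"
      using VD Rn nonneg by (intro mult_mono) auto
    also have "D * e\<^sup>2 \<le> D * e" using e nonneg by (intro mult_left_mono) (auto simp: power2_eq_square mult_le_one)
    finally have "norm (P e - Q) \<le> (3 + 2 * q) * x * e + 2 * N * m * (D * e)"
      using RQ nonneg by (simp add: mult_left_mono)
    then show ?thesis using PG E near by (simp add: mult_ac)
  qed
  \<comment> \<open>\<open>B\<close> and \<open>B2\<close> bound the coefficients of
    \<open>e^2\<close> and \<open>e^3\<close> in the errors of the two cases, \<open>T\<close> the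
    distance from \<open>Q\<close> per unit of \<open>e\<close>. The choice of \<open>e\<close>
    below makes each product small enough.\<close>
  define B where "B = norm E * ((2 + 2 * q) * x\<^sup>2) + (2 * norm E * N + 2 * norm E * N * D) * D"
  define B2 where "B2 = (M + 2 * norm E * N * D) * D"
  have Bn: "0 \<le> B" "0 \<le> B2" using nonneg by (auto simp: B_def B2_def intro!: add_nonneg_nonneg mult_nonneg_nonneg)
  define T where "T = (3 + 2 * q) * x + 2 * N * m * D"
  have T: "0 \<le> T" using nonneg by (auto simp: T_def intro!: add_nonneg_nonneg mult_nonneg_nonneg)
  define \<kappa> where "\<kappa> = (if E \<bullet> X < 0 then - (E \<bullet> X) else - (E \<bullet> quad Q X))"
  have \<kappa>: "\<kappa> > 0" using neg by (auto simp: \<kappa>_def)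
  define e where "e = min 1 (min (min (1 / (4 * (x + 1))) (r / (2 * ((3 + 2 * q) * x + 1)))) (min (d / (2 * (T + 1))) (min (\<kappa> / (2 * (B + 1))) (\<kappa> / (2 * (B2 + 1))))))"
  have bound: "z * e < y" if "e \<le> y / (2 * (z + 1))" "0 \<le> z" "0 < y" for y z :: real
  proof -
    have "z * e \<le> z * (y / (2 * (z + 1)))" using that by (intro mult_left_mono) auto
    also have "\<dots> = y * (z / (2 * (z + 1)))" by simp
    also have "\<dots> < y * 1" using that by (intro mult_strict_left_mono) (auto simp: divide_less_eq)
    finally show ?thesis by simp
  qed
  have qx: "0 \<le> (3 + 2 * q) * x" using nonneg by simp
  have e: "0 < e" "e \<le> 1"
    using \<kappa> r(1) d Bn T nonneg qx by (auto simp: e_def add_nonneg_pos)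
  have ex: "e * x \<le> 1/4"
  proof -
    have "e \<le> 1 / (4 * (x + 1))" by (simp add: e_def)
    then have "e * x \<le> 1 / (4 * (x + 1)) * x" using nonneg by (intro mult_right_mono) auto
    also have "\<dots> \<le> 1/4" using nonneg by (simp add: field_simps)
    finally show ?thesis .
  qed
  have er: "(3 + 2 * q) * x * e < r" by (rule bound) (use r qx in \<open>auto simp: e_def\<close>)
  have eT: "T * e < d" by (rule bound) (use d T in \<open>auto simp: e_def\<close>)
  have eB: "B * e < \<kappa>" by (rule bound) (use \<kappa> Bn in \<open>auto simp: e_def\<close>)
  have eB2: "B2 * e < \<kappa>" by (rule bound) (use \<kappa> Bn in \<open>auto simp: e_def\<close>)
  have k: "P e \<in> projs a" "norm (P e - Q) \<le> (3 + 2 * q) * x * e + 2 * N * m * D * e"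
    "\<bar>E \<bullet> P e - E \<bullet> R e\<bar> \<le> (norm (E ** R e - R e ** E) + 2 * norm E * N * (D * e\<^sup>2)) * (D * e\<^sup>2)"
    "norm (R e - Q - e *\<^sub>R X) \<le> (2 + 2 * q) * x\<^sup>2 * e\<^sup>2"
    using key[OF e ex er] by blast+
  have EN: "0 \<le> 2 * norm E * N" and De0: "0 \<le> D * e\<^sup>2" using nonneg by auto
  have e2: "e\<^sup>2 \<le> e" "e\<^sup>2 \<le> 1" "0 \<le> e\<^sup>2" using e by (auto simp: power2_eq_square mult_le_one mult_left_le_one_le)
  have De: "D * e\<^sup>2 \<le> D" "D * e\<^sup>2 \<le> D * e" using e2 nonneg by (auto intro: mult_left_le mult_left_mono)
  have "E \<bullet> P e < E \<bullet> Q"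
  proof (cases "E \<bullet> X < 0")
    case True
    have ER: "\<bar>E \<bullet> R e - E \<bullet> Q - e * (E \<bullet> X)\<bar> \<le> norm E * ((2 + 2 * q) * x\<^sup>2 * e\<^sup>2)"
    proof -
      have "E \<bullet> R e - E \<bullet> Q - e * (E \<bullet> X) = E \<bullet> (R e - Q - e *\<^sub>R X)" by (simp add: inner_diff_right)
      also have "\<bar>\<dots>\<bar> \<le> norm E * norm (R e - Q - e *\<^sub>R X)" by (rule Cauchy_Schwarz_ineq2)
      also have "\<dots> \<le> norm E * ((2 + 2 * q) * x\<^sup>2 * e\<^sup>2)" using k(4) by (intro mult_left_mono) auto
      finally show ?thesis .
    qed
    have nR: "norm (R e) \<le> N"
    proof -
      have "norm (e *\<^sub>R X) \<le> 1/4" using ex e by (simp add: x_def)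
      from chart_dist[OF this, of Q] have "norm (R e - Q) \<le> (3 + 2 * q) * (e * x)"
        using e by (simp add: R_def q_def x_def)
      also have "\<dots> \<le> (3 + 2 * q) * (1 * x)" using e nonneg by (intro mult_left_mono mult_right_mono) auto
      finally show ?thesis using norm_triangle_sub[of "R e" Q] by (simp add: N_def q_def)
    qed
    have "norm (E ** R e - R e ** E) \<le> norm E * N + N * norm E"
      using nR nonneg by (intro order_trans[OF norm_triangle_ineq4] add_mono order_trans[OF norm_mm] mult_mono) auto
    then have c: "norm (E ** R e - R e ** E) \<le> 2 * norm E * N" by (simp add: mult_ac)
    have "\<bar>E \<bullet> P e - E \<bullet> R e\<bar> \<le> (2 * norm E * N + 2 * norm E * N * D) * (D * e\<^sup>2)"
      by (rule order_trans[OF k(3) mult_right_mono[OF add_mono[OF c mult_left_mono[OF De(1) EN]] De0]])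
    then have "E \<bullet> P e - E \<bullet> Q \<le> e * (E \<bullet> X) + B * e\<^sup>2"
      using ER by (simp add: B_def algebra_simps)
    also have "\<dots> = e * (B * e - \<kappa>)" using True by (simp add: \<kappa>_def power2_eq_square algebra_simps)
    also have "\<dots> < 0" using eB e by (simp add: mult_pos_neg)
    finally show ?thesis by simp
  next
    case False
    then have E: "E ** Q = Q ** E" "E \<bullet> X = 0" "\<kappa> = - (E \<bullet> quad Q X)" using neg by (auto simp: \<kappa>_def)
    have X4: "norm (e *\<^sub>R X) \<le> 1/4" using ex e by (simp add: x_def)
    have ER: "E \<bullet> R e = E \<bullet> Q - e\<^sup>2 * \<kappa>"
      using inner_chart[OF Qp tangent_scaleR[OF X] norm_square_le[OF X4] E(1)] by (simp add: R_def quad_scaleR E)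
    have "norm (R e - Q) \<le> norm (R e - Q - e *\<^sub>R X) + norm (e *\<^sub>R X)"
      using norm_triangle_ineq[of "R e - Q - e *\<^sub>R X" "e *\<^sub>R X"] by simp
    also have "\<dots> \<le> (2 + 2 * q) * x\<^sup>2 * e\<^sup>2 + e * x" using k(4) e by (simp add: x_def)
    also have "\<dots> \<le> (2 + 2 * q) * x\<^sup>2 * e + e * x"
      using e2 nonneg by (intro add_right_mono mult_left_mono) auto
    finally have RQ: "norm (R e - Q) \<le> (x + (2 + 2 * q) * x\<^sup>2) * e" by (simp add: algebra_simps)
    have "E ** R e - R e ** E = E ** (R e - Q) - (R e - Q) ** E" by (simp add: mm_simps E)
    also have "norm \<dots> \<le> norm E * norm (R e - Q) + norm (R e - Q) * norm E"
      by (rule order_trans[OF norm_triangle_ineq4 add_mono[OF norm_mm norm_mm]])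
    also have "\<dots> \<le> norm E * ((x + (2 + 2 * q) * x\<^sup>2) * e) + ((x + (2 + 2 * q) * x\<^sup>2) * e) * norm E"
      by (intro add_mono mult_left_mono mult_right_mono RQ norm_ge_zero)
    finally have c: "norm (E ** R e - R e ** E) \<le> M * e" by (simp add: M_def algebra_simps)
    have "\<bar>E \<bullet> P e - E \<bullet> R e\<bar> \<le> (M * e + 2 * norm E * N * (D * e)) * (D * e\<^sup>2)"
      by (rule order_trans[OF k(3) mult_right_mono[OF add_mono[OF c mult_left_mono[OF De(2) EN]] De0]])
    also have "\<dots> = e\<^sup>2 * (B2 * e)" by (simp add: B2_def algebra_simps)
    finally have "E \<bullet> P e - E \<bullet> Q \<le> e\<^sup>2 * (B2 * e - \<kappa>)" unfolding ER by (simp add: algebra_simps)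
    also have "\<dots> < 0" using eB2 e by (simp add: mult_pos_neg)
    finally show ?thesis by simp
  qed
  moreover have "norm (P e - Q) < d" using k(2) eT by (simp add: T_def algebra_simps)
  ultimately show ?thesis using k(1) by blast
qed

section \<open>Minima of an entry over a path component\<close>

definition block2 :: "'n \<Rightarrow> 'n \<Rightarrow> real \<Rightarrow> real \<Rightarrow> real \<Rightarrow> real \<Rightarrow> 'a::conj_field^'n^'n" where
  "block2 x y m1 m2 m3 m4 = (\<chi> i j. of_real (if i = x \<and> j = x then m1 else if i = x \<and> j = y then m2
     else if i = y \<and> j = x then m3 else if i = y \<and> j = y then m4 else 0))"

lemma scaleR_nth2: "(r *\<^sub>R A) $ i $ j = of_real r * (A :: 'a::conj_field^'n^'m) $ i $ j"
  by (simp add: of_real_def)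

lemma block2_mult:
  fixes x y :: "'n::finite" and P :: "'a::conj_field^'n^'n"
  assumes "x \<noteq> y"
  shows "(block2 x y m1 m2 m3 m4 ** P) $ i $ j =
    (if i = x then of_real m1 * P $ x $ j + of_real m2 * P $ y $ j
     else if i = y then of_real m3 * P $ x $ j + of_real m4 * P $ y $ j else 0)"
  unfolding matrix_matrix_mult_def vec_lambda_beta
  by (subst sum_two[OF assms]) (use assms in \<open>auto simp: block2_def\<close>)

lemma mult_block2:
  fixes x y :: "'n::finite" and P :: "'a::conj_field^'n^'n"
  assumes "x \<noteq> y"
  shows "(P ** block2 x y m1 m2 m3 m4) $ i $ j =
    (if j = x then P $ i $ x * of_real m1 + P $ i $ y * of_real m3
     else if j = y then P $ i $ x * of_real m2 + P $ i $ y * of_real m4 else 0)"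
  unfolding matrix_matrix_mult_def vec_lambda_beta
  by (subst sum_two[OF assms]) (use assms in \<open>auto simp: block2_def\<close>)

lemma mult_block2_mult:
  fixes x y :: "'n::finite" and P R :: "'a::conj_field^'n^'n"
  assumes "x \<noteq> y"
  shows "(P ** (block2 x y m1 m2 m3 m4 ** R)) $ i $ j =
    P $ i $ x * (of_real m1 * R $ x $ j + of_real m2 * R $ y $ j)
    + P $ i $ y * (of_real m3 * R $ x $ j + of_real m4 * R $ y $ j)"
proof -
  have "(P ** (block2 x y m1 m2 m3 m4 ** R)) $ i $ j = (\<Sum>k\<in>UNIV. P $ i $ k * (block2 x y m1 m2 m3 m4 ** R) $ k $ j)"
    by (simp add: matrix_matrix_mult_def[of P])
  also have "\<dots> = P $ i $ x * (block2 x y m1 m2 m3 m4 ** R) $ x $ j + P $ i $ y * (block2 x y m1 m2 m3 m4 ** R) $ y $ j"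
    by (rule sum_two[OF assms]) (simp add: block2_mult[OF assms])
  finally show ?thesis using assms by (simp add: block2_mult[OF assms])
qed

lemma adj_block2:
  assumes "x \<noteq> y" shows "adj (block2 x y m1 m2 m3 m4) = block2 x y m1 m3 m2 m4"
  unfolding vec_eq_iff
proof (intro allI)
  fix i j
  show "adj (block2 x y m1 m2 m3 m4) $ i $ j = block2 x y m1 m3 m2 m4 $ i $ j"
    using assms by (cases "i = x"; cases "i = y"; cases "j = x"; cases "j = y"; simp add: block2_def)
qed

lemma inner_block2:
  fixes x y :: "'n::finite" and A :: "'a::conj_field^'n^'n"
  assumes "x \<noteq> y"
  shows "block2 x y m1 m2 m3 m4 \<bullet> A = m1 * rp (A$x$x) + m2 * rp (A$x$y) + (m3 * rp (A$y$x) + m4 * rp (A$y$y))"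
proof -
  have *: "(\<Sum>j\<in>UNIV. rp (cj (block2 x y m1 m2 m3 m4 $ i $ j) * A $ i $ j))
      = rp (cj (block2 x y m1 m2 m3 m4 $ i $ x) * A $ i $ x) + rp (cj (block2 x y m1 m2 m3 m4 $ i $ y) * A $ i $ y)" for i
    by (rule sum_two[OF assms]) (auto simp: block2_def)
  show ?thesis unfolding inner_mat *
    by (subst sum_two[OF assms]) (use assms in \<open>auto simp: block2_def scaleR_conv_of_real[symmetric]\<close>)
qed

text \<open>The velocity of the projection \<open>P\<close> when its range is moved by the flow of
  \<open>M\<close>. For Hermitian \<open>M\<close> it is the orthogonal projection of
  \<open>M\<close> onto the tangent space at \<open>P\<close>.\<close>

definition tpart :: "'a::conj_field^'n^'n \<Rightarrow> 'a^'n^'n \<Rightarrow> 'a^'n^'n" where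
  "tpart P M = (mat 1 - P) ** (M ** P) + P ** (adj M ** (mat 1 - P))"

lemma tangent_tpart:
  fixes P M :: "'a::conj_field^'n^'n"
  assumes "proj P" shows "tangent P (tpart P M)"
proof -
  have p: "P ** P = P" "P ** (P ** B) = P ** B" "adj P = P" for B :: "'a^'n^'n"
    using assms by (auto simp: proj_def matrix_mul_assoc)
  show ?thesis unfolding tangent_def tpart_def
    by (simp only: mm_simps p adj_add adj_diff adj_mult adj_adj adj_mat_1 matrix_mul_lid matrix_mul_rid)
      (simp add: algebra_simps)
qed

text \<open>The pairing reduces to \<open>\<beta>\<close> times the trace of
  \<open>(1 - 2 P) X^2\<close>, which vanishes because \<open>X\<close> anticommutes with
  \<open>1 - 2 P\<close>. This supplies the balance hypothesis of \<open>descent\<close> for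
  directions living on one component of the support graph.\<close>

lemma quad_balanced:
  fixes P X :: "'a::conj_field^'n^'n"
  assumes P: "proj P" and X: "tangent P X" and b: "rdiag b ** P = P ** rdiag b" "rdiag b ** X = \<beta> *\<^sub>R X"
  shows "rdiag b \<bullet> quad P X = 0"
proof -
  have Xh: "adj X = X" and XP: "P ** X + X ** P = X" using X by (auto simp: tangent_def)
  have Ph: "adj P = P" using P by (simp add: proj_def)
  have Dh: "adj (rdiag b) = (rdiag b :: 'a^'n^'n)" by (auto simp: vec_eq_iff rdiag_def)
  have bX: "X ** rdiag b = \<beta> *\<^sub>R X"
    using arg_cong[OF b(2), of adj] by (simp add: adj_mult Xh Dh)
  have 1: "rdiag b \<bullet> (X ** X) = \<beta> * (X \<bullet> X)"
    using inner_mm_right[of X X "rdiag b"] by (simp add: inner_commute Xh bX)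
  have "rdiag b \<bullet> (P ** (X ** X)) = (X ** X) \<bullet> (P ** rdiag b)"
    using inner_mm_right[of P "X ** X" "rdiag b"] by (simp add: inner_commute Ph)
  also have "\<dots> = X \<bullet> (X ** (rdiag b ** P))"
    using inner_mm_right[of X X "P ** rdiag b"] by (simp add: b(1) Xh)
  also have "\<dots> = \<beta> * (X \<bullet> (X ** P))"
    by (simp add: matrix_mul_assoc bX mm.scaleR_left)
  finally have 2: "rdiag b \<bullet> (P ** (X ** X)) = \<beta> * (X \<bullet> (X ** P))" .
  have "X \<bullet> (P ** X) = X \<bullet> (X ** P)"
    using inner_adj[of X "P ** X"] by (simp add: adj_mult Xh Ph)
  then have "X \<bullet> X = 2 * (X \<bullet> (X ** P))"
    using arg_cong[OF XP, of "inner X"] by (simp add: inner_add_right)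
  then show ?thesis unfolding quad_def inner_diff_right 1 2 by (simp add: algebra_simps)
qed

lemma proj_complement: "proj P \<Longrightarrow> proj (mat 1 - P)"
  by (simp add: proj_def mm_simps adj_diff)

lemma proj_entry_le:
  assumes "proj P" shows "(norm (P $ x $ y))\<^sup>2 \<le> rp (P $ x $ x) * rp (P $ y $ y)"
proof -
  have P: "P ** P = P" "adj P = P" using assms by (auto simp: proj_def)
  have "P $ x $ y = (\<Sum>k\<in>UNIV. P $ x $ k * P $ k $ y)"
    by (subst P(1)[symmetric]) (simp add: matrix_matrix_mult_def)
  also have "norm \<dots> \<le> (\<Sum>k\<in>UNIV. norm (P $ x $ k) * norm (P $ y $ k))"
  proof (rule order_trans[OF norm_sum], rule sum_mono)
    fix k
    have "P $ k $ y = cj (P $ y $ k)" by (rule herm_nth[OF P(2)])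
    then show "norm (P $ x $ k * P $ k $ y) \<le> norm (P $ x $ k) * norm (P $ y $ k)" by (simp add: norm_mult)
  qed
  finally have "(norm (P $ x $ y))\<^sup>2 \<le> (\<Sum>k\<in>UNIV. norm (P $ x $ k) * norm (P $ y $ k))\<^sup>2"
    by (intro power_mono) auto
  also have "\<dots> \<le> (\<Sum>k\<in>UNIV. (norm (P $ x $ k))\<^sup>2) * (\<Sum>k\<in>UNIV. (norm (P $ y $ k))\<^sup>2)"
    by (rule Cauchy_Schwarz_ineq_sum)
  finally show ?thesis unfolding row_norm[OF assms] .
qed

lemma tpart_selfadj:
  fixes P F G :: "'a::conj_field^'n^'n"
  assumes P: "proj P" and F: "adj F = F" and G: "tangent P G"
  shows "tpart P F \<bullet> G = F \<bullet> G"
proof -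
  have Ph: "adj P = P" "P ** P = P" using P by (auto simp: proj_def)
  have PB: "P ** (P ** B) = P ** B" for B :: "'a^'n^'n" by (simp add: matrix_mul_assoc Ph)
  have e1: "((mat 1 - P) ** (F ** P)) \<bullet> G = F \<bullet> ((mat 1 - P) ** (G ** P))"
    by (simp only: inner_mm_right[of "mat 1 - P" "F ** P" G] inner_mm_left[of F P] adj_diff adj_mat_1 Ph
      matrix_mul_assoc[symmetric])
  have e2: "(P ** (F ** (mat 1 - P))) \<bullet> G = F \<bullet> (P ** (G ** (mat 1 - P)))"
    by (simp only: inner_mm_right[of P "F ** (mat 1 - P)" G] inner_mm_left[of F "mat 1 - P"] adj_diff adj_mat_1 Ph
      matrix_mul_assoc[symmetric])
  have "tpart P F \<bullet> G = F \<bullet> ((mat 1 - P) ** (G ** P)) + F \<bullet> (P ** (G ** (mat 1 - P)))"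
    unfolding tpart_def F inner_left_distrib e1 e2 ..
  also have "\<dots> = F \<bullet> G"
    unfolding inner_right_distrib[symmetric]
    by (simp only: mm_simps tangent_commute[OF G] Ph PB matrix_mul_lid matrix_mul_rid) simp
  finally show ?thesis .
qed

lemma linear_tpart: "linear (tpart P :: 'a::conj_field^'n^'n \<Rightarrow> 'a^'n^'n)"
  unfolding tpart_def
  by (rule linearI) (simp_all add: mm_simps adj_add mm.scaleR_left mm.scaleR_right scaleR_add_right scaleR_diff_right algebra_simps)

text \<open>A nonzero projection of \<open>E\<close> onto the tangent directions orthogonal to the diagonal would give a
  first-order descent, hence the Lagrange condition at a minimum.\<close>

lemma lagrange_condition:
  fixes P :: "'a::conj_field^'n^'n"
  assumes P: "P \<in> projs a" and xy: "x \<noteq> y" and d: "d > 0"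
    and min: "\<And>R. R \<in> projs a \<Longrightarrow> norm (R - P) < d \<Longrightarrow> rp (P $ x $ y) \<le> rp (R $ x $ y)"
    and nz: "P $ x $ y \<noteq> 0"
  obtains l where "(block2 x y 0 1 1 0 + rdiag l) ** P = P ** (block2 x y 0 1 1 0 + rdiag l)"
proof -
  have Pp: "proj P" and Ph: "adj P = P" "P ** P = P" using projs_D[OF P] by auto
  have PB: "P ** (P ** B) = P ** B" for B :: "'a^'n^'n" by (simp add: matrix_mul_assoc Ph)
  define H :: "'a^'n^'n" where "H = block2 x y 0 1 1 0"
  have Hh: "adj H = H" by (simp add: H_def adj_block2[OF xy])
  have Dh: "adj (rdiag l) = (rdiag l :: 'a^'n^'n)" for l :: "'n \<Rightarrow> real" by (auto simp: vec_eq_iff rdiag_def)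
  \<comment> \<open>The component of \<open>x\<close> in the support graph of \<open>P\<close>,
    expressed through commuting diagonals. Multipliers are confined to it, so that \<open>E\<close>
    and \<open>z\<close> scale by \<open>b x\<close> under every commuting \<open>b\<close>, as
    \<open>quad_balanced\<close> demands.\<close>
  define C where "C = {i. \<forall>b::'n \<Rightarrow> real. rdiag b ** P = P ** rdiag b \<longrightarrow> b i = b x}"
  have xC: "x \<in> C" by (simp add: C_def)
  have b_xy: "b y = b x" if "rdiag b ** P = P ** rdiag b" for b :: "'n \<Rightarrow> real"
    using that nz by (metis rdiag_commute_iff)
  have yC: "y \<in> C" using b_xy by (simp add: C_def)
  define L :: "('a^'n^'n) set" where "L = {rdiag l | l. \<forall>i. i \<notin> C \<longrightarrow> l i = 0}"
  have "subspace L"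
    unfolding subspace_def L_def
  proof (intro conjI ballI allI)
    show "0 \<in> {rdiag l :: 'a^'n^'n | l. \<forall>i. i \<notin> C \<longrightarrow> l i = 0}"
      by (rule CollectI, rule exI[of _ "\<lambda>_. 0"]) (simp add: rdiag_def vec_eq_iff)
  next
    fix A B :: "'a^'n^'n" assume "A \<in> {rdiag l | l. \<forall>i. i \<notin> C \<longrightarrow> l i = 0}" "B \<in> {rdiag l | l. \<forall>i. i \<notin> C \<longrightarrow> l i = 0}"
    then obtain k l where "A = rdiag k" "\<forall>i. i \<notin> C \<longrightarrow> k i = 0" "B = rdiag l" "\<forall>i. i \<notin> C \<longrightarrow> l i = 0" by auto
    then show "A + B \<in> {rdiag l | l. \<forall>i. i \<notin> C \<longrightarrow> l i = 0}"
      by (intro CollectI exI[of _ "\<lambda>i. k i + l i"]) (auto simp: rdiag_def vec_eq_iff)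
  next
    fix c :: real and A :: "'a^'n^'n" assume "A \<in> {rdiag l | l. \<forall>i. i \<notin> C \<longrightarrow> l i = 0}"
    then obtain k where "A = rdiag k" "\<forall>i. i \<notin> C \<longrightarrow> k i = 0" by auto
    then show "c *\<^sub>R A \<in> {rdiag l | l. \<forall>i. i \<notin> C \<longrightarrow> l i = 0}"
      by (intro CollectI exI[of _ "\<lambda>i. c * k i"]) (auto simp: rdiag_def vec_eq_iff of_real_def)
  qed
  then have S: "span (tpart P ` L) = tpart P ` L"
    by (intro span_eq_iff[THEN iffD2] linear_subspace_image[OF linear_tpart])
  obtain s z where sz: "s \<in> span (tpart P ` L)" "\<And>w. w \<in> span (tpart P ` L) \<Longrightarrow> orthogonal z w" "tpart P H = s + z"
    using orthogonal_subspace_decomp_exists[of "tpart P ` L" "tpart P H"] by blast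
  obtain l where l: "\<forall>i. i \<notin> C \<longrightarrow> l i = 0" "s = tpart P (rdiag l)"
  proof -
    have "s \<in> tpart P ` L" using sz(1) S by simp
    then show thesis using that by (auto simp: L_def)
  qed
  define E where "E = H - rdiag l"
  have Eh: "adj E = E" by (simp add: E_def adj_diff Hh Dh)
  have z: "z = tpart P E"
    using sz(3) l(2) by (simp add: E_def linear_diff[OF linear_tpart])
  have tz: "tangent P z" unfolding z by (rule tangent_tpart[OF Pp])
  have bE: "rdiag b ** E = b x *\<^sub>R E" "E ** rdiag b = b x *\<^sub>R E" if b: "rdiag b ** P = P ** rdiag b" for b
  proof -
    have Eij: "b i = b x \<and> b j = b x" if nz: "E $ i $ j \<noteq> 0" for i j
    proof (cases "i = j")
      case True
      then have "E $ i $ j = - of_real (l i)" using xy by (simp add: E_def H_def block2_def rdiag_def)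
      then have "i \<in> C" using nz l(1) by auto
      then show ?thesis using b True by (simp add: C_def)
    next
      case False
      then have "E $ i $ j = H $ i $ j" by (simp add: E_def rdiag_def)
      moreover have "H $ i $ j = 0" if "\<not> (i = x \<and> j = y)" "\<not> (i = y \<and> j = x)"
        using that False xy
        by (cases "i = x"; cases "i = y"; cases "j = x"; cases "j = y"; simp add: H_def block2_def)
      ultimately have "i = x \<and> j = y \<or> i = y \<and> j = x" using nz by metis
      then show ?thesis using b_xy[OF b] by auto
    qed
    show "rdiag b ** E = b x *\<^sub>R E" "E ** rdiag b = b x *\<^sub>R E"
      using Eij unfolding vec_eq_iff rdiag_mult mult_rdiag scaleR_nth2 by auto
  qed
  have bz: "rdiag b ** z = b x *\<^sub>R z" if b: "rdiag b ** P = P ** rdiag b" for b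
  proof -
    have bP: "rdiag b ** (P ** B) = P ** (rdiag b ** B)" for B :: "'a^'n^'n" by (simp add: matrix_mul_assoc b)
    have bEB: "rdiag b ** (E ** B) = b x *\<^sub>R (E ** B)" for B :: "'a^'n^'n"
      by (simp add: matrix_mul_assoc bE[OF b] mm.scaleR_left)
    show ?thesis unfolding z tpart_def Eh
      by (simp only: mm_simps b bP bEB bE[OF b] mm.scaleR_left mm.scaleR_right scaleR_add_right scaleR_diff_right
          matrix_mul_lid matrix_mul_rid)
  qed
  have "z = 0"
  proof (rule ccontr)
    assume "z \<noteq> 0"
    \<comment> \<open>On \<open>C\<close>, orthogonality to the multipliers annihilates the diagonal
      of \<open>z\<close>; off \<open>C\<close>, scaling by a \<open>b\<close> with
      \<open>b i \<noteq> b x\<close> does.\<close>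
    have zd: "z $ i $ i = 0" for i
    proof (cases "i \<in> C")
      case True
      define u where "u j = (if j = i then 1 else 0 :: real)" for j
      have "rdiag u \<in> L" using True unfolding L_def by (intro CollectI exI[of _ u]) (auto simp: u_def)
      then have "orthogonal z (tpart P (rdiag u))" using sz(2) S by blast
      then have "rdiag u \<bullet> z = 0" using tpart_selfadj[OF Pp Dh tz, of u] by (simp add: orthogonal_def inner_commute)
      then have "rp (z $ i $ i) = 0" by (simp add: inner_rdiag u_def if_distrib[of "\<lambda>t. t * _"] cong: if_cong)
      then show ?thesis using herm_diag[of z i] tz by (simp add: tangent_def)
    next
      case False
      then obtain b where b: "rdiag b ** P = P ** rdiag b" "b i \<noteq> b x" by (auto simp: C_def)
      then have "of_real (b i) * z $ i $ i = of_real (b x) * z $ i $ i"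
        using arg_cong[OF bz[OF b(1)], of "\<lambda>A. A $ i $ i"] by (simp only: rdiag_mult scaleR_nth2)
      then show ?thesis using b(2) by simp
    qed
    have tX: "tangent P (- z)" using tangent_scaleR[OF tz, of "-1"] by simp
    have "\<exists>R\<in>projs a. norm (R - P) < d \<and> E \<bullet> R < E \<bullet> P"
    proof (rule descent[OF P tX _ _ _ d])
      show "(- z) $ i $ i = 0" for i by (simp add: zd)
      show "rdiag b \<bullet> quad P (- z) = 0" if "rdiag b ** P = P ** rdiag b" for b
        by (rule quad_balanced[OF Pp tX that, of "b x"]) (simp add: bz[OF that] mm_simps)
      have "E \<bullet> z = z \<bullet> z" using tpart_selfadj[OF Pp Eh tz] z by simp
      then show "E \<bullet> (- z) < 0 \<or> E ** P = P ** E \<and> E \<bullet> (- z) = 0 \<and> E \<bullet> quad P (- z) < 0"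
        using \<open>z \<noteq> 0\<close> by simp
    qed
    then obtain R where R: "R \<in> projs a" "norm (R - P) < d" "E \<bullet> R < E \<bullet> P" by blast
    \<comment> \<open>The diagonal part of \<open>E\<close> pairs to a constant on
      \<open>projs a\<close>, so a decrease of the pairing with \<open>E\<close> is a decrease of
      the entry.\<close>
    have EE: "E \<bullet> A = 2 * rp (A $ x $ y) - (\<Sum>i\<in>UNIV. l i * a i)" if "A \<in> projs a" for A
    proof -
      have "A $ y $ x = cj (A $ x $ y)" by (rule herm_nth[OF projs_D(2)[OF that]])
      then show ?thesis using projs_D(4)[OF that]
        by (simp add: E_def H_def inner_diff_left inner_block2[OF xy] inner_rdiag)
    qed
    show False using min[OF R(1,2)] R(3) EE[OF R(1)] EE[OF P] by simp
  qed
  then have "tpart P E ** P = 0" using z by (simp add: mm_simps)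
  moreover have "tpart P E ** P = E ** P - P ** (E ** P)"
    by (simp only: tpart_def Eh mm_simps PB Ph matrix_mul_lid matrix_mul_rid) simp
  ultimately have EP: "E ** P = P ** (E ** P)" by simp
  have PE: "P ** E = P ** (E ** P)"
    using arg_cong[OF EP, of adj] by (simp only: adj_mult Ph Eh matrix_mul_assoc)
  have "E = H + rdiag (\<lambda>i. - l i)" by (simp add: E_def rdiag_def vec_eq_iff)
  then show thesis using that[of "\<lambda>i. - l i"] EP PE H_def by simp
qed

text \<open>\<open>a\<close>, \<open>b\<close>, \<open>p\<close> are the entries of the
  \<open>2 x 2\<close> block, \<open>D\<close> is its determinant, \<open>1 - a - b + D\<close> that
  of the complementary block, \<open>k\<close> the difference of the two multipliers. The
  \<open>g\<close>s are the entries of the commutator of the Lagrange matrix with the test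
  direction, the \<open>h\<close>s those of its product with the block. The left side is the second
  variation times \<open>p\<close>: if \<open>p < 0\<close> and both determinants are positive, the
  variation is negative.\<close>

lemma second_order_poly:
  fixes a b p k :: real
  assumes k: "k * p = a - b"
  defines "D \<equiv> a * b - p\<^sup>2"
  defines "m1 \<equiv> p" and "m2 \<equiv> D - a" and "m3 \<equiv> b - D" and "m4 \<equiv> - p"
  defines "g1 \<equiv> m3 - m2" and "g2 \<equiv> k * m2 + m4 - m1" and "g3 \<equiv> - k * m3 + m1 - m4" and "g4 \<equiv> m2 - m3"
  defines "h1 \<equiv> g1 * a + g2 * p" and "h2 \<equiv> g1 * p + g2 * b" and "h3 \<equiv> g3 * a + g4 * p" and "h4 \<equiv> g3 * p + g4 * b"
  shows "(m1 * (h1 - (a * h1 + p * h3)) + m2 * (h2 - (a * h2 + p * h4))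
     + (m3 * (h3 - (p * h1 + b * h3)) + m4 * (h4 - (p * h2 + b * h4)))) * p
     = ((a - b)\<^sup>2 + 4 * p\<^sup>2) * D * (1 - a - b + D)"
  using k unfolding h1_def h2_def h3_def h4_def g1_def g2_def g3_def g4_def m1_def m2_def m3_def m4_def D_def
  by algebra

lemma rdiag_block2:
  assumes "b y = b x"
  shows "rdiag b ** block2 x y m1 m2 m3 m4 = b x *\<^sub>R block2 x y m1 m2 m3 m4"
  unfolding vec_eq_iff
proof (intro allI)
  fix i j
  show "(rdiag b ** block2 x y m1 m2 m3 m4) $ i $ j = (b x *\<^sub>R block2 x y m1 m2 m3 m4) $ i $ j"
    unfolding rdiag_mult scaleR_nth2 using assms by (cases "i = x"; cases "i = y"; simp add: block2_def)
qed

text \<open>Second-order test direction: on the span of the two coordinates \<open>M\<close> is \<open>(P - det P)\<close> followed by a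
  quarter turn. It is the combination of the two rotations between the eigenvectors of the \<open>2 \<times> 2\<close> block
  that keeps the diagonal fixed to first order.\<close>

lemma extremal_of_minimum:
  fixes P :: "'a::conj_field^'n^'n"
  assumes P: "P \<in> projs a" and xy: "x \<noteq> y" and d: "d > 0"
    and min: "\<And>R. R \<in> projs a \<Longrightarrow> norm (R - P) < d \<Longrightarrow> rp (P $ x $ y) \<le> rp (R $ x $ y)"
    and neg: "rp (P $ x $ y) < 0"
  obtains p where "P $ x $ y = of_real p" "p < 0" "p\<^sup>2 = a x * a y \<or> p\<^sup>2 = (1 - a x) * (1 - a y)"
proof -
  have Pp: "proj P" and Ph: "adj P = P" "P ** P = P" using projs_D[OF P] by auto
  have PB: "P ** (P ** B) = P ** B" for B :: "'a^'n^'n" by (simp add: matrix_mul_assoc Ph)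
  have nz: "P $ x $ y \<noteq> 0" using neg by auto
  obtain l where l: "(block2 x y 0 1 1 0 + rdiag l) ** P = P ** (block2 x y 0 1 1 0 + rdiag l)"
    using lagrange_condition[OF P xy d min nz] by blast
  define E :: "'a^'n^'n" where "E = block2 x y 0 1 1 0 + rdiag l"
  have EP: "E ** P = P ** E" using l by (simp add: E_def)
  have ent: "(if i = x then P $ y $ j else if i = y then P $ x $ j else 0) + of_real (l i) * P $ i $ j
      = (if j = x then P $ i $ y else if j = y then P $ i $ x else 0) + of_real (l j) * P $ i $ j" for i j
    using arg_cong[OF l, of "\<lambda>A. A $ i $ j"] xy
    by (simp add: mm_simps block2_mult[OF xy] mult_block2[OF xy] rdiag_mult mult_rdiag split: if_splits)
  have Pd: "P $ i $ i = of_real (a i)" for i by (rule projs_D(4)[OF P])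
  \<comment> \<open>The entry at \<open>x, x\<close> of the Lagrange condition makes the minimal
    entry real.\<close>
  have "P $ y $ x = P $ x $ y" using ent[of x x] xy by simp
  moreover have "P $ y $ x = cj (P $ x $ y)" by (rule herm_nth[OF Ph(1)])
  ultimately have "cj (P $ x $ y) = P $ x $ y" by simp
  then obtain p where p: "P $ x $ y = of_real p" using real_iff_cj by blast
  then have p': "P $ y $ x = of_real p" using \<open>P $ y $ x = P $ x $ y\<close> by simp
  have pneg: "p < 0" using neg p by simp
  have "(of_real (a y) :: 'a) + of_real (l x) * of_real p = of_real (a x) + of_real (l y) * of_real p"
    using ent[of x y] xy by (simp add: p Pd)
  then have "(of_real (a y + l x * p) :: 'a) = of_real (a x + l y * p)" by simp
  then have k: "(l x - l y) * p = a x - a y" unfolding of_real_eq_iff by (simp add: algebra_simps)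
  define D where "D = a x * a y - p\<^sup>2"
  have D0: "0 \<le> D" using proj_entry_le[OF Pp, of x y] by (simp add: D_def p Pd)
  have D1: "0 \<le> 1 - a x - a y + D"
    using proj_entry_le[OF proj_complement[OF Pp], of x y] xy
    by (simp add: D_def p Pd mat_def rp_diff algebra_simps)
  show thesis
  proof (cases "D = 0 \<or> 1 - a x - a y + D = 0")
    case True
    then show thesis by (intro that[OF p pneg]) (auto simp: D_def algebra_simps)
  next
    case False
    then have Dpos: "0 < D" "0 < 1 - a x - a y + D" using D0 D1 by auto
    define m1 m2 m3 m4 where m: "m1 = p" "m2 = D - a x" "m3 = a y - D" "m4 = - p"
    define M :: "'a^'n^'n" where "M = block2 x y m1 m2 m3 m4"
    define K where "K = (mat 1 - P) ** (M ** P)"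
    define X where "X = tpart P M"
    have XK: "X = K + adj K"
      by (simp add: X_def tpart_def K_def adj_mult adj_diff Ph matrix_mul_assoc)
    have tX: "tangent P X" unfolding X_def by (rule tangent_tpart[OF Pp])
    have Kent: "K $ i $ j = (M ** P) $ i $ j - (P ** (M ** P)) $ i $ j" for i j
      by (simp add: K_def mm_simps)
    have diagK: "rp (K $ i $ i) = 0" for i
    proof -
      consider "i = x" | "i = y" | "i \<noteq> x" "i \<noteq> y" by blast
      then show ?thesis
      proof cases
        case 1
        have "K $ x $ x = of_real ((m1 * a x + m2 * p) - (a x * (m1 * a x + m2 * p) + p * (m3 * a x + m4 * p)))"
          unfolding Kent M_def block2_mult[OF xy] mult_block2_mult[OF xy] using xy by (simp add: p p' Pd)
        also have "(m1 * a x + m2 * p) - (a x * (m1 * a x + m2 * p) + p * (m3 * a x + m4 * p)) = 0"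
          unfolding m D_def by algebra
        finally show ?thesis using 1 by simp
      next
        case 2
        have "K $ y $ y = of_real ((m3 * p + m4 * a y) - (p * (m1 * p + m2 * a y) + a y * (m3 * p + m4 * a y)))"
          unfolding Kent M_def block2_mult[OF xy] mult_block2_mult[OF xy] using xy by (simp add: p p' Pd)
        also have "(m3 * p + m4 * a y) - (p * (m1 * p + m2 * a y) + a y * (m3 * p + m4 * a y)) = 0"
          unfolding m D_def by algebra
        finally show ?thesis using 2 by simp
      next
        case 3
        \<comment> \<open>Outside the block the Lagrange condition makes \<open>u\<close> and
          \<open>w\<close> real multiples of each other. All four products then become multiples of
          \<open>r\<close>, with total coefficient 0 by \<open>k\<close>.\<close>
        define u w where "u = P $ i $ x" "w = P $ i $ y"
        define r where "r = rp (u * cj w)"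
        have u: "P $ x $ i = cj u" and w: "P $ y $ i = cj w" unfolding u_w_def by (rule herm_nth[OF Ph(1)])+
        have 1: "of_real (l i - l x) * u = w" and 2: "of_real (l i - l y) * w = u"
          using ent[of i x] ent[of i y] 3 xy by (auto simp: u_w_def algebra_simps)
        have rr: "rp (w * cj u) = r" using rp_cj[of "u * cj w"] by (simp add: r_def cj_mult mult.commute)
        have sc: "rp (of_real s * z) = s * rp z" for s and z :: 'a by (simp add: scaleR_conv_of_real[symmetric])
        have "w * cj w = of_real (l i - l x) * (u * cj w)" by (subst (1) 1[symmetric]) (simp add: mult.assoc)
        then have ww: "rp (w * cj w) = (l i - l x) * r" by (simp only: sc r_def)
        have "u * cj u = of_real (l i - l y) * (w * cj u)" by (subst (1) 2[symmetric]) (simp add: mult.assoc)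
        then have uu: "rp (u * cj u) = (l i - l y) * r" by (simp only: sc rr)
        have "K $ i $ i = - (of_real m1 * (u * cj u) + of_real m2 * (u * cj w) + (of_real m3 * (w * cj u) + of_real m4 * (w * cj w)))"
          unfolding Kent M_def block2_mult[OF xy] mult_block2_mult[OF xy] u w u_w_def[symmetric] using 3 by (simp add: algebra_simps)
        then have "rp (K $ i $ i) = - (m1 * ((l i - l y) * r) + m2 * r + (m3 * r + m4 * ((l i - l x) * r)))"
          by (simp only: rp_minus rp_add sc uu ww rr r_def[symmetric])
        also have "\<dots> = - (p * (l i - l y) - p * (l i - l x) + (a y - a x)) * r" unfolding m by algebra
        also have "p * (l i - l y) - p * (l i - l x) + (a y - a x) = 0" using k by (simp add: algebra_simps)
        finally show ?thesis by simp
      qed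
    qed
    have Xd: "X $ i $ i = 0" for i
    proof -
      have "X $ i $ i = of_real (2 * rp (K $ i $ i))" by (simp only: XK of_real_rp vector_add_component adj_nth)
      then show ?thesis by (simp add: diagK)
    qed
    have bal: "rdiag b \<bullet> quad P X = 0" if b: "rdiag b ** P = P ** rdiag b" for b
    proof (rule quad_balanced[OF Pp tX b, of "b x"])
      have bxy: "b y = b x" using b nz by (metis rdiag_commute_iff)
      have bM: "rdiag b ** M = b x *\<^sub>R M" "rdiag b ** adj M = b x *\<^sub>R adj M"
        unfolding M_def adj_block2[OF xy] by (rule rdiag_block2[OF bxy])+
      have bP: "rdiag b ** (P ** B) = P ** (rdiag b ** B)" for B :: "'a^'n^'n" by (simp add: matrix_mul_assoc b)
      have bMB: "rdiag b ** (M ** B) = b x *\<^sub>R (M ** B)" "rdiag b ** (adj M ** B) = b x *\<^sub>R (adj M ** B)" for B :: "'a^'n^'n"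
        by (simp_all add: matrix_mul_assoc bM mm.scaleR_left)
      show "rdiag b ** X = b x *\<^sub>R X" unfolding X_def tpart_def
        by (simp only: mm_simps b bP bMB bM mm.scaleR_left mm.scaleR_right scaleR_add_right scaleR_diff_right
            matrix_mul_lid matrix_mul_rid)
    qed
    have EX: "E \<bullet> X = 0"
      by (rule inner_offdiag[OF Pp EP]) (use tX in \<open>simp add: tangent_def\<close>)
    define g1 g2 g3 g4 where g: "g1 = m3 - m2" "g2 = (l x - l y) * m2 + m4 - m1" "g3 = - (l x - l y) * m3 + m1 - m4" "g4 = m2 - m3"
    define G :: "'a^'n^'n" where "G = block2 x y g1 g2 g3 g4"
    have Geq: "E ** M - M ** E = G"
      unfolding vec_eq_iff
    proof (intro allI)
      fix i j
      show "(E ** M - M ** E) $ i $ j = G $ i $ j"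
        unfolding E_def mm_simps vector_minus_component vector_add_component rdiag_mult mult_rdiag
          block2_mult[OF xy] mult_block2[OF xy] M_def G_def g
        using xy by (cases "i = x"; cases "i = y"; cases "j = x"; cases "j = y"; simp add: block2_def rdiag_def algebra_simps)
    qed
    \<comment> \<open>\<open>quad P X\<close> is \<open>K ** adj K - adj K ** K\<close>, so its
      pairing with \<open>E\<close> is that of \<open>K\<close> with the commutator of
      \<open>E\<close> and \<open>K\<close>. As \<open>E\<close> commutes with \<open>P\<close>,
      this involves \<open>E\<close> only through \<open>G\<close>, its commutator with
      \<open>M\<close>, which lives on the \<open>2 x 2\<close> block.\<close>
    have EX2: "E \<bullet> quad P X = M \<bullet> ((mat 1 - P) ** (G ** P))"
    proof -
      have PK: "P ** K = 0" "adj K ** P = 0" "K ** P = K" "P ** adj K = adj K"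
        by (simp_all add: K_def mm_simps PB Ph adj_diff adj_mult)
      have PKB: "P ** (K ** B) = 0" "P ** (adj K ** B) = adj K ** B" "K ** (P ** B) = K ** B" for B :: "'a^'n^'n"
        by (simp_all add: matrix_mul_assoc PK mm_simps)
      have KK: "K ** K = 0" "adj K ** adj K = 0"
        by (metis PK(1,3) matrix_mul_assoc mm.zero_right) (metis PK(2,4) matrix_mul_assoc mm.zero_left)
      have "quad P X = K ** adj K - adj K ** K"
        unfolding quad_def XK by (simp add: mm_simps KK PKB PK)
      then have "E \<bullet> quad P X = E \<bullet> (K ** adj K) - E \<bullet> (adj K ** K)" by (simp add: inner_diff_right)
      also have "E \<bullet> (K ** adj K) = K \<bullet> (E ** K)"
        using inner_mm_left[of K "adj K" E] by (simp add: inner_commute)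
      also have "E \<bullet> (adj K ** K) = K \<bullet> (K ** E)"
        using inner_mm_right[of "adj K" K E] by (simp add: inner_commute)
      finally have 1: "E \<bullet> quad P X = K \<bullet> (E ** K - K ** E)" by (simp add: inner_diff_right)
      have EPB: "E ** (P ** B) = P ** (E ** B)" for B :: "'a^'n^'n" by (simp add: matrix_mul_assoc EP)
      have 2: "E ** K - K ** E = (mat 1 - P) ** (G ** P)"
        unfolding K_def Geq[symmetric] by (simp add: mm_simps EPB EP)
      define Z where "Z = (mat 1 - P) ** (G ** P)"
      have "K \<bullet> Z = (M ** P) \<bullet> ((mat 1 - P) ** Z)"
        unfolding K_def using inner_mm_right[of "mat 1 - P" "M ** P" Z] by (simp add: adj_diff Ph)
      also have "(mat 1 - P) ** Z = Z" by (simp add: Z_def mm_simps PB)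
      also have "(M ** P) \<bullet> Z = M \<bullet> (Z ** P)" using inner_mm_left[of M P Z] by (simp add: Ph)
      also have "Z ** P = Z" by (simp add: Z_def mm_simps Ph)
      finally show ?thesis using 1 2 by (simp add: Z_def)
    qed
    define h1 h2 h3 h4 where h: "h1 = g1 * a x + g2 * p" "h2 = g1 * p + g2 * a y" "h3 = g3 * a x + g4 * p" "h4 = g3 * p + g4 * a y"
    have Zent: "((mat 1 - P) ** (G ** P)) $ i $ j = (G ** P) $ i $ j - (P ** (G ** P)) $ i $ j" for i j
      by (simp add: mm_simps)
    have "((mat 1 - P) ** (G ** P)) $ x $ x = of_real (h1 - (a x * h1 + p * h3))"
      "((mat 1 - P) ** (G ** P)) $ x $ y = of_real (h2 - (a x * h2 + p * h4))"
      "((mat 1 - P) ** (G ** P)) $ y $ x = of_real (h3 - (p * h1 + a y * h3))"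
      "((mat 1 - P) ** (G ** P)) $ y $ y = of_real (h4 - (p * h2 + a y * h4))"
      unfolding Zent G_def block2_mult[OF xy] mult_block2_mult[OF xy] h using xy by (simp_all add: p p' Pd mat_def algebra_simps)
    then have "(E \<bullet> quad P X) * p = (m1 * (h1 - (a x * h1 + p * h3)) + m2 * (h2 - (a x * h2 + p * h4))
     + (m3 * (h3 - (p * h1 + a y * h3)) + m4 * (h4 - (p * h2 + a y * h4)))) * p"
      unfolding EX2 M_def inner_block2[OF xy] by (simp only: rp_of_real)
    also have "\<dots> = ((a x - a y)\<^sup>2 + 4 * p\<^sup>2) * D * (1 - a x - a y + D)"
      using second_order_poly[OF k] unfolding h g m D_def by simp
    also have "\<dots> > 0"
    proof -
      have "0 < (a x - a y)\<^sup>2 + 4 * p\<^sup>2" using pneg by (intro add_nonneg_pos) auto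
      then show ?thesis by (intro mult_pos_pos Dpos)
    qed
    finally have "0 < (E \<bullet> quad P X) * p" .
    then have q: "E \<bullet> quad P X < 0" using pneg by (simp add: zero_less_mult_iff)
    obtain R where R: "R \<in> projs a" "norm (R - P) < d" "E \<bullet> R < E \<bullet> P"
      using descent[OF P tX Xd bal _ d, of E] EP EX q by blast
    have EE: "E \<bullet> A = 2 * rp (A $ x $ y) + (\<Sum>i\<in>UNIV. l i * a i)" if "A \<in> projs a" for A
    proof -
      have "A $ y $ x = cj (A $ x $ y)" by (rule herm_nth[OF projs_D(2)[OF that]])
      then show ?thesis using projs_D(4)[OF that]
        by (simp add: E_def inner_add_left inner_block2[OF xy] inner_rdiag)
    qed
    show thesis using min[OF R(1,2)] R(3) EE[OF R(1)] EE[OF P] by simp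
  qed
qed

section \<open>Transitivity of the diagonal unitaries\<close>

lemma path_component_map:
  assumes "path_component S x y" "continuous_on S f" "f ` S \<subseteq> T"
  shows "path_component T (f x) (f y)"
proof -
  obtain g where g: "path g" "path_image g \<subseteq> S" "pathstart g = x" "pathfinish g = y"
    using assms(1) unfolding path_component_def by blast
  have "path (f \<circ> g)"
    using g continuous_on_subset[OF assms(2)] by (intro path_continuous_image) auto
  moreover have "path_image (f \<circ> g) \<subseteq> T"
    using g(2) assms(3) by (auto simp: path_image_compose)
  ultimately show ?thesis
    unfolding path_component_def using g(3,4) pathstart_compose pathfinish_compose by metis
qed

lemma projs_conj_by:
  assumes "P \<in> projs a" "unitary V" "\<And>i. conj_by V P $ i $ i = of_real (b i)"
  shows "conj_by V P \<in> projs b"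
  using assms proj_conj_by[of P V] by (simp add: projs_def)

lemma path_component_conj_by:
  assumes "path_component (projs a) P Q" "\<And>R. R \<in> projs a \<Longrightarrow> conj_by V R \<in> projs b"
  shows "path_component (projs b) (conj_by V P) (conj_by V Q)"
proof (rule path_component_map[OF assms(1)])
  show "continuous_on (projs a) (conj_by V)"
    unfolding conj_by_def by (intro continuous_intros)
qed (use assms(2) in auto)

section \<open>Path components modulo diagonal unitaries\<close>

definition cdiag :: "('n \<Rightarrow> 'a) \<Rightarrow> 'a::conj_field^'n^'n" where
  "cdiag s = (\<chi> i j. if i = j then s i else 0)"

definition units :: "('n \<Rightarrow> 'a::conj_field) set" where
  "units = {s. \<forall>i. norm (s i) = 1}"

lemma cdiag_mult: "(cdiag s ** P) $ i $ j = s i * P $ i $ j"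
  by (simp add: cdiag_def matrix_matrix_mult_def if_distrib[of "\<lambda>x. x * _"] cong: if_cong)

lemma mult_cdiag: "(P ** cdiag s) $ i $ j = P $ i $ j * s j"
proof -
  have "(P ** cdiag s) $ i $ j = (\<Sum>k\<in>UNIV. if k = j then P $ i $ k * s j else 0)"
    unfolding cdiag_def matrix_matrix_mult_def vec_lambda_beta by (rule sum.cong) auto
  then show ?thesis by simp
qed

lemma adj_cdiag: "adj (cdiag s) = cdiag (\<lambda>i. cj (s i))"
  by (auto simp: vec_eq_iff cdiag_def)

lemma conj_cdiag: "conj_by (cdiag s) P $ i $ j = s i * P $ i $ j * cj (s j)"
  by (simp add: conj_by_def adj_cdiag mult_cdiag cdiag_mult)

lemma unit_cj: "s \<in> units \<Longrightarrow> s i * cj (s i) = 1" "s \<in> units \<Longrightarrow> cj (s i) * s i = 1"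
  by (auto simp: units_def mult_cj cj_mult_self)

lemma unitary_cdiag:
  assumes "s \<in> units" shows "unitary (cdiag s)"
  using unit_cj[OF assms] unfolding unitary_def vec_eq_iff
  by (auto simp: adj_cdiag mult_cdiag) (auto simp: cdiag_def mat_def)

lemma conj_cdiag_projs:
  assumes "P \<in> projs a" "s \<in> units" shows "conj_by (cdiag s) P \<in> projs a"
proof (rule projs_conj_by[OF assms(1) unitary_cdiag[OF assms(2)]])
  fix i
  have "conj_by (cdiag s) P $ i $ i = (s i * cj (s i)) * P $ i $ i" by (simp add: conj_cdiag mult_ac)
  then show "conj_by (cdiag s) P $ i $ i = of_real (a i)" using unit_cj[OF assms(2)] projs_D(4)[OF assms(1)] by simp
qed

lemma conj_cdiag_mult: "conj_by (cdiag s) (conj_by (cdiag t) P) = conj_by (cdiag (\<lambda>i. s i * t i)) P"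
  by (simp add: vec_eq_iff conj_cdiag cj_mult mult_ac)

lemma units_mult: "s \<in> units \<Longrightarrow> t \<in> units \<Longrightarrow> (\<lambda>i. s i * t i) \<in> units"
  by (simp add: units_def norm_mult)

lemma units_cj: "s \<in> units \<Longrightarrow> (\<lambda>i. cj (s i)) \<in> units"
  by (simp add: units_def)

definition eqv :: "('n \<Rightarrow> real) \<Rightarrow> 'a::conj_field^'n^'n \<Rightarrow> 'a^'n^'n \<Rightarrow> bool" where
  "eqv a P Q \<longleftrightarrow> (\<exists>s\<in>units. path_component (projs a) (conj_by (cdiag s) P) Q)"

lemma cdiag_1: "cdiag (\<lambda>_. 1) = mat 1"
  by (simp add: cdiag_def mat_def vec_eq_iff)

lemma eqv_of_path: "path_component (projs a) P Q \<Longrightarrow> eqv a P Q"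
  unfolding eqv_def by (rule bexI[of _ "\<lambda>_. 1"]) (auto simp: cdiag_1 units_def)

lemma eqv_refl: "P \<in> projs a \<Longrightarrow> eqv a P P"
  by (rule eqv_of_path) (rule path_component_refl)

lemma eqv_trans: "eqv a P Q \<Longrightarrow> eqv a Q R \<Longrightarrow> eqv a P R"
proof -
  assume "eqv a P Q" "eqv a Q R"
  then obtain s t where s: "s \<in> units" "path_component (projs a) (conj_by (cdiag s) P) Q"
    and t: "t \<in> units" "path_component (projs a) (conj_by (cdiag t) Q) R" unfolding eqv_def by blast
  have "path_component (projs a) (conj_by (cdiag t) (conj_by (cdiag s) P)) (conj_by (cdiag t) Q)"
    by (rule path_component_conj_by[OF s(2)]) (rule conj_cdiag_projs[OF _ t(1)])
  then have "path_component (projs a) (conj_by (cdiag (\<lambda>i. t i * s i)) P) R"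
    unfolding conj_cdiag_mult by (rule path_component_trans[OF _ t(2)])
  then show "eqv a P R" unfolding eqv_def using units_mult[OF t(1) s(1)] by blast
qed

lemma eqv_sym: "eqv a P Q \<Longrightarrow> eqv a Q P"
proof -
  assume "eqv a P Q"
  then obtain s where s: "s \<in> units" "path_component (projs a) (conj_by (cdiag s) P) Q" unfolding eqv_def by blast
  have "path_component (projs a) (conj_by (cdiag (\<lambda>i. cj (s i))) (conj_by (cdiag s) P)) (conj_by (cdiag (\<lambda>i. cj (s i))) Q)"
    by (rule path_component_conj_by[OF s(2)]) (rule conj_cdiag_projs[OF _ units_cj[OF s(1)]])
  moreover have "conj_by (cdiag (\<lambda>i. cj (s i))) (conj_by (cdiag s) P) = P"
    unfolding conj_cdiag_mult using unit_cj[OF s(1)] by (simp add: cdiag_1)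
  ultimately show "eqv a Q P" unfolding eqv_def using units_cj[OF s(1)] path_component_sym by metis
qed

lemma eqv_mem: "eqv a P Q \<Longrightarrow> Q \<in> projs a"
  unfolding eqv_def using path_component_mem(2) by blast

lemma projs_bounds:
  assumes "P \<in> projs a" shows "0 \<le> a i" "a i \<le> 1"
proof -
  have n: "0 \<le> b" if "proj R" "R $ i $ i = of_real b" for R :: "'a^'b^'b" and b
    using row_norm[OF that(1), of i] that(2) by (simp add: sum_nonneg)
  show "0 \<le> a i" by (rule n[OF projs_D(1,4)[OF assms]])
  have "(mat 1 - P) $ i $ i = of_real (1 - a i)" using projs_D(4)[OF assms] by (simp add: mat_def)
  from n[OF proj_complement[OF projs_D(1)[OF assms]] this] show "a i \<le> 1" by simp
qed

text \<open>Row \<open>i\<close> of a projection has squared norm \<open>a i\<close>. Hence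
  \<open>a i * (1 - a i)\<close> measures the coupling of coordinate \<open>i\<close> to the others;
  it splits off exactly for the values 0 and 1.\<close>

lemma offdiag_sum:
  assumes "P \<in> projs a" shows "(\<Sum>j\<in>UNIV - {i}. (norm (P $ i $ j))\<^sup>2) = a i - (a i)\<^sup>2"
proof -
  have "a i = (\<Sum>j\<in>UNIV. (norm (P $ i $ j))\<^sup>2)"
    using row_norm[OF projs_D(1)[OF assms], of i] projs_D(4)[OF assms, of i] by simp
  also have "\<dots> = (a i)\<^sup>2 + (\<Sum>j\<in>UNIV - {i}. (norm (P $ i $ j))\<^sup>2)"
    by (subst sum.remove[of UNIV i]) (auto simp: projs_D(4)[OF assms])
  finally show ?thesis by simp
qed

lemma offdiag_zero:
  assumes "P \<in> projs a" "a i = 0 \<or> a i = 1" "j \<noteq> i" shows "P $ i $ j = 0" "P $ j $ i = 0"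
proof -
  have "(\<Sum>j\<in>UNIV - {i}. (norm (P $ i $ j))\<^sup>2) = 0" using offdiag_sum[OF assms(1), of i] assms(2) by auto
  then show "P $ i $ j = 0" using assms(3) by (subst (asm) sum_nonneg_eq_0_iff) auto
  then show "P $ j $ i = 0" using herm_nth[OF projs_D(2)[OF assms(1)], of j i] by simp
qed

lemma offdiag_nonzero:
  assumes "P \<in> projs a" "0 < a i" "a i < 1" obtains j where "j \<noteq> i" "P $ i $ j \<noteq> 0"
proof (rule ccontr)
  assume "\<not> thesis"
  then have "\<And>j. j \<noteq> i \<Longrightarrow> P $ i $ j = 0" using that by blast
  then have "a i - (a i)\<^sup>2 = 0" using offdiag_sum[OF assms(1), of i] by simp
  then have "a i * (1 - a i) = 0" by (simp add: algebra_simps power2_eq_square)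
  then show False using assms by simp
qed

section \<open>Extremal pairs and the rotation that splits them\<close>

definition extremal :: "('n \<Rightarrow> real) \<Rightarrow> 'n \<Rightarrow> 'n \<Rightarrow> 'a::conj_field^'n^'n \<Rightarrow> bool" where
  "extremal a x y P \<longleftrightarrow> P \<in> projs a \<and> (\<exists>p. P $ x $ y = of_real p \<and> p < 0 \<and>
     (p\<^sup>2 = a x * a y \<or> p\<^sup>2 = (1 - a x) * (1 - a y)))"

text \<open>A phase at \<open>x\<close> makes the given entry negative, so its minimum over the
  resulting component is negative too and the variational result applies.\<close>

lemma reach_extremal:
  fixes P :: "'a::conj_field^'n^'n"
  assumes P: "P \<in> projs a" and xy: "x \<noteq> y" and nz: "P $ x $ y \<noteq> 0"
  obtains Q where "eqv a P Q" "extremal a x y Q"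
proof -
  define s where "s i = (if i = x then - cj (P $ x $ y) / of_real (norm (P $ x $ y)) else 1)" for i
  have s: "s \<in> units" using nz by (auto simp: units_def s_def norm_divide)
  define P1 where "P1 = conj_by (cdiag s) P"
  have P1: "P1 \<in> projs a" unfolding P1_def by (rule conj_cdiag_projs[OF P s])
  have "P1 $ x $ y = - (cj (P $ x $ y) * P $ x $ y) / of_real (norm (P $ x $ y))"
    using xy by (simp add: P1_def conj_cdiag s_def)
  also have "\<dots> = of_real (- norm (P $ x $ y))"
    using nz by (simp add: cj_mult_self power2_eq_square)
  finally have neg: "rp (P1 $ x $ y) < 0" using nz by simp
  have "continuous_on UNIV (\<lambda>R :: 'a^'n^'n. rp (R $ x $ y))" by (intro continuous_intros)
  from path_component_minimum[OF P1 this]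
  obtain Q d where Q: "path_component (projs a) P1 Q" "rp (Q $ x $ y) \<le> rp (P1 $ x $ y)" "d > 0"
     "\<And>R. R \<in> projs a \<Longrightarrow> norm (R - Q) < d \<Longrightarrow> rp (Q $ x $ y) \<le> rp (R $ x $ y)"
    using path_component_refl[OF P1] by metis
  have QG: "Q \<in> projs a" using path_component_mem(2)[OF Q(1)] .
  have "rp (Q $ x $ y) < 0" using neg Q(2) by simp
  then obtain p where "Q $ x $ y = of_real p" "p < 0" "p\<^sup>2 = a x * a y \<or> p\<^sup>2 = (1 - a x) * (1 - a y)"
    using extremal_of_minimum[OF QG xy Q(3,4)] by blast
  then have "extremal a x y Q" using QG by (auto simp: extremal_def)
  moreover have "eqv a P Q" using Q(1) s unfolding eqv_def P1_def by blast
  ultimately show thesis using that by blast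
qed

text \<open>\<open>p^2\<close> is bounded by both candidate values, so it is the smaller one, and
  \<open>p < 0\<close> fixes the sign: all extremal blocks with diagonal \<open>a\<close> coincide.
  Their eigenvalues are 0 and \<open>a x + a y\<close>, or 1 and \<open>a x + a y - 1\<close>, so
  one real rotation depending on \<open>a\<close> alone diagonalizes them. Conversely
  \<open>y\<close> is decoupled in any member of \<open>projs b\<close>, so rotating back yields the
  diagonal \<open>a\<close> whatever the rest is.\<close>

lemma reduction:
  fixes a :: "'n::finite \<Rightarrow> real"
  assumes xy: "x \<noteq> y" and a: "0 < a x" "a x < 1" "0 < a y" "a y < 1"
  shows "\<exists>c s b. c \<noteq> 0 \<and> c\<^sup>2 + s\<^sup>2 = (1::real) \<and> (b y = 0 \<or> b y = 1) \<and> (\<forall>i. i \<noteq> x \<longrightarrow> i \<noteq> y \<longrightarrow> b i = a i) \<and>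
    (\<forall>Q :: 'a::conj_field^'n^'n. extremal a x y Q \<longrightarrow> conj_by (givens x y c (of_real s)) Q \<in> projs b) \<and>
    (\<forall>R :: 'a^'n^'n. R \<in> projs b \<longrightarrow> conj_by (adj (givens x y c (of_real s))) R \<in> projs a)"
proof -
  \<comment> \<open>\<open>A\<close> and \<open>B\<close> are the diagonal entries of the singular
    block, that of \<open>Q\<close> or of its complement, and \<open>e\<close> is the sign of its
    off-diagonal entry. Its range is spanned by \<open>(sqrt A, e * sqrt B)\<close>, whose
    normalization is \<open>(c, s)\<close>.\<close>
  define A B e where "A = (if a x + a y \<le> 1 then a x else 1 - a x)"
    "B = (if a x + a y \<le> 1 then a y else 1 - a y)" "e = (if a x + a y \<le> 1 then - 1 else 1 :: real)"
  have AB: "0 < A" "0 < B" using a by (auto simp: A_B_e_def)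
  define c s where "c = sqrt (A / (A + B))" "s = e * sqrt (B / (A + B))"
  define b where "b = a(x := (if a x + a y \<le> 1 then a x + a y else a x + a y - 1),
     y := (if a x + a y \<le> 1 then 0 else 1))"
  have bx: "b x = (if a x + a y \<le> 1 then a x + a y else a x + a y - 1)" and
    by': "b y = (if a x + a y \<le> 1 then 0 else 1)" using xy by (auto simp: b_def)
  have c0: "c \<noteq> 0" using AB by (simp add: c_s_def)
  have ee: "e\<^sup>2 = 1" by (simp add: A_B_e_def)
  have c2: "c\<^sup>2 = A / (A + B)" and s2: "s\<^sup>2 = B / (A + B)"
    using AB by (auto simp: c_s_def power_mult_distrib ee)
  have cs1: "c\<^sup>2 + s\<^sup>2 = 1" using AB by (simp add: c2 s2 add_divide_distrib[symmetric])
  have cs: "c * s = e * sqrt (A * B) / (A + B)"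
    using AB by (simp add: c_s_def real_sqrt_divide real_sqrt_mult)
  have nrm: "c\<^sup>2 + (norm (of_real s :: 'a))\<^sup>2 = 1" "c\<^sup>2 + (norm (of_real (- s) :: 'a))\<^sup>2 = 1" using cs1 by auto
  define U :: "'a^'n^'n" where "U = givens x y c (of_real s)"
  have Uu: "unitary U" unfolding U_def by (rule unitary_givens[OF xy nrm(1)])
  have Ua: "adj U = givens x y c (of_real (- s))" by (simp add: U_def adj_givens[OF xy])
  have Uau: "unitary (adj U)" unfolding Ua by (rule unitary_givens[OF xy nrm(2)])
  have fwd: "conj_by U Q \<in> projs b" if ex: "extremal a x y Q" for Q
  proof (rule projs_conj_by[OF _ Uu])
    show QG: "Q \<in> projs a" using ex by (simp add: extremal_def)
    obtain p where p: "Q $ x $ y = of_real p" "p < 0" "p\<^sup>2 = a x * a y \<or> p\<^sup>2 = (1 - a x) * (1 - a y)"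
      using ex by (auto simp: extremal_def)
    have p': "Q $ y $ x = of_real p" using herm_nth[OF projs_D(2)[OF QG], of y x] p(1) by simp
    have Qd: "Q $ i $ i = of_real (a i)" for i by (rule projs_D(4)[OF QG])
    have D0: "p\<^sup>2 \<le> a x * a y"
      using proj_entry_le[OF projs_D(1)[OF QG], of x y] by (simp add: p Qd)
    have D1: "p\<^sup>2 \<le> (1 - a x) * (1 - a y)"
      using proj_entry_le[OF proj_complement[OF projs_D(1)[OF QG]], of x y] xy
      by (simp add: p Qd mat_def rp_diff)
    have pAB: "p\<^sup>2 = A * B"
    proof (cases "a x + a y \<le> 1")
      case True
      have "a x * a y \<le> (1 - a x) * (1 - a y)" using True by (simp add: algebra_simps)
      then show ?thesis using p(3) D0 True by (auto simp: A_B_e_def)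
    next
      case False
      have "(1 - a x) * (1 - a y) \<le> a x * a y" using False by (simp add: algebra_simps)
      then show ?thesis using p(3) D1 False by (auto simp: A_B_e_def)
    qed
    have "sqrt (p\<^sup>2) = - p" using p(2) by simp
    then have sq: "sqrt (A * B) = - p" by (simp add: pAB)
    have csp: "c * s * p = - e * (A * B) / (A + B)"
      unfolding cs sq using pAB by (simp add: power2_eq_square)
    have xx: "conj_by U Q $ x $ x = of_real (b x)"
    proof -
      have "conj_by U Q $ x $ x = of_real (c\<^sup>2 * a x + 2 * (c * s * p) + s\<^sup>2 * a y)"
        unfolding U_def conj_givens_xx[OF xy] by (simp add: p p' Qd algebra_simps power2_eq_square)
      also have "c\<^sup>2 * a x + 2 * (c * s * p) + s\<^sup>2 * a y = (A * a x - 2 * e * (A * B) + B * a y) / (A + B)"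
        unfolding c2 s2 csp by (simp add: add_divide_distrib diff_divide_distrib)
      also have "\<dots> = b x"
      proof -
        have "A * a x - 2 * e * (A * B) + B * a y = b x * (A + B)"
          unfolding A_B_e_def bx by (simp add: algebra_simps)
        then show ?thesis using AB by simp
      qed
      finally show ?thesis .
    qed
    show "conj_by U Q $ i $ i = of_real (b i)" for i
    proof -
      consider "i = x" | "i = y" | "i \<noteq> x" "i \<noteq> y" by blast
      then show ?thesis
      proof cases
        case 2
        have "conj_by U Q $ x $ x + conj_by U Q $ y $ y = of_real (a x + a y)"
          unfolding U_def conj_givens_sum[OF xy nrm(1)] by (simp add: Qd)
        then have "conj_by U Q $ y $ y = of_real (a x + a y - b x)" unfolding xx by (simp add: algebra_simps)
        also have "a x + a y - b x = b y" by (simp add: bx by')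
        finally show ?thesis using 2 by simp
      next
        case 3
        then show ?thesis unfolding U_def conj_givens_other[OF xy 3] by (simp add: Qd b_def)
      qed (simp add: xx)
    qed
  qed
  have bwd: "conj_by (adj U) R \<in> projs a" if R: "R \<in> projs b" for R
  proof (rule projs_conj_by[OF R Uau])
    have z: "R $ y $ x = 0" "R $ x $ y = 0" using offdiag_zero[OF R, of y x] by' xy by auto
    have Rd: "R $ i $ i = of_real (b i)" for i by (rule projs_D(4)[OF R])
    have xx: "conj_by (adj U) R $ x $ x = of_real (a x)"
    proof -
      have "conj_by (adj U) R $ x $ x = of_real (c\<^sup>2 * b x + s\<^sup>2 * b y)"
        unfolding Ua conj_givens_xx[OF xy] by (simp add: z Rd algebra_simps power2_eq_square)
      also have "c\<^sup>2 * b x + s\<^sup>2 * b y = (A * b x + B * b y) / (A + B)"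
        unfolding c2 s2 by (simp add: add_divide_distrib)
      also have "\<dots> = a x"
      proof -
        have "A * b x + B * b y = a x * (A + B)"
          unfolding A_B_e_def bx by' by (simp add: algebra_simps)
        then show ?thesis using AB by simp
      qed
      finally show ?thesis .
    qed
    show "conj_by (adj U) R $ i $ i = of_real (a i)" for i
    proof -
      consider "i = x" | "i = y" | "i \<noteq> x" "i \<noteq> y" by blast
      then show ?thesis
      proof cases
        case 2
        have "conj_by (adj U) R $ x $ x + conj_by (adj U) R $ y $ y = of_real (b x + b y)"
          unfolding Ua conj_givens_sum[OF xy nrm(2)] by (simp add: Rd)
        then have "conj_by (adj U) R $ y $ y = of_real (b x + b y - a x)" unfolding xx by (simp add: algebra_simps)
        also have "b x + b y - a x = a y" by (simp add: bx by')
        finally show ?thesis using 2 by simp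
      next
        case 3
        then show ?thesis unfolding Ua conj_givens_other[OF xy 3] by (simp add: Rd b_def)
      qed (simp add: xx)
    qed
  qed
  show ?thesis
    by (rule exI[of _ c], rule exI[of _ s], rule exI[of _ b])
      (use c0 cs1 fwd bwd by' in \<open>auto simp: b_def U_def\<close>)
qed

text \<open>On the plane of \<open>x\<close> and \<open>y\<close> the block of \<open>Q\<close> is a
  multiple of the identity, so every real rotation there preserves the diagonal.\<close>

lemma pair_rotation:
  fixes Q :: "'a::conj_field^'n^'n"
  assumes Q: "Q \<in> projs a" and xy: "x \<noteq> y" "Q $ x $ y = 0" "a x = a y"
  shows "path_component (projs a) Q (conj_by (givens x y (cos \<theta>) (of_real (sin \<theta>))) Q)"
proof -
  define g where "g t = conj_by (givens x y (cos (t * \<theta>)) (of_real (sin (t * \<theta>)))) Q" for t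
  have yx: "Q $ y $ x = 0" using herm_nth[OF projs_D(2)[OF Q], of y x] xy(2) by simp
  have nrm: "(cos t)\<^sup>2 + (norm (of_real (sin t) :: 'a))\<^sup>2 = 1" for t by simp
  have GGt: "conj_by (givens x y (cos t) (of_real (sin t))) Q \<in> projs a" for t
  proof (rule projs_conj_by[OF Q unitary_givens[OF xy(1) nrm]])
    let ?R = "conj_by (givens x y (cos t) (of_real (sin t))) Q"
    have "?R $ x $ x = of_real ((cos t)\<^sup>2 * a x + (sin t)\<^sup>2 * a y)"
      unfolding conj_givens_xx[OF xy(1)] by (simp add: xy(2) yx projs_D(4)[OF Q] power2_eq_square mult_ac)
    also have "(cos t)\<^sup>2 * a x + (sin t)\<^sup>2 * a y = a x"
      unfolding xy(3)[symmetric] distrib_right[symmetric] by simp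
    finally have xx: "?R $ x $ x = of_real (a x)" .
    have "?R $ x $ x + ?R $ y $ y = of_real (a x) + of_real (a y)"
      unfolding conj_givens_sum[OF xy(1) nrm] by (simp add: projs_D(4)[OF Q])
    then have yy: "?R $ y $ y = of_real (a y)" using xx by simp
    show "?R $ i $ i = of_real (a i)" for i
    proof (cases "i = x \<or> i = y")
      case False
      then have "i \<noteq> x" "i \<noteq> y" by auto
      then show ?thesis unfolding conj_givens_other[OF xy(1) \<open>i \<noteq> x\<close> \<open>i \<noteq> y\<close>] by (intro projs_D(4)[OF Q])
    qed (use xx yy in auto)
  qed
  have "continuous_on {0..1} g"
    unfolding g_def by (intro continuous_on_conj_by continuous_on_givens continuous_intros)
  moreover have "g 0 = Q" by (simp add: g_def givens_1[OF xy(1)])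
  moreover have "g 1 = conj_by (givens x y (cos \<theta>) (of_real (sin \<theta>))) Q" by (simp add: g_def)
  ultimately show ?thesis
    unfolding path_component_def path_def path_image_def pathstart_def pathfinish_def
    using GGt by (intro exI[of _ g]) (auto simp: g_def)
qed

text \<open>If the entry at \<open>x, y\<close> vanishes, some other \<open>j\<close> is coupled to
  \<open>x\<close>, whence \<open>a j = a y\<close>. Once \<open>x, j\<close> is extremal, a
  rotation of that plane decouples \<open>j\<close>; so if the entry at \<open>x, y\<close> is still
  0, the one at \<open>j, y\<close> is 0 as well. Then \<open>j\<close> and \<open>y\<close> may be
  rotated into each other, which moves part of the nonzero entry at \<open>x, j\<close> to
  \<open>x, y\<close>.\<close>

lemma reach_nonzero:
  fixes P :: "'a::conj_field^'n^'n"
  assumes P: "P \<in> projs a" and xy: "x \<noteq> y" and a: "0 < a x" "a x < 1" "0 < a y" "a y < 1"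
    and two: "\<And>j. j \<noteq> x \<Longrightarrow> a j = 0 \<or> a j = 1 \<or> a j = a y"
  obtains Q where "eqv a P Q" "Q $ x $ y \<noteq> 0"
proof (cases "P $ x $ y = 0")
  case False
  then show thesis using that eqv_refl[OF P] by blast
next
  case True
  obtain j where j: "j \<noteq> x" "P $ x $ j \<noteq> 0" by (rule offdiag_nonzero[OF P a(1,2)])
  have jy: "j \<noteq> y" using j True by auto
  have "a j \<noteq> 0" "a j \<noteq> 1" using offdiag_zero(2)[OF P, of j x] j by auto
  then have aj: "a j = a y" using two[OF j(1)] by blast
  have xj: "x \<noteq> j" using j by simp
  obtain Q where Q: "eqv a P Q" "extremal a x j Q"
    by (rule reach_extremal[OF P xj j(2)])
  then have QG: "Q \<in> projs a" by (simp add: extremal_def)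
  show thesis
  proof (cases "Q $ x $ y = 0")
    case False
    then show thesis using that Q(1) by blast
  next
    case True
    obtain c s b where r: "c \<noteq> 0" "b j = 0 \<or> b j = 1"
      and fwd: "\<And>Q :: 'a^'n^'n. extremal a x j Q \<Longrightarrow> conj_by (givens x j c (of_real s)) Q \<in> projs b"
      using reduction[of x j a, where ?'a = 'a, OF xj a(1,2)] a(3,4) unfolding aj by blast
    have "conj_by (givens x j c (of_real s)) Q $ j $ y = 0"
      by (rule offdiag_zero(1)[OF fwd[OF Q(2)] r(2)]) (use jy in simp)
    then have "of_real c * Q $ j $ y = 0"
      using xy jy xj True by (simp add: conj_by_def mult_adj_givens givens_mult)
    then have jy0: "Q $ j $ y = 0" using r(1) by simp
    define R where "R = conj_by (givens j y (cos (pi / 4)) (of_real (sin (pi / 4)))) Q"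
    have "path_component (projs a) Q R"
      unfolding R_def by (rule pair_rotation[OF QG jy jy0 aj])
    then have "eqv a P R" using eqv_trans[OF Q(1) eqv_of_path] by blast
    moreover have "R $ x $ y = - of_real (sin (pi / 4)) * Q $ x $ j"
      using xy jy xj True by (simp add: R_def conj_by_def mult_adj_givens givens_mult)
    moreover have "Q $ x $ j \<noteq> 0" using Q(2) by (auto simp: extremal_def)
    moreover have "sin (pi / 4) \<noteq> (0::real)" by (simp add: sin_45)
    ultimately show thesis using that by simp
  qed
qed

lemma conj_cdiag_givens:
  assumes "x \<noteq> y" "t x = t y"
  shows "cdiag t ** givens x y c s = givens x y c s ** cdiag t"
  unfolding vec_eq_iff cdiag_mult mult_cdiag
proof (intro allI)
  fix i j
  show "t i * givens x y c s $ i $ j = givens x y c s $ i $ j * t j"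
    using assms by (cases "i = x"; cases "i = y"; cases "j = x"; cases "j = y"; cases "i = j"; simp add: givens_def mult.commute)
qed

text \<open>Each step rotates an extremal pair so that one of its diagonal entries becomes 0 or 1 and the
  corresponding coordinate splits off.\<close>

theorem units_transitive:
  fixes P P' :: "'a::conj_field^'n^'n"
  assumes "\<And>j. j \<noteq> x \<Longrightarrow> a j = 0 \<or> a j = 1 \<or> a j = c" "P \<in> projs a" "P' \<in> projs a"
  shows "eqv a P P'"
  using assms
proof (induction "card {i. 0 < a i \<and> a i < 1}" arbitrary: a x P P' rule: less_induct)
  case less
  note ac = less.prems(1) and P = less.prems(2) and P' = less.prems(3)
  show ?case
  proof (cases "\<exists>i. 0 < a i \<and> a i < 1")
    case False
    then have a01: "a i = 0 \<or> a i = 1" for i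
      using projs_bounds[OF P, of i] by (metis less_eq_real_def)
    have "P $ i $ j = P' $ i $ j" for i j
      using offdiag_zero[OF P a01, of j i] offdiag_zero[OF P' a01, of j i] projs_D(4)[OF P] projs_D(4)[OF P']
      by (cases "j = i") auto
    then have "P = P'" by (simp add: vec_eq_iff)
    then show ?thesis using eqv_refl[OF P] by simp
  next
    case True
    \<comment> \<open>The exceptional index should be fractional. If \<open>a x\<close> is 0 or 1
      there is no exception at all, and any fractional index can serve.\<close>
    then obtain z where z: "0 < a z" "a z < 1" "\<And>j. j \<noteq> z \<Longrightarrow> a j = 0 \<or> a j = 1 \<or> a j = c"
    proof (cases "0 < a x \<and> a x < 1")
      case True
      then show thesis using that[of x] ac by blast
    next
      case False
      then have "a x = 0 \<or> a x = 1" using projs_bounds[OF P, of x] by (metis less_eq_real_def)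
      moreover obtain z where "0 < a z" "a z < 1" using \<open>\<exists>i. 0 < a i \<and> a i < 1\<close> by blast
      ultimately have "a j = 0 \<or> a j = 1 \<or> a j = c" for j using ac[of j] by (cases "j = x") auto
      then show thesis using that[of z] \<open>0 < a z\<close> \<open>a z < 1\<close> by blast
    qed
    obtain y where y: "y \<noteq> z" "P $ z $ y \<noteq> 0" by (rule offdiag_nonzero[OF P z(1,2)])
    have zy: "z \<noteq> y" using y by simp
    have "a y \<noteq> 0" "a y \<noteq> 1" using offdiag_zero(2)[OF P, of y z] y by auto
    then have ay: "0 < a y" "a y < 1" "a y = c" using projs_bounds[OF P, of y] z(3)[OF y(1)] by auto
    have reach: "\<exists>Q. eqv a R Q \<and> extremal a z y Q" if R: "R \<in> projs a" for R :: "'a^'n^'n"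
    proof -
      obtain R1 where R1: "eqv a R R1" "R1 $ z $ y \<noteq> 0"
        by (rule reach_nonzero[OF R zy z(1,2) ay(1,2)]) (use z(3) ay(3) in auto)
      obtain Q where "eqv a R1 Q" "extremal a z y Q"
        by (rule reach_extremal[OF eqv_mem[OF R1(1)] zy R1(2)])
      then show ?thesis using eqv_trans[OF R1(1)] by blast
    qed
    obtain Q where Q: "eqv a P Q" "extremal a z y Q" using reach[OF P] by blast
    obtain Q' where Q': "eqv a P' Q'" "extremal a z y Q'" using reach[OF P'] by blast
    obtain k s b where ks: "k\<^sup>2 + s\<^sup>2 = (1::real)" and b: "b y = 0 \<or> b y = 1" "\<forall>i. i \<noteq> z \<longrightarrow> i \<noteq> y \<longrightarrow> b i = a i"
        and fwd: "\<forall>Q :: 'a^'n^'n. extremal a z y Q \<longrightarrow> conj_by (givens z y k (of_real s)) Q \<in> projs b"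
        and bwd: "\<forall>R :: 'a^'n^'n. R \<in> projs b \<longrightarrow> conj_by (adj (givens z y k (of_real s))) R \<in> projs a"
      using reduction[of z y a, where ?'a = 'a, OF zy z(1,2) ay(1,2)] by blast
    show ?thesis
    proof -
      define U :: "'a^'n^'n" where "U = givens z y k (of_real s)"
      have Uu: "unitary U" unfolding U_def by (rule unitary_givens[OF zy]) (use ks in simp)
      have UU: "conj_by (adj U) (conj_by U R) = R" for R
        using Uu by (simp add: conj_by_mult unitary_def)
      have "{i. 0 < b i \<and> b i < 1} \<subseteq> {i. 0 < a i \<and> a i < 1} - {y}"
      proof
        fix i assume i: "i \<in> {i. 0 < b i \<and> b i < 1}"
        then have "i \<noteq> y" using b(1) by auto
        then show "i \<in> {i. 0 < a i \<and> a i < 1} - {y}" using i z(1,2) b(2) by (cases "i = z") auto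
      qed
      then have lt: "card {i. 0 < b i \<and> b i < 1} < card {i. 0 < a i \<and> a i < 1}"
        using ay by (intro psubset_card_mono) auto
      \<comment> \<open>\<open>y\<close> now has value 0 or 1, and \<open>z\<close> absorbs the new
        value, so the shape of the diagonal survives with exception \<open>z\<close>.\<close>
      have bc: "b j = 0 \<or> b j = 1 \<or> b j = c" if "j \<noteq> z" for j
        using that b z(3)[OF that] by (cases "j = y") auto
      have "eqv b (conj_by U Q) (conj_by U Q')"
        by (rule less.hyps[OF lt bc]) (use fwd Q(2) Q'(2) in \<open>auto simp: U_def\<close>)
      then obtain t where t: "t \<in> units" "path_component (projs b) (conj_by (cdiag t) (conj_by U Q)) (conj_by U Q')"
        unfolding eqv_def by blast
      \<comment> \<open>\<open>y\<close> is decoupled after the rotation, so its phase does not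
        affect the matrix. Giving it the phase of \<open>z\<close> makes the diagonal unitary
        commute with the rotation back.\<close>
      define t' where "t' = t(y := t z)"
      have t'u: "t' \<in> units" using t(1) by (auto simp: units_def t'_def)
      have RG: "conj_by U Q \<in> projs b" using fwd Q(2) by (simp add: U_def)
      have same: "conj_by (cdiag t) (conj_by U Q) = conj_by (cdiag t') (conj_by U Q)"
        unfolding vec_eq_iff conj_cdiag
      proof (intro allI)
        fix i j
        show "t i * conj_by U Q $ i $ j * cj (t j) = t' i * conj_by U Q $ i $ j * cj (t' j)"
        proof (cases "i = j")
          case True
          have "t i * cj (t i) = t' i * cj (t' i)" using unit_cj(1)[OF t(1)] unit_cj(1)[OF t'u] by simp
          then show ?thesis using True by (simp add: mult.commute mult.left_commute)
        next
          case False
          show ?thesis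
          proof (cases "i = y \<or> j = y")
            case True
            then have "conj_by U Q $ i $ j = 0" using offdiag_zero[OF RG b(1)] False by auto
            then show ?thesis by simp
          qed (simp add: t'_def)
        qed
      qed
      have "path_component (projs a) (conj_by (adj U) (conj_by (cdiag t') (conj_by U Q))) (conj_by (adj U) (conj_by U Q'))"
        by (rule path_component_conj_by[OF t(2)[unfolded same]]) (use bwd in \<open>simp add: U_def\<close>)
      moreover have "adj U ** cdiag t' = cdiag t' ** adj U"
        unfolding U_def adj_givens[OF zy] using zy by (intro conj_cdiag_givens[symmetric]) (simp_all add: t'_def)
      then have "conj_by (adj U) (conj_by (cdiag t') (conj_by U Q)) = conj_by (cdiag t') (conj_by (adj U) (conj_by U Q))"
        by (simp add: conj_by_mult matrix_mul_assoc)
      ultimately have "eqv a Q Q'" unfolding eqv_def UU using t'u by auto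
      then show ?thesis using eqv_trans[OF Q(1)] eqv_trans[OF _ eqv_sym[OF Q'(1)]] by blast
    qed
  qed
qed

section \<open>Rank and the complex case\<close>

text \<open>Every row of \<open>P\<close> is fixed by right multiplication with \<open>P\<close>.
  Expanding the rows in a basis \<open>B\<close> of the row space therefore yields coefficient
  vectors dual to \<open>B\<close>, and the trace counts the basis. This works over any field, so
  real and complex rank are covered together.\<close>

lemma trace_idempotent:
  fixes P :: "'a::field^'n^'n"
  assumes P: "P ** P = P"
  shows "trace P = of_nat (rank P)"
proof -
  obtain B where B: "B \<subseteq> rows P" "vec.independent B" "rows P \<subseteq> vec.span B" "card B = vec.dim (rows P)"
    using vec.basis_exists by blast
  have fB: "finite B" using B(2) vec.finiteI_independent by blast
  have "\<exists>u. row i P = (\<Sum>v\<in>B. u v *s v)" for i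
  proof -
    have "row i P \<in> vec.span B" using B(3) by (auto simp: rows_def)
    then show ?thesis unfolding vec.span_finite[OF fB] by blast
  qed
  then obtain u where u: "\<And>i. row i P = (\<Sum>v\<in>B. u i v *s v)" by metis
  have Pij: "P $ i $ j = (\<Sum>v\<in>B. u i v * v $ j)" for i j
    using arg_cong[OF u[of i], of "\<lambda>w. w $ j"] by (simp add: row_def)
  have rowP: "(\<Sum>i\<in>UNIV. v $ i * P $ i $ j) = v $ j" if v: "v \<in> B" for v j
  proof -
    obtain k where "v = row k P" using v B(1) by (auto simp: rows_def)
    then show ?thesis using arg_cong[OF P, of "\<lambda>A. A $ k $ j"] by (simp add: row_def matrix_matrix_mult_def)
  qed
  have dual: "(\<Sum>i\<in>UNIV. v $ i * u i w) = (if w = v then 1 else 0)" if v: "v \<in> B" and w: "w \<in> B" for v w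
  proof -
    define f where "f w = (\<Sum>i\<in>UNIV. v $ i * u i w) - (if w = v then 1 else 0)" for w
    have "(\<Sum>w\<in>B. f w *s w) = 0"
      unfolding vec_eq_iff
    proof
      fix j
      have "(\<Sum>w\<in>B. f w *s w) $ j = (\<Sum>w\<in>B. (\<Sum>i\<in>UNIV. v $ i * u i w) * w $ j) - (\<Sum>w\<in>B. if w = v then v $ j else 0)"
        by (simp add: f_def left_diff_distrib sum_subtractf if_distrib[of "\<lambda>t. t * _"] cong: if_cong)
      also have "(\<Sum>w\<in>B. (\<Sum>i\<in>UNIV. v $ i * u i w) * w $ j) = (\<Sum>i\<in>UNIV. v $ i * P $ i $ j)"
        unfolding Pij sum_distrib_left sum_distrib_right by (subst sum.swap) (simp add: mult.assoc)
      also have "\<dots> = v $ j" by (rule rowP[OF v])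
      also have "(\<Sum>w\<in>B. if w = v then v $ j else 0) = v $ j" using v fB by simp
      finally show "(\<Sum>w\<in>B. f w *s w) $ j = 0 $ j" by simp
    qed
    then have "f w = 0" using vec.independentD[OF B(2) fB subset_refl] w by blast
    then show ?thesis by (simp add: f_def)
  qed
  have "trace P = (\<Sum>i\<in>UNIV. \<Sum>v\<in>B. v $ i * u i v)" by (simp add: trace_def Pij mult.commute)
  also have "\<dots> = (\<Sum>v\<in>B. \<Sum>i\<in>UNIV. v $ i * u i v)" by (rule sum.swap)
  also have "\<dots> = (\<Sum>v\<in>B. 1)" by (rule sum.cong) (simp_all add: dual)
  finally show ?thesis using B(4) by (simp add: row_rank_def_gen)
qed

lemma rank_projs_const:
  fixes P :: "'a::conj_field^'n^'n"
  assumes "P \<in> projs (\<lambda>_. real d / real CARD('n))"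
  shows "rank P = d"
proof -
  have "(of_nat (rank P) :: 'a) = trace P" using trace_idempotent[OF projs_D(3)[OF assms]] by simp
  also have "\<dots> = of_nat d" by (simp add: trace_def projs_D(4)[OF assms])
  finally show ?thesis by simp
qed

lemma G_real_eq: "(G_real d :: (real^'n^'n) set) = projs (\<lambda>_. real d / real CARD('n))"
proof -
  have "adj P = transpose P" for P :: "real^'n^'n"
    by (simp add: vec_eq_iff transpose_def cj_real_def)
  then have "P \<in> G_real d \<longleftrightarrow> P \<in> projs (\<lambda>_. real d / real CARD('n))" for P :: "real^'n^'n"
    using rank_projs_const[of P d] by (simp add: G_real_def projs_def orth_proj_real_def proj_def) blast
  then show ?thesis by blast
qed

lemma G_complex_eq: "(G_complex d :: (complex^'n^'n) set) = projs (\<lambda>_. real d / real CARD('n))"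
proof -
  have "adj P = conj_transpose P" for P :: "complex^'n^'n"
    by (simp add: vec_eq_iff conj_transpose_def cj_complex_def)
  then have "P \<in> G_complex d \<longleftrightarrow> P \<in> projs (\<lambda>_. real d / real CARD('n))" for P :: "complex^'n^'n"
    using rank_projs_const[of P d] by (simp add: G_complex_def projs_def orth_proj_complex_def proj_def) blast
  then show ?thesis by blast
qed

text \<open>Each phase can be moved to 1 along the unit circle by scaling its argument, so
  conjugation by a diagonal unitary does not leave the path component.\<close>

lemma path_connected_projs_complex:
  "path_connected (projs (\<lambda>_. c) :: (complex^'n^'n) set)"
  unfolding path_connected_component
proof (intro ballI)
  fix P Q :: "complex^'n^'n" assume P: "P \<in> projs (\<lambda>_. c)" and Q: "Q \<in> projs (\<lambda>_. c)"
  obtain s where s: "s \<in> units" "path_component (projs (\<lambda>_. c)) (conj_by (cdiag s) P) Q"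
    using units_transitive[OF _ P Q] unfolding eqv_def by blast
  define g where "g t = conj_by (cdiag (\<lambda>i. exp (\<i> * of_real (t * Arg (s i))))) P" for t
  have "continuous_on {0..1} (\<lambda>t. cdiag (\<lambda>i. exp (\<i> * of_real (t * Arg (s i)))) :: complex^'n^'n)"
  proof -
    have "continuous_on {0..1} (\<lambda>t. if i = j then exp (\<i> * of_real (t * Arg (s i))) else 0 :: complex)" for i j
      by (cases "i = j"; simp; intro continuous_intros)
    then show ?thesis unfolding cdiag_def by (intro continuous_on_vec_lambda)
  qed
  then have "continuous_on {0..1} g" unfolding g_def by (intro continuous_on_conj_by continuous_intros)
  moreover have "g 0 = P" by (simp add: g_def cdiag_1)
  moreover have "exp (\<i> * of_real (Arg (s i))) = s i" for i
    using Arg_eq[of "s i"] s(1) by (auto simp: units_def) (metis Arg_eq mult_1 norm_zero of_real_1 zero_neq_one)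
  then have "g 1 = conj_by (cdiag s) P" by (simp add: g_def)
  moreover have "g t \<in> projs (\<lambda>_. c)" for t
    unfolding g_def by (rule conj_cdiag_projs[OF P]) (simp add: units_def norm_exp_i_times)
  ultimately have "path_component (projs (\<lambda>_. c)) P (conj_by (cdiag s) P)"
    unfolding path_component_def path_def path_image_def pathstart_def pathfinish_def
    by (intro exI[of _ g]) auto
  then show "path_component (projs (\<lambda>_. c)) P Q" using s(2) by (rule path_component_trans)
qed

section \<open>Sign changes in the real case\<close>

lemma projs_complement:
  assumes "P \<in> projs (\<lambda>_. c)" shows "mat 1 - P \<in> projs (\<lambda>_. 1 - c)"
proof -
  have "(mat 1 - P) $ i $ i = of_real (1 - c)" for i
    using projs_D(4)[OF assms, of i] by (simp add: mat_def)
  then show ?thesis using proj_complement[OF projs_D(1)[OF assms]] by (simp add: projs_def)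
qed

lemma path_connected_projs_complement:
  assumes "path_connected (projs (\<lambda>_. 1 - c) :: ('a::conj_field^'n^'n) set)"
  shows "path_connected (projs (\<lambda>_. c) :: ('a^'n^'n) set)"
proof -
  have "projs (\<lambda>_. c) = (\<lambda>P. mat 1 - P) ` (projs (\<lambda>_. 1 - c) :: ('a^'n^'n) set)"
  proof (intro equalityI subsetI)
    fix P :: "'a^'n^'n" assume "P \<in> projs (\<lambda>_. c)"
    then show "P \<in> (\<lambda>P. mat 1 - P) ` projs (\<lambda>_. 1 - c)"
      by (intro image_eqI[of _ _ "mat 1 - P"] projs_complement) simp
  next
    fix P :: "'a^'n^'n" assume "P \<in> (\<lambda>P. mat 1 - P) ` projs (\<lambda>_. 1 - c)"
    then show "P \<in> projs (\<lambda>_. c)" using projs_complement[of _ "1 - c"] by auto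
  qed
  moreover have "path_connected ((\<lambda>P. mat 1 - P) ` (projs (\<lambda>_. 1 - c) :: ('a^'n^'n) set))"
    by (rule path_connected_continuous_image[OF _ assms]) (intro continuous_intros)
  ultimately show ?thesis by simp
qed

section \<open>Construction of the special projection\<close>

text \<open>If \<open>t\<close> lies strictly between the two diagonal values, \<open>rot\<close>
  reaches it whatever the entry at \<open>u, v\<close> is. The last clause tracks zeros: a row
  vanishing at \<open>u\<close> and \<open>v\<close> still vanishes at \<open>u\<close> after the
  rotation.\<close>

lemma rotate_to:
  fixes P :: "'a::conj_field^'n^'n"
  assumes P: "P \<in> projs b" and uv: "u \<noteq> v" and t: "(b u - t) * (b v - t) < 0 \<or> b u = t"
  shows "\<exists>R. R \<in> projs (b(u := t, v := b u + b v - t)) \<and>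
    (\<forall>i j. i \<notin> {u, v} \<longrightarrow> j \<notin> {u, v} \<longrightarrow> R $ i $ j = P $ i $ j) \<and>
    (\<forall>i. i \<notin> {u, v} \<longrightarrow> P $ i $ u = 0 \<longrightarrow> P $ i $ v = 0 \<longrightarrow> R $ i $ u = 0)"
proof -
  have Pd: "P $ i $ i = of_real (b i)" for i by (rule projs_D(4)[OF P])
  obtain c and s :: 'a where cs: "rot t u v P = givens u v c s" "c\<^sup>2 + (norm s)\<^sup>2 = 1"
    using rot_givens[of t u v P] by metis
  define R where "R = conj_by (givens u v c s) P"
  have "(rp (P$u$u) - t) * (rp (P$v$v) - t) < (norm (P$u$v))\<^sup>2 \<or> rp (P$u$u) = t"
    using t by (auto simp: Pd intro: less_le_trans)
  then have uu: "R $ u $ u = of_real t"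
    unfolding R_def cs(1)[symmetric] by (rule rot_diag[OF projs_D(2)[OF P] uv])
  have "R $ u $ u + R $ v $ v = of_real (b u + b v)"
    unfolding R_def conj_givens_sum[OF uv cs(2)] by (simp add: Pd)
  then have vv: "R $ v $ v = of_real (b u + b v - t)" unfolding uu by (simp add: algebra_simps)
  have oth: "R $ i $ j = P $ i $ j" if "i \<notin> {u, v}" "j \<notin> {u, v}" for i j
    using that by (simp add: R_def conj_by_def mult_adj_givens[OF uv] givens_mult[OF uv])
  have "R \<in> projs (b(u := t, v := b u + b v - t))"
    unfolding R_def
  proof (rule projs_conj_by[OF P unitary_givens[OF uv cs(2)]])
    fix i
    show "conj_by (givens u v c s) P $ i $ i = of_real ((b(u := t, v := b u + b v - t)) i)"
      using uu vv oth[of i i] uv Pd[of i] unfolding R_def[symmetric] by (cases "i = u"; cases "i = v") auto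
  qed
  moreover have "R $ i $ u = 0" if "i \<notin> {u, v}" "P $ i $ u = 0" "P $ i $ v = 0" for i
    using that by (simp add: R_def conj_by_def mult_adj_givens[OF uv] givens_mult[OF uv])
  ultimately show ?thesis using oth by blast
qed

text \<open>With the right sum, a wrong entry forces one value above and one below \<open>c\<close>.
  Rotating these two makes one of them equal to \<open>c\<close>, so the number of wrong entries
  drops.\<close>

lemma equalize_diagonal:
  fixes P :: "'a::conj_field^'n^'n"
  assumes "P \<in> projs b" "(\<Sum>i\<in>W. b i) = real (card W) * c"
  shows "\<exists>R b'. R \<in> projs b' \<and> (\<forall>i\<in>W. b' i = c) \<and> (\<forall>i. i \<notin> W \<longrightarrow> b' i = b i) \<and>
    (\<forall>i j. i \<notin> W \<longrightarrow> j \<notin> W \<longrightarrow> R $ i $ j = P $ i $ j)"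
  using assms
proof (induction "card {i\<in>W. b i \<noteq> c}" arbitrary: b P rule: less_induct)
  case less
  note P = less.prems(1) and S = less.prems(2)
  show ?case
  proof (cases "\<forall>i\<in>W. b i = c")
    case True
    then show ?thesis using P by blast
  next
    case False
    have Sc: "(\<Sum>i\<in>W. c) = (\<Sum>i\<in>W. b i)" using S by simp
    have "\<exists>u\<in>W. \<exists>v\<in>W. b u > c \<and> b v < c"
    proof (rule ccontr)
      assume no: "\<not> ?thesis"
      then consider "\<forall>i\<in>W. b i \<le> c" | "\<forall>i\<in>W. c \<le> b i" by (meson not_le)
      then show False
      proof cases
        case 1
        then have "(\<Sum>i\<in>W. b i) < (\<Sum>i\<in>W. c)" using False by (intro sum_strict_mono_ex1) (auto simp: less_le)
        then show False using Sc by simp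
      next
        case 2
        then have "(\<Sum>i\<in>W. c) < (\<Sum>i\<in>W. b i)" using False by (intro sum_strict_mono_ex1) (auto simp: less_le)
        then show False using Sc by simp
      qed
    qed
    then obtain u v where uv: "u \<in> W" "v \<in> W" "b u > c" "b v < c" by blast
    then have ne: "u \<noteq> v" by auto
    define b1 where "b1 = b(u := c, v := b u + b v - c)"
    have "(b u - c) * (b v - c) < 0 \<or> b u = c" using uv by (simp add: mult_pos_neg)
    then obtain R where R: "R \<in> projs b1" "\<forall>i j. i \<notin> {u, v} \<longrightarrow> j \<notin> {u, v} \<longrightarrow> R $ i $ j = P $ i $ j"
      using rotate_to[OF P ne, of c] unfolding b1_def by blast
    have "{i\<in>W. b1 i \<noteq> c} \<subseteq> {i\<in>W. b i \<noteq> c} - {u}"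
      using uv ne by (auto simp: b1_def split: if_splits)
    moreover have "u \<in> {i\<in>W. b i \<noteq> c}" using uv by simp
    ultimately have lt: "card {i\<in>W. b1 i \<noteq> c} < card {i\<in>W. b i \<noteq> c}"
      by (intro psubset_card_mono) auto
    have split: "sum f W = f u + (f v + sum f (W - {u} - {v}))" for f :: "'n \<Rightarrow> real"
      using sum.remove[of W u f] sum.remove[of "W - {u}" v f] uv ne by simp
    have "(\<Sum>i\<in>W. b1 i) = b1 u + (b1 v + (\<Sum>i\<in>W - {u} - {v}. b1 i))" by (rule split)
    also have "\<dots> = b u + (b v + (\<Sum>i\<in>W - {u} - {v}. b i))"
      using ne by (simp add: b1_def)
    also have "\<dots> = (\<Sum>i\<in>W. b i)"
      by (rule split[symmetric])
    finally have S1: "(\<Sum>i\<in>W. b1 i) = real (card W) * c" using S by simp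
    obtain R' b' where R': "R' \<in> projs b'" "\<forall>i\<in>W. b' i = c" "\<forall>i. i \<notin> W \<longrightarrow> b' i = b1 i"
       "\<forall>i j. i \<notin> W \<longrightarrow> j \<notin> W \<longrightarrow> R' $ i $ j = R $ i $ j"
      using less.hyps[OF lt R(1) S1] by blast
    have "b' i = b i" if "i \<notin> W" for i using R'(3) that uv by (auto simp: b1_def)
    moreover have "R' $ i $ j = P $ i $ j" if "i \<notin> W" "j \<notin> W" for i j
      using R'(4) R(2) that uv by auto
    ultimately show ?thesis using R'(1,2) by blast
  qed
qed

text \<open>The diagonal is brought to \<open>2 c\<close>, \<open>c\<close>, \<open>0\<close> at
  \<open>x\<close>, \<open>y\<close>, \<open>z\<close> and to \<open>c\<close> elsewhere, with the
  entry at \<open>x, y\<close> kept 0. A 45 degree rotation between \<open>x\<close> and the zero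
  row \<open>z\<close> then halves \<open>2 c\<close> and makes both rows equal. A diagonal value
  \<open>2 c\<close> requires \<open>2 * c \<le> 1\<close>, and \<open>2 \<le> d\<close> provides
  the two initially orthogonal coordinates \<open>x\<close> and \<open>y\<close>.\<close>

lemma exists_special:
  assumes d: "2 \<le> d" "2 * d \<le> CARD('n::finite)"
  obtains Q :: "'a::conj_field^'n^'n" and x y z where
    "Q \<in> projs (\<lambda>_. real d / real CARD('n))" "x \<noteq> y" "x \<noteq> z" "y \<noteq> z" "Q $ x $ y = 0" "\<And>k. Q $ x $ k = Q $ z $ k"
proof -
  define c where "c = real d / real CARD('n)"
  have N: "real CARD('n) > 0" by simp
  have c: "0 < c" "2 * c \<le> 1" using d by (auto simp: c_def field_simps)
  have cN: "real CARD('n) * c = real d" by (simp add: c_def)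
  obtain D :: "'n set" where D: "card D = d"
    using obtain_subset_with_card_n[of d "UNIV :: 'n set"] d by auto
  obtain x y where xy: "x \<in> D" "y \<in> D" "x \<noteq> y"
    using d D card_le_Suc0_iff_eq[of D] by (metis One_nat_def Suc_1 finite not_less_eq_eq)
  have cD: "card (- D) = CARD('n) - d" using D by (simp add: Compl_eq_Diff_UNIV card_Diff_subset)
  define b0 where "b0 i = (if i \<in> D then 1 else 0 :: real)" for i
  have R0: "(rdiag b0 :: 'a^'n^'n) \<in> projs b0"
  proof -
    have "rdiag b0 ** rdiag b0 = (rdiag b0 :: 'a^'n^'n)"
      unfolding vec_eq_iff rdiag_mult by (auto simp: b0_def rdiag_def)
    moreover have "adj (rdiag b0) = (rdiag b0 :: 'a^'n^'n)" by (auto simp: vec_eq_iff rdiag_def)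
    ultimately show ?thesis by (simp add: projs_def proj_def rdiag_def)
  qed
  have S0: "sum b0 UNIV = real d" by (simp add: b0_def D sum.If_cases)
  obtain R1 :: "'a^'n^'n" and b1 z l where zl: "z \<notin> D" "l \<notin> D" "z \<noteq> l"
    and R1: "R1 \<in> projs b1" "b1 x = 2 * c" "b1 y = 1" "b1 z = 0" "b1 l = 0" "sum b1 UNIV = real d"
      "R1 $ x $ y = 0" "R1 $ x $ l = 0"
  proof (cases "2 * c = 1")
    case True
    \<comment> \<open>The entry at \<open>x\<close> already has its target value here. In the other
      case it is lowered from 1 to \<open>2 * c\<close> against a third coordinate \<open>k\<close>
      outside \<open>D\<close>.\<close>
    have "card (- D) \<ge> 2" using cD d by simp
    then obtain z l where "z \<in> - D" "l \<in> - D" "z \<noteq> l"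
      by (metis card_le_Suc0_iff_eq One_nat_def Suc_1 finite not_less_eq_eq)
    then show thesis
      using that[of z l "rdiag b0" b0] R0 S0 True xy by (auto simp: b0_def rdiag_def)
  next
    case False
    then have "2 * d < CARD('n)" using c(2) d by (auto simp: c_def field_simps)
    then have "card (- D) \<ge> 3" using cD d by simp
    then obtain T where T: "T \<subseteq> - D" "card T = 3" using obtain_subset_with_card_n by metis
    then obtain z l k where zlk: "T = {z, l, k}" "z \<noteq> l" "z \<noteq> k" "l \<noteq> k" by (metis card_3_iff)
    then have nD: "z \<notin> D" "l \<notin> D" "k \<notin> D" using T(1) by auto
    have xk: "x \<noteq> k" using xy nD by auto
    have t1: "(b0 x - 2 * c) * (b0 k - 2 * c) < 0 \<or> b0 x = 2 * c"
    proof -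
      have "2 * c < 1" using c(2) False by linarith
      then have "(1 - 2 * c) * (0 - 2 * c) < 0" using c(1) by (intro mult_pos_neg) auto
      then show ?thesis using xy nD by (simp add: b0_def)
    qed
    obtain R :: "'a^'n^'n" where R: "R \<in> projs (b0(x := 2 * c, k := b0 x + b0 k - 2 * c))"
      "\<forall>i. i \<notin> {x, k} \<longrightarrow> (rdiag b0 :: 'a^'n^'n) $ i $ x = 0 \<longrightarrow> (rdiag b0 :: 'a^'n^'n) $ i $ k = 0 \<longrightarrow> R $ i $ x = 0"
      using rotate_to[OF R0 xk t1] by blast
    define b1 where "b1 = b0(x := 2 * c, k := b0 x + b0 k - 2 * c)"
    have yl: "y \<notin> {x, k}" "l \<notin> {x, k}" "z \<notin> {x, k}" using xy nD zlk by auto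
    have z0: "R $ y $ x = 0" "R $ l $ x = 0" using R(2)[rule_format, of y] R(2)[rule_format, of l] yl xy nD by (auto simp: rdiag_def)
    have "R $ x $ y = 0" "R $ x $ l = 0"
      using herm_nth[OF projs_D(2)[OF R(1)], of x y] herm_nth[OF projs_D(2)[OF R(1)], of x l] z0 by auto
    moreover have "sum b1 UNIV = sum b0 UNIV"
      using xk unfolding b1_def by (subst (1 2) sum_split_two[OF xk]) simp
    ultimately show thesis
      using that[of z l R b1] R(1) S0 zlk nD xy xk yl unfolding b1_def[symmetric]
      by (auto simp: b1_def b0_def)
  qed
  have yl: "y \<noteq> l" "x \<noteq> l" "x \<noteq> z" "y \<noteq> z" using xy zl by auto
  have t2: "(b1 y - c) * (b1 l - c) < 0 \<or> b1 y = c" using R1 c by (simp add: mult_pos_neg)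
  obtain R2 :: "'a^'n^'n" where R2: "R2 \<in> projs (b1(y := c, l := b1 y + b1 l - c))"
    "\<forall>i. i \<notin> {y, l} \<longrightarrow> R1 $ i $ y = 0 \<longrightarrow> R1 $ i $ l = 0 \<longrightarrow> R2 $ i $ y = 0"
    using rotate_to[OF R1(1) yl(1) t2] by blast
  define b2 where "b2 = b1(y := c, l := b1 y + b1 l - c)"
  have R2xy: "R2 $ x $ y = 0" using R2(2)[rule_format, of x] R1(7,8) xy yl by simp
  have S2: "sum b2 UNIV = real d"
    using yl unfolding b2_def R1(6)[symmetric] by (subst (1 2) sum_split_two[OF yl(1)]) simp
  have b2: "b2 x = 2 * c" "b2 y = c" "b2 z = 0" using R1 xy yl zl by (auto simp: b2_def)
  define W where "W = UNIV - {x, y, z}"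
  have cW: "card W = CARD('n) - 3" unfolding W_def using xy yl by (subst card_Diff_subset) auto
  have N3: "3 \<le> CARD('n)" using d by simp
  have "sum b2 UNIV = sum b2 W + sum b2 {x, y, z}"
    unfolding W_def by (rule sum.subset_diff) auto
  then have "sum b2 W = real d - 3 * c" using S2 b2 xy yl by simp
  also have "\<dots> = real (card W) * c" unfolding cW cN[symmetric] using N3 by (simp add: of_nat_diff algebra_simps)
  finally obtain R3 b3 where R3: "R3 \<in> projs b3" "\<forall>i\<in>W. b3 i = c" "\<forall>i. i \<notin> W \<longrightarrow> b3 i = b2 i"
    "\<forall>i j. i \<notin> W \<longrightarrow> j \<notin> W \<longrightarrow> R3 $ i $ j = R2 $ i $ j"
    using equalize_diagonal[OF R2(1)[folded b2_def]] by metis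
  have xyz: "x \<notin> W" "y \<notin> W" "z \<notin> W" by (auto simp: W_def)
  have b3: "b3 x = 2 * c" "b3 y = c" "b3 z = 0" "\<And>i. i \<noteq> x \<Longrightarrow> i \<noteq> y \<Longrightarrow> i \<noteq> z \<Longrightarrow> b3 i = c"
    using R3(2,3) xyz b2 by (auto simp: W_def)
  have R3xy: "R3 $ x $ y = 0" using R3(4) xyz R2xy by simp
  have R3z: "R3 $ z $ j = 0" "R3 $ j $ z = 0" for j
    using offdiag_zero[OF R3(1), of z j] b3(3) projs_D(4)[OF R3(1), of z] by (cases "j = z"; simp)+
  define h where "h = 1 / sqrt (2::real)"
  have h2: "h * h = 1 / 2" by (simp add: h_def)
  have nrm: "h\<^sup>2 + (norm (of_real (- h) :: 'a))\<^sup>2 = 1" by (simp add: power2_eq_square h2)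
  define G :: "'a^'n^'n" where "G = givens x z h (of_real (- h))"
  define Q where "Q = conj_by G R3"
  have xz: "x \<noteq> z" by (rule yl)
  have Qx: "Q $ x $ k = Q $ z $ k" for k
    using xz by (simp add: Q_def G_def conj_by_def mult_adj_givens[OF xz] givens_mult[OF xz] R3z)
  have Qxy: "Q $ x $ y = 0"
    using xy yl by (simp add: Q_def G_def conj_by_def mult_adj_givens[OF xz] givens_mult[OF xz] R3z R3xy)
  have "Q $ x $ x = of_real (h * h * (2 * c))"
    unfolding Q_def G_def conj_givens_xx[OF xz] using projs_D(4)[OF R3(1), of x] b3(1) by (simp add: R3z)
  then have Qxx: "Q $ x $ x = of_real c" by (simp add: h2)
  have "Q $ x $ x + Q $ z $ z = of_real (b3 x + b3 z)"
    unfolding Q_def G_def conj_givens_sum[OF xz nrm] using projs_D(4)[OF R3(1)] by simp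
  then have Qzz: "Q $ z $ z = of_real c" unfolding Qxx b3 by (simp add: algebra_simps mult_2)
  have "Q \<in> projs (\<lambda>_. c)"
    unfolding Q_def
  proof (rule projs_conj_by[OF R3(1)])
    show "unitary G" unfolding G_def by (rule unitary_givens[OF xz nrm])
    fix i
    show "conj_by G R3 $ i $ i = of_real c"
    proof (cases "i = x \<or> i = z")
      case False
      then have "conj_by G R3 $ i $ i = R3 $ i $ i" unfolding G_def by (intro conj_givens_other[OF xz]) auto
      also have "\<dots> = of_real c" using projs_D(4)[OF R3(1), of i] b3 False by (cases "i = y") auto
      finally show ?thesis .
    qed (use Qxx Qzz in \<open>auto simp: Q_def\<close>)
  qed
  then show thesis using that[of Q x y z] xy yl Qx Qxy by (simp add: c_def)
qed

section \<open>Sign changes and transpositions acting on path components\<close>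

abbreviation linked :: "real \<Rightarrow> 'a::conj_field^'n^'n \<Rightarrow> 'a^'n^'n \<Rightarrow> bool" where
  "linked c \<equiv> path_component (projs (\<lambda>_. c))"

definition permute :: "('n \<Rightarrow> 'n) \<Rightarrow> 'a^'n^'n \<Rightarrow> 'a^'n^'n" where
  "permute \<pi> P = (\<chi> i j. P $ \<pi> i $ \<pi> j)"

definition swap :: "'n \<Rightarrow> 'n \<Rightarrow> 'n \<Rightarrow> 'n" where
  "swap x y k = (if k = x then y else if k = y then x else k)"

definition signs :: "'n set \<Rightarrow> 'n \<Rightarrow> real" where
  "signs A k = (if k \<in> A then - 1 else 1)"

lemma permute_nth [simp]: "permute \<pi> P $ i $ j = P $ \<pi> i $ \<pi> j" by (simp add: permute_def)

lemma swap_swap [simp]: "swap x y (swap x y k) = k" by (simp add: swap_def)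

lemma bij_swap: "bij (swap x y)" by (rule o_bij[of "swap x y"]) (auto simp: fun_eq_iff)

lemma permute_permute: "permute \<pi> (permute \<rho> P) = permute (\<rho> \<circ> \<pi>) P" by (simp add: vec_eq_iff)

lemma permute_conj_cdiag: "permute \<pi> (conj_by (cdiag s) P) = conj_by (cdiag (s \<circ> \<pi>)) (permute \<pi> P)"
  by (simp add: vec_eq_iff conj_cdiag)

lemma permute_projs:
  fixes P :: "'a::conj_field^'n^'n"
  assumes "P \<in> projs (\<lambda>_. c)" "bij \<pi>" shows "permute \<pi> P \<in> projs (\<lambda>_. c)"
proof -
  have "(permute \<pi> P ** permute \<pi> P) $ i $ j = permute \<pi> P $ i $ j" for i j
  proof -
    have "(permute \<pi> P ** permute \<pi> P) $ i $ j = (\<Sum>k\<in>UNIV. P $ \<pi> i $ k * P $ k $ \<pi> j)"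
      unfolding matrix_matrix_mult_def using assms(2)
      by (simp add: sum.reindex_bij_betw[of \<pi> UNIV UNIV "\<lambda>k. P $ \<pi> i $ k * P $ k $ \<pi> j"])
    then show ?thesis using arg_cong[OF projs_D(3)[OF assms(1)], of "\<lambda>A. A $ \<pi> i $ \<pi> j"]
      by (simp add: matrix_matrix_mult_def)
  qed
  then have "permute \<pi> P ** permute \<pi> P = permute \<pi> P" by (simp add: vec_eq_iff)
  moreover have "adj (permute \<pi> P) = permute \<pi> P"
    unfolding vec_eq_iff adj_nth permute_nth using herm_nth[OF projs_D(2)[OF assms(1)]] by metis
  ultimately show ?thesis using projs_D(4)[OF assms(1)] by (simp add: projs_def proj_def)
qed

lemma path_component_permute:
  fixes P Q :: "'a::conj_field^'n^'n"
  assumes "linked c P Q" "bij \<pi>"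
  shows "linked c (permute \<pi> P) (permute \<pi> Q)"
proof (rule path_component_map[OF assms(1)])
  show "continuous_on (projs (\<lambda>_. c)) (permute \<pi>)"
    unfolding permute_def by (intro continuous_on_vec_lambda continuous_intros)
qed (use permute_projs assms(2) in auto)

lemma signs_units: "signs A \<in> units" by (simp add: units_def signs_def)

lemma units_real: assumes "s \<in> units" shows "s = signs {k. s k = - 1}"
proof
  fix k
  have "\<bar>s k\<bar> = 1" using assms by (simp add: units_def)
  then have "s k = 1 \<or> s k = - 1" by linarith
  then show "s k = signs {k. s k = - 1} k" by (auto simp: signs_def)
qed

lemma signs_swap: "signs A \<circ> swap x y = signs (swap x y ` A)"
proof
  fix k
  have "swap x y k \<in> A \<longleftrightarrow> k \<in> swap x y ` A" by (metis image_iff swap_swap)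
  then show "(signs A \<circ> swap x y) k = signs (swap x y ` A) k" by (simp add: signs_def)
qed

definition flip :: "real \<Rightarrow> 'n::finite set \<Rightarrow> bool" where
  "flip c A \<longleftrightarrow> (\<forall>P::real^'n^'n. P \<in> projs (\<lambda>_. c) \<longrightarrow> linked c (conj_by (cdiag (signs A)) P) P)"

lemma flip_Diff:
  fixes A B :: "'n::finite set"
  assumes "flip c A" "flip c B" shows "flip c ((A - B) \<union> (B - A))"
  unfolding flip_def
proof (intro allI impI)
  fix P :: "real^'n^'n" assume P: "P \<in> projs (\<lambda>_. c)"
  have "(\<lambda>k. signs A k * signs B k) = signs ((A - B) \<union> (B - A))" by (auto simp: signs_def)
  then have "conj_by (cdiag (signs ((A - B) \<union> (B - A)))) P = conj_by (cdiag (signs A)) (conj_by (cdiag (signs B)) P)"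
    by (simp add: conj_cdiag_mult)
  moreover have "linked c (conj_by (cdiag (signs A)) (conj_by (cdiag (signs B)) P)) (conj_by (cdiag (signs B)) P)"
    using assms(1) conj_cdiag_projs[OF P signs_units] by (simp add: flip_def)
  moreover have "linked c (conj_by (cdiag (signs B)) P) P"
    using assms(2) P by (simp add: flip_def)
  ultimately show "linked c (conj_by (cdiag (signs ((A - B) \<union> (B - A)))) P) P"
    using path_component_trans by metis
qed

text \<open>Renaming coordinates maps the projections with constant diagonal to themselves
  continuously and permutes the sign patterns.\<close>

lemma flip_swap:
  fixes A :: "'n::finite set"
  assumes "flip c A" shows "flip c (swap x y ` A)"
  unfolding flip_def
proof (intro allI impI)
  fix P :: "real^'n^'n" assume P: "P \<in> projs (\<lambda>_. c)"
  have "linked c (conj_by (cdiag (signs A)) (permute (swap x y) P)) (permute (swap x y) P)"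
    using assms permute_projs[OF P bij_swap] by (simp add: flip_def)
  moreover have "permute (swap x y) (permute (swap x y) P) = P" by (simp add: vec_eq_iff)
  ultimately show "linked c (conj_by (cdiag (signs (swap x y ` A))) P) P"
    using path_component_permute[OF _ bij_swap, of c _ "permute (swap x y) P" x y] permute_conj_cdiag signs_swap by metis
qed

text \<open>The diagonal signs act transitively on the path components and commute, so a sign change that
  fixes one component fixes all of them.\<close>

lemma flip_of_component:
  fixes Q :: "real^'n^'n"
  assumes Q: "linked c (conj_by (cdiag (signs A)) Q) Q"
  shows "flip c A"
  unfolding flip_def
proof (intro allI impI)
  fix P :: "real^'n^'n" assume P: "P \<in> projs (\<lambda>_. c)"
  have "Q \<in> projs (\<lambda>_. c)" using path_component_mem(2)[OF Q] .
  then have "eqv (\<lambda>_. c) Q P" using units_transitive[of undefined "\<lambda>_. c" c Q P] P by simp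
  then obtain u where u: "u \<in> units" "linked c (conj_by (cdiag u) Q) P"
    unfolding eqv_def by blast
  have "linked c (conj_by (cdiag (signs A)) (conj_by (cdiag u) Q)) (conj_by (cdiag (signs A)) P)"
    by (rule path_component_conj_by[OF u(2)]) (rule conj_cdiag_projs[OF _ signs_units])
  moreover have "linked c (conj_by (cdiag u) (conj_by (cdiag (signs A)) Q)) (conj_by (cdiag u) Q)"
    by (rule path_component_conj_by[OF Q]) (rule conj_cdiag_projs[OF _ u(1)])
  moreover have "conj_by (cdiag u) (conj_by (cdiag (signs A)) Q) = conj_by (cdiag (signs A)) (conj_by (cdiag u) Q)"
    by (simp add: conj_cdiag_mult mult.commute)
  ultimately show "linked c (conj_by (cdiag (signs A)) P) P"
    using u(2) path_component_sym path_component_trans by metis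
qed

lemma flip_all:
  assumes "\<And>i::'n::finite. flip c {i}" shows "flip c (A :: 'n set)"
proof -
  have "finite A" by simp
  then show ?thesis
  proof induction
    case empty
    have "signs {} = (\<lambda>_::'n. 1)" by (auto simp: signs_def)
    then show ?case by (simp add: flip_def cdiag_1 path_component_refl)
  next
    case (insert x A)
    have "({x} - A) \<union> (A - {x}) = insert x A" using insert.hyps by auto
    then show ?case using flip_Diff[OF assms insert.IH, of x] by simp
  qed
qed

lemma path_connected_projs_of_flip_singleton:
  assumes "\<And>i::'n::finite. flip c {i}"
  shows "path_connected (projs (\<lambda>_. c) :: (real^'n^'n) set)"
  unfolding path_connected_component
proof (intro ballI)
  fix P Q :: "real^'n^'n" assume P: "P \<in> projs (\<lambda>_. c)" and Q: "Q \<in> projs (\<lambda>_. c)"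
  obtain s where s: "s \<in> units" "linked c (conj_by (cdiag s) P) Q"
    using units_transitive[of undefined "\<lambda>_. c" c P Q] P Q unfolding eqv_def by auto
  have "linked c (conj_by (cdiag s) P) P"
    using flip_all[OF assms, of "{k. s k = - 1}"] P units_real[OF s(1)] by (simp add: flip_def)
  then show "linked c P Q"
    using s(2) path_component_sym path_component_trans by metis
qed

text \<open>A half turn gives \<open>flip c {x, y}\<close>, and renaming gives further pairs. A
  quarter turn shows that \<open>\<tau>\<close> acts on the component of \<open>Q\<close> as the
  flip of \<open>y\<close>. Since \<open>\<sigma>\<close> exchanges equal rows, it fixes
  \<open>Q\<close>, and its conjugate \<open>\<rho> = \<sigma> \<tau> \<sigma>\<close> also acts as
  a single flip. But \<open>\<sigma> = \<tau> \<rho> \<tau>\<close> then amounts to three flips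
  while fixing \<open>Q\<close>; removing a pair leaves one flip that preserves the
  component.\<close>

lemma flip_singleton:
  fixes Q :: "real^'n^'n" and i :: 'n
  assumes Q: "Q \<in> projs (\<lambda>_. c)" and ne: "x \<noteq> y" "x \<noteq> z" "y \<noteq> z"
    and Qxy: "Q $ x $ y = 0" and Qxz: "\<And>k. Q $ x $ k = Q $ z $ k"
  shows "flip c {i}"
proof -
  let ?S = "\<lambda>A. conj_by (cdiag (signs A)) :: real^'n^'n \<Rightarrow> real^'n^'n"
  note trans = path_component_trans[of "projs (\<lambda>_. c) :: (real^'n^'n) set"] and sym = path_component_sym[of "projs (\<lambda>_. c) :: (real^'n^'n) set"]
  have S_path: "linked c (?S A P) (?S A R)" if "linked c P R" for A P R
    by (rule path_component_conj_by[OF that]) (rule conj_cdiag_projs[OF _ signs_units])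
  have SS: "?S A (?S A P) = P" for A P
  proof -
    have "(\<lambda>k. signs A k * signs A k) = (\<lambda>_. 1)" by (auto simp: signs_def)
    then show ?thesis by (simp add: conj_cdiag_mult cdiag_1)
  qed
  have "givens x y (cos pi) (of_real (sin pi)) = cdiag (signs {x, y})"
  proof -
    have "givens x y (- 1) 0 $ i $ j = cdiag (signs {x, y}) $ i $ j" for i j
      using ne by (cases "i = x"; cases "i = y"; cases "j = x"; cases "j = y"; simp add: givens_def cdiag_def signs_def)
    then show ?thesis by (simp add: vec_eq_iff)
  qed
  then have "linked c Q (?S {x, y} Q)"
    using pair_rotation[OF Q ne(1) Qxy, of pi] by simp
  then have fxy: "flip c {x, y}" by (rule flip_of_component[OF sym])
  have pair_x: "flip c {x, j}" if "j \<noteq> x" for j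
  proof (cases "j = y")
    case False
    have "swap y j ` {x, y} = {x, j}" using that ne False by (auto simp: swap_def)
    then show ?thesis using flip_swap[OF fxy, of y j] by simp
  qed (use fxy in simp)
  define \<tau> \<sigma> \<rho> where "\<tau> = swap x y" "\<sigma> = swap x z" "\<rho> = swap y z"
  have bij: "bij \<tau>" "bij \<sigma>" "bij \<rho>" by (auto simp: \<tau>_\<sigma>_\<rho>_def bij_swap)
  have "conj_by (givens x y (cos (pi/2)) (of_real (sin (pi/2)))) Q = ?S {y} (permute \<tau> Q)"
    unfolding vec_eq_iff
  proof (intro allI)
    fix i j
    show "conj_by (givens x y (cos (pi/2)) (of_real (sin (pi/2)))) Q $ i $ j = ?S {y} (permute \<tau> Q) $ i $ j"
      using ne unfolding conj_by_def[of "givens _ _ _ _"] mult_adj_givens[OF ne(1)] givens_mult[OF ne(1)] conj_cdiag permute_nth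
      by (cases "i = x"; cases "i = y"; cases "j = x"; cases "j = y"; simp add: \<tau>_\<sigma>_\<rho>_def swap_def signs_def cj_real_def)
  qed
  then have "linked c Q (?S {y} (permute \<tau> Q))"
    using pair_rotation[OF Q ne(1) Qxy, of "pi/2"] by simp
  from S_path[OF this, of "{y}"] have \<tau>Q: "linked c (permute \<tau> Q) (?S {y} Q)"
    unfolding SS by (rule sym)
  have Qsym: "Q $ j $ i = Q $ i $ j" for i j
    using herm_nth[OF projs_D(2)[OF Q], of j i] by (simp add: cj_real_def)
  have \<sigma>Q: "permute \<sigma> Q = Q"
  proof -
    have r: "Q $ \<sigma> i $ j = Q $ i $ j" for i j using Qxz by (simp add: \<tau>_\<sigma>_\<rho>_def swap_def)
    have "Q $ \<sigma> i $ \<sigma> j = Q $ i $ j" for i j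
      using r[of i "\<sigma> j"] r[of j i] Qsym by metis
    then show ?thesis by (simp add: vec_eq_iff)
  qed
  have \<sigma>\<tau>\<sigma>: "\<sigma> \<circ> \<tau> \<circ> \<sigma> = \<rho>" and \<tau>\<rho>\<tau>: "\<tau> \<circ> \<rho> \<circ> \<tau> = \<sigma>"
    using ne by (auto simp: \<tau>_\<sigma>_\<rho>_def swap_def fun_eq_iff)
  have pmS: "permute \<pi> (?S A P) = conj_by (cdiag (signs A \<circ> \<pi>)) (permute \<pi> P)" for \<pi> A P by (rule permute_conj_cdiag)
  have \<rho>Q: "linked c (permute \<rho> Q) (?S {y} Q)"
  proof -
    have "permute \<rho> Q = permute \<sigma> (permute \<tau> (permute \<sigma> Q))" unfolding permute_permute by (simp add: \<sigma>\<tau>\<sigma>[symmetric] comp_assoc)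
    then have "permute \<rho> Q = permute \<sigma> (permute \<tau> Q)" by (simp only: \<sigma>Q)
    moreover have "permute \<sigma> (?S {y} Q) = ?S {y} Q"
    proof -
      have "signs {y} \<circ> \<sigma> = signs {y}" unfolding \<tau>_\<sigma>_\<rho>_def signs_swap using ne by (simp add: swap_def)
      then show ?thesis by (simp add: pmS \<sigma>Q)
    qed
    ultimately show ?thesis using path_component_permute[OF \<tau>Q bij(2)] by simp
  qed
  have fzy: "flip c {y, z}"
  proof -
    have "({x, y} - {x, z}) \<union> ({x, z} - {x, y}) = {y, z}" using ne by auto
    then show ?thesis using flip_Diff[OF fxy pair_x[of z]] ne by simp
  qed
  have "linked c Q (permute \<tau> (permute \<rho> (?S {y} Q)))"
  proof -
    have "Q = permute \<tau> (permute \<rho> (permute \<tau> Q))" unfolding permute_permute using \<sigma>Q by (simp add: \<tau>\<rho>\<tau> comp_assoc[symmetric])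
    then show ?thesis using path_component_permute[OF path_component_permute[OF \<tau>Q bij(3)] bij(1)] by simp
  qed
  also have "permute \<rho> (?S {y} Q) = ?S {z} (permute \<rho> Q)"
  proof -
    have "signs {y} \<circ> \<rho> = signs {z}" unfolding \<tau>_\<sigma>_\<rho>_def signs_swap using ne by (simp add: swap_def)
    then show ?thesis by (simp add: pmS)
  qed
  finally have 1: "linked c Q (permute \<tau> (?S {z} (permute \<rho> Q)))" .
  have "linked c (permute \<tau> (?S {z} (permute \<rho> Q))) (permute \<tau> (?S {z} (?S {y} Q)))"
    by (rule path_component_permute[OF S_path[OF \<rho>Q] bij(1)])
  moreover have "?S {z} (?S {y} Q) = ?S {y, z} Q"
  proof -
    have "(\<lambda>k. signs {z} k * signs {y} k) = signs {y, z}" using ne by (auto simp: signs_def)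
    then show ?thesis by (simp add: conj_cdiag_mult)
  qed
  moreover have "linked c (permute \<tau> (?S {y, z} Q)) (permute \<tau> Q)"
    by (rule path_component_permute[OF _ bij(1)]) (use fzy Q in \<open>simp add: flip_def\<close>)
  ultimately have "linked c Q (?S {y} Q)"
    using 1 \<tau>Q trans by metis
  then have fy: "flip c {y}" by (rule flip_of_component[OF sym])
  have "swap y i ` {y} = {i}" by (simp add: swap_def)
  then show ?thesis using flip_swap[OF fy, of y i] by simp
qed

theorem corollary1p3:
  shows "(\<forall>d::nat. 1 \<le> d \<and> d \<le> CARD('n::finite) \<longrightarrow>
            path_connected (G_complex d :: (complex^'n^'n) set)) \<and>
         (\<forall>d::nat. 2 \<le> d \<and> d + 2 \<le> CARD('m::finite) \<longrightarrow>
            path_connected (G_real d :: (real^'m^'m) set))"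
proof (intro conjI allI impI)
  fix d :: nat
  show "path_connected (G_complex d :: (complex^'n^'n) set)"
    unfolding G_complex_eq by (rule path_connected_projs_complex)
next
  fix d :: nat assume d: "2 \<le> d \<and> d + 2 \<le> CARD('m)"
  \<comment> \<open>The special projection exists for rank at most half the dimension. Larger ranks
    are reached through \<open>mat 1 - P\<close>, whose rank \<open>CARD('m) - d\<close> is at least
    2 because \<open>d + 2 \<le> CARD('m)\<close>.\<close>
  have half: "path_connected (projs (\<lambda>_. real k / real CARD('m)) :: (real^'m^'m) set)"
    if k: "2 \<le> k" "2 * k \<le> CARD('m)" for k
  proof -
    obtain Q :: "real^'m^'m" and x y z where
      "Q \<in> projs (\<lambda>_. real k / real CARD('m))" "x \<noteq> y" "x \<noteq> z" "y \<noteq> z" "Q $ x $ y = 0" "\<And>j. Q $ x $ j = Q $ z $ j"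
      using exists_special[OF k] by blast
    then show ?thesis by (intro path_connected_projs_of_flip_singleton flip_singleton[of Q])
  qed
  show "path_connected (G_real d :: (real^'m^'m) set)"
    unfolding G_real_eq
  proof (cases "2 * d \<le> CARD('m)")
    case True
    then show "path_connected (projs (\<lambda>_. real d / real CARD('m)) :: (real^'m^'m) set)"
      using half d by blast
  next
    case False
    have "1 - real d / real CARD('m) = real (CARD('m) - d) / real CARD('m)"
      using d by (simp add: of_nat_diff diff_divide_distrib)
    moreover have "path_connected (projs (\<lambda>_. real (CARD('m) - d) / real CARD('m)) :: (real^'m^'m) set)"
      by (rule half) (use d False in auto)
    ultimately have "path_connected (projs (\<lambda>_. 1 - real d / real CARD('m)) :: (real^'m^'m) set)"
      by (simp only:)
    then show "path_connected (projs (\<lambda>_. real d / real CARD('m)) :: (real^'m^'m) set)"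
      by (rule path_connected_projs_complement)
  qed
qed

end
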